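(* Let $V=\{0,1,\ldots,9,a,b\}$ be a set of twelve vertex labels and let $\zeta=(0,1,2,\ldots,9,a,b)$ be the cyclic permutation of $V$ of order $12$. Up to combinatorial equivalence there exist exactly three combinatorial $4$-manifolds $M$ with vertex set $V$ such that $\zeta$ is an automorphism of $M$, the $1$-simplex $\langle 0\,6\rangle$ is a diagonal of $M$, and $f_4(M)=72=6f_0(M)=18\chi(M)$. These three combinatorially distinct types can be represented by $M_1,M_2,M_3$ such that each $|M_i|$ ($1\leqslant i\leqslant 3$) is PL-homeomorphic to $S^2\times S^2$, and such that their automorphism groups are $$\mathrm{Aut}(M_1)\cong C_{12}\rtimes C_2,\qquad \mathrm{Aut}(M_2)\cong A_5\rtimes C_4,\qquad \mathrm{Aut}(M_3)\cong C_{12}\rtimes(C_2\times C_2).$$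
   Context: A finite (abstract) simplicial complex $M$ is a combinatorial manifold of dimension $n$ if every simplex of $M$ has dimension at most $n$ and, for every $0\leqslant k\leqslant n$, the link of every $k$-simplex of $M$ is a triangulated $(n-k-1)$-sphere (with $S^{-1}=\emptyset$). A diagonal of $M$ is an edge (pair of vertices of $M$) that does not itself belong to $M$. Two simplicial complexes $M,M'$ are combinatorially equivalent, written $M\sim M'$, if there is a bijection $\phi$ between their faces with $F_1\subset F_2$ if and only if $\phi(F_1)\subset\phi(F_2)$. $|M|$ denotes the underlying space of $M$ (the union of its simplices), $f_i(M)$ the number of $i$-dimensional faces of $M$, and $\chi(M)$ the Euler characteristic. An automorphism of $M$ is a permutation of its vertices mapping simplices to simplices (in both directions); $\mathrm{Aut}(M)$ is the group of all automorphisms. $\langle v_0 \ldots v_k\rangle$ denotes the simplex with vertices $v_0,\ldots,v_k$. $C_k$ is the cyclic group of order $k$, $A_5$ the alternating group on five letters, and $N\rtimes H$ denotes a semidirect product of $N$ by $H$, with $N$ the normal factor; the statement does not specify the action, i.e. it asserts isomorphism to the semidirect product for some action of $H$ on $N$. *)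

theory Defs
  imports
    "HOL-Analysis.Analysis"
    "HOL-Algebra.Bij"
    "HOL-Algebra.Elementary_Groups"
    "HOL-Algebra.Sym_Groups"
begin

section \<open>Finite abstract simplicial complexes\<close>

text \<open>The empty face is not listed among the faces, so the empty complex is the empty set
  and face counts range over dimensions 0 and above.\<close>

definition abstract_complex :: "'a set set \<Rightarrow> bool" where
  "abstract_complex M \<longleftrightarrow>
     finite M \<and> (\<forall>F\<in>M. finite F \<and> F \<noteq> {}) \<and> (\<forall>F\<in>M. \<forall>G. G \<subseteq> F \<and> G \<noteq> {} \<longrightarrow> G \<in> M)"

definition vertices :: "'a set set \<Rightarrow> 'a set" where
  "vertices M = \<Union>M"

definition faces :: "nat \<Rightarrow> 'a set set \<Rightarrow> 'a set set" where
  "faces i M = {F \<in> M. card F = i + 1}"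

definition f_number :: "nat \<Rightarrow> 'a set set \<Rightarrow> nat" where
  "f_number i M = card (faces i M)"

text \<open>No face has more than \<open>card (vertices M)\<close> vertices, so all later terms would vanish.\<close>

definition euler_char :: "'a set set \<Rightarrow> int" where
  "euler_char M = (\<Sum>i<card (vertices M). (-1) ^ i * int (f_number i M))"

definition link :: "'a set \<Rightarrow> 'a set set \<Rightarrow> 'a set set" where
  "link F M = {G \<in> M. G \<inter> F = {} \<and> G \<union> F \<in> M}"

definition diagonal :: "'a set \<Rightarrow> 'a set set \<Rightarrow> bool" where
  "diagonal e M \<longleftrightarrow> e \<subseteq> vertices M \<and> card e = 2 \<and> e \<notin> M"

definition combinatorially_equivalent :: "'a set set \<Rightarrow> 'b set set \<Rightarrow> bool" (infix "\<sim>\<^sub>c" 50) where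
  "M \<sim>\<^sub>c M' \<longleftrightarrow>
     (\<exists>\<phi>. bij_betw \<phi> M M' \<and> (\<forall>F\<^sub>1\<in>M. \<forall>F\<^sub>2\<in>M. F\<^sub>1 \<subseteq> F\<^sub>2 \<longleftrightarrow> \<phi> F\<^sub>1 \<subseteq> \<phi> F\<^sub>2))"

definition automorphism :: "'a set set \<Rightarrow> ('a \<Rightarrow> 'a) \<Rightarrow> bool" where
  "automorphism M \<pi> \<longleftrightarrow>
     \<pi> permutes vertices M \<and> (\<forall>F. F \<subseteq> vertices M \<longrightarrow> (F \<in> M \<longleftrightarrow> \<pi> ` F \<in> M))"

definition Aut :: "'a set set \<Rightarrow> ('a \<Rightarrow> 'a) monoid" where
  "Aut M = \<lparr>carrier = {\<pi>. automorphism M \<pi>}, monoid.mult = (\<circ>), one = id\<rparr>"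


section \<open>Underlying spaces and combinatorial manifolds\<close>

text \<open>Vertices are placed at the standard basis vectors, so that each abstract face spans a
  geometric simplex and the underlying space is the union of these simplices.\<close>

definition underlying_space :: "'v::finite set set \<Rightarrow> (real ^ 'v) set" where
  "underlying_space M = (\<Union>F\<in>M. convex hull ((\<lambda>v. axis v 1) ` F))"

definition triangulated_sphere :: "int \<Rightarrow> 'v::finite set set \<Rightarrow> bool" where
  "triangulated_sphere d L \<longleftrightarrow>
     abstract_complex L \<and>
     (d = -1 \<and> underlying_space L = {} \<or>
      d \<ge> 0 \<and> top_of_set (underlying_space L) homeomorphic_space nsphere (nat d))"

definition combinatorial_manifold :: "nat \<Rightarrow> 'v::finite set set \<Rightarrow> bool" where
  "combinatorial_manifold n M \<longleftrightarrow>
     abstract_complex M \<and>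
     (\<forall>F\<in>M. card F \<le> n + 1) \<and>
     (\<forall>k\<le>n. \<forall>F\<in>faces k M. triangulated_sphere (int n - int k - 1) (link F M))"


section \<open>PL homeomorphism\<close>

text \<open>For compact polyhedra: a map is piecewise linear if the domain is a finite union of
  polytopes on each of which the map is affine.  Continuity follows, since the pieces are
  finitely many closed sets.\<close>

definition piecewise_linear_on ::
  "'a::euclidean_space set \<Rightarrow> ('a \<Rightarrow> 'b::euclidean_space) \<Rightarrow> bool" where
  "piecewise_linear_on S f \<longleftrightarrow>
     (\<exists>\<P>. finite \<P> \<and> \<Union>\<P> = S \<and>
        (\<forall>P\<in>\<P>. polytope P \<and> (\<exists>L c. linear L \<and> (\<forall>x\<in>P. f x = L x + c))))"

definition PL_homeomorphic ::
  "'a::euclidean_space set \<Rightarrow> 'b::euclidean_space set \<Rightarrow> bool" where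
  "PL_homeomorphic S T \<longleftrightarrow>
     (\<exists>f g. homeomorphism S T f g \<and> piecewise_linear_on S f \<and> piecewise_linear_on T g)"

text \<open>The standard PL 2-sphere is the boundary of a 3-simplex, here the one whose vertices are
  the four elements of the numeral type \<open>4\<close>; the product carries the product PL structure.\<close>

definition PL_S2 :: "(real ^ 4) set" where
  "PL_S2 = underlying_space {F :: 4 set. F \<noteq> {} \<and> F \<noteq> UNIV}"

definition PL_S2_times_S2 :: "((real ^ 4) \<times> (real ^ 4)) set" where
  "PL_S2_times_S2 = PL_S2 \<times> PL_S2"


section \<open>Semidirect products\<close>

definition semidirect_product ::
  "('a, 'c) monoid_scheme \<Rightarrow> ('b \<Rightarrow> 'a \<Rightarrow> 'a) \<Rightarrow> ('b, 'd) monoid_scheme \<Rightarrow> ('a \<times> 'b) monoid" where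
  "semidirect_product N \<phi> H =
     \<lparr>carrier = carrier N \<times> carrier H,
      monoid.mult = (\<lambda>(n, h) (n', h'). (n \<otimes>\<^bsub>N\<^esub> \<phi> h n', h \<otimes>\<^bsub>H\<^esub> h')),
      one = (\<one>\<^bsub>N\<^esub>, \<one>\<^bsub>H\<^esub>)\<rparr>"

lemma group_semidirect_product:
  assumes "group N" "group H" "\<phi> \<in> hom H (AutoGroup N)"
  shows "group (semidirect_product N \<phi> H)"
proof -
  interpret N: group N by fact
  interpret H: group H by fact
  interpret \<phi>: group_hom H "AutoGroup N" \<phi>
    by (simp add: group_hom_def group_hom_axioms_def assms N.AutoGroup)
  have aut: "\<phi> h \<in> hom N N \<inter> Bij (carrier N)" if "h \<in> carrier H" for h
    using \<phi>.hom_closed[OF that] by (simp add: AutoGroup_def auto_def)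
  have cl: "\<phi> h n \<in> carrier N" if "h \<in> carrier H" "n \<in> carrier N" for h n
    using aut[OF that(1)] that(2) by (auto simp: hom_def)
  have mult: "\<phi> h (m \<otimes>\<^bsub>N\<^esub> n) = \<phi> h m \<otimes>\<^bsub>N\<^esub> \<phi> h n"
    if "h \<in> carrier H" "m \<in> carrier N" "n \<in> carrier N" for h m n
    using aut[OF that(1)] that by (auto simp: hom_def)
  have comp: "\<phi> (h \<otimes>\<^bsub>H\<^esub> k) n = \<phi> h (\<phi> k n)"
    if "h \<in> carrier H" "k \<in> carrier H" "n \<in> carrier N" for h k n
    using that aut by (simp add: \<phi>.hom_mult AutoGroup_def BijGroup_def compose_def)
  have one: "\<phi> \<one>\<^bsub>H\<^esub> n = n" if "n \<in> carrier N" for n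
    using \<phi>.hom_one that by (simp add: AutoGroup_def BijGroup_def)
  have hone: "\<phi> h \<one>\<^bsub>N\<^esub> = \<one>\<^bsub>N\<^esub>" if "h \<in> carrier H" for h
    using mult[OF that N.one_closed N.one_closed] cl[OF that N.one_closed] by simp
  show ?thesis
  proof (rule groupI)
    fix x assume x: "x \<in> carrier (semidirect_product N \<phi> H)"
    then obtain n h where nh: "x = (n, h)" "n \<in> carrier N" "h \<in> carrier H"
      by (auto simp: semidirect_product_def)
    let ?k = "inv\<^bsub>H\<^esub> h"
    have "\<phi> ?k (inv\<^bsub>N\<^esub> n) \<otimes>\<^bsub>N\<^esub> \<phi> ?k n = \<one>\<^bsub>N\<^esub>"
      using nh cl mult[of ?k "inv\<^bsub>N\<^esub> n" n] hone[of ?k] by simp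
    then show "\<exists>y\<in>carrier (semidirect_product N \<phi> H).
        y \<otimes>\<^bsub>semidirect_product N \<phi> H\<^esub> x = \<one>\<^bsub>semidirect_product N \<phi> H\<^esub>"
      using nh cl by (intro bexI[of _ "(\<phi> ?k (inv\<^bsub>N\<^esub> n), ?k)"])
        (auto simp: semidirect_product_def simp del: \<phi>.hom_inv)
  qed (auto simp: semidirect_product_def cl mult comp one N.m_assoc H.m_assoc
      simp del: \<phi>.hom_mult \<phi>.hom_one)
qed

definition iso_semidirect ::
  "('g, 'e) monoid_scheme \<Rightarrow> ('a, 'c) monoid_scheme \<Rightarrow> ('b, 'd) monoid_scheme \<Rightarrow> bool" where
  "iso_semidirect G N H \<longleftrightarrow> (\<exists>\<phi> \<in> hom H (AutoGroup N). G \<cong> semidirect_product N \<phi> H)"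


section \<open>Twelve vertices with a cyclic symmetry\<close>

text \<open>The labels \<open>0, \<dots>, 9, a, b\<close> are the twelve elements \<open>0, \<dots>, 9, 10, 11\<close> of the numeral
  type \<open>12\<close>, whose arithmetic is modulo 12.\<close>

definition zeta :: "12 \<Rightarrow> 12" where
  "zeta = cycle_of_list [0, 1, 2, 3, 4, 5, 6, 7, 8, 9, 10, 11]"

lemma exhaust_12:
  fixes v :: 12
  shows "v \<in> {0, 1, 2, 3, 4, 5, 6, 7, 8, 9, 10, 11}"
proof (cases v)
  case (of_int z)
  then have "z \<in> {0, 1, 2, 3, 4, 5, 6, 7, 8, 9, 10, 11}" by simp presburger
  then show ?thesis using of_int by auto
qed

lemma zeta_eq: "zeta v = v + 1"
  using exhaust_12[of v] by (auto simp: zeta_def transpose_def)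

definition admissible :: "12 set set \<Rightarrow> bool" where
  "admissible M \<longleftrightarrow>
     combinatorial_manifold 4 M \<and> vertices M = UNIV \<and> automorphism M zeta \<and> diagonal {0, 6} M \<and>
     f_number 4 M = 72 \<and> 72 = 6 * f_number 0 M \<and> 72 = 18 * euler_char M"

end

theory Submission
  imports Defs "HOL-Homology.Invariance_of_Domain"
begin

text \<open>The rotations of the diagonal \<open>{0, 6}\<close> are the six pairs of antipodal vertices, so a facet
  has one vertex in each of five of these pairs, and up to rotation it is one of sixteen explicit sets.
  That every 3-face lies in exactly two facets turns the classification into a finite constraint
  problem on the sixteen orbits. Its solutions with 72 facets and Euler characteristic 4 are three
  complexes and the mirror images of two of them under \<open>x \<mapsto> -x\<close>. Explicit sequences of bistellar
  flips carry the links of these complexes to boundaries of simplices and the complexes themselves to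
  the staircase triangulation of a product of two boundaries of 3-simplices. An automorphism is a
  rotation after an element of the stabilizer of \<open>0\<close>, which is found by a backtracking search; the
  orders 24, 240 and 48 of the automorphism groups distinguish the three complexes.\<close>

section \<open>Piecewise linear homeomorphisms and bistellar flips\<close>

text \<open>Being a manifold and being PL-homeomorphic to the product are statements about spaces,
  while the data are lists of facets. The bridge is that a bistellar flip is induced by an explicit
  piecewise linear bijection in barycentric coordinates, so a list of flips is a certificate that
  can be checked by evaluation. The product is triangulated with 16 vertices, four more than the
  complexes have, so each flip sequence also creates four vertices by subdividing facets. This
  triangulation is compared with the product by one linear map, row and column sums, which avoids
  any theory of subdivisions. Apart from the symmetry, the diagonal and the face numbers, the
  classification uses only that every face lies in a 4-face and every 3-face in exactly two; spheres
  have to be recognized only for the complexes that are found. For the group of order 240 the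
  vertices are read as five-cycles, so that automorphisms become twisted conjugations by
  permutations of five points; the equality of two counts then shows that every twisted conjugation
  occurs.\<close>

lemma convex_hull_axis:
  fixes F :: "'v::finite set"
  shows "convex hull ((\<lambda>v. axis v (1::real)) ` F) =
    {x. (\<forall>v. 0 \<le> x $ v) \<and> (\<Sum>v\<in>UNIV. x $ v) = 1 \<and> (\<forall>v. v \<notin> F \<longrightarrow> x $ v = 0)}"
    (is "?L = ?R")
proof
  have "convex ?R"
    by (rule convexI) (simp add: sum.distrib flip: sum_distrib_left)
  moreover have "(\<lambda>v. axis v 1) ` F \<subseteq> ?R"
    by (auto simp: axis_def)
  ultimately show "?L \<subseteq> ?R"
    by (rule hull_minimal[rotated])
  show "?R \<subseteq> ?L"
  proof
    fix x assume x: "x \<in> ?R"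
    have "(\<Sum>v\<in>F. x $ v) = (\<Sum>v\<in>UNIV. x $ v)"
      using x by (intro sum.mono_neutral_left) auto
    then have 1: "(\<Sum>v\<in>F. x $ v) = 1"
      using x by simp
    have "x = (\<Sum>v\<in>F. x $ v *\<^sub>R axis v 1)"
      using x by (auto simp: vec_eq_iff axis_def if_distrib cong: if_cong)
    also have "\<dots> \<in> ?L"
      by (rule convex_sum) (use x 1 in \<open>auto intro: hull_inc\<close>)
    finally show "x \<in> ?L" .
  qed
qed

lemma abstract_complex_subset: "abstract_complex K \<Longrightarrow> F \<in> K \<Longrightarrow> G \<subseteq> F \<Longrightarrow> G \<noteq> {} \<Longrightarrow> G \<in> K"
  unfolding abstract_complex_def by blast

text \<open>The support of a point is the smallest vertex set whose simplex contains it. As the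
  complex is closed under nonempty subsets, the point is covered as soon as this one set is a
  face.\<close>

lemma in_underlying_space_iff:
  fixes K :: "'v::finite set set"
  assumes "abstract_complex K"
  shows "x \<in> underlying_space K \<longleftrightarrow>
    (\<forall>v. 0 \<le> x $ v) \<and> (\<Sum>v\<in>UNIV. x $ v) = 1 \<and> {v. x $ v \<noteq> 0} \<in> K"
proof -
  have supp: "{v. x $ v \<noteq> 0} \<subseteq> F \<longleftrightarrow> (\<forall>v. v \<notin> F \<longrightarrow> x $ v = 0)" for F
    by auto
  have "x \<in> underlying_space K \<longleftrightarrow>
      (\<forall>v. 0 \<le> x $ v) \<and> (\<Sum>v\<in>UNIV. x $ v) = 1 \<and> (\<exists>F\<in>K. {v. x $ v \<noteq> 0} \<subseteq> F)"
    by (auto simp: underlying_space_def convex_hull_axis supp)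
  moreover have "{v. x $ v \<noteq> 0} \<in> K" if "(\<Sum>v\<in>UNIV. x $ v) = 1" "F \<in> K" "{v. x $ v \<noteq> 0} \<subseteq> F" for F
  proof (rule abstract_complex_subset[OF assms that(2,3)])
    show "{v. x $ v \<noteq> 0} \<noteq> {}"
      using that(1) by force
  qed
  ultimately show ?thesis
    by blast
qed

lemma polytope_axis_hull: "polytope (convex hull ((\<lambda>v::'v::finite. axis v (1::real)) ` F))"
  by (simp add: polytope_convex_hull)

lemma polyhedron_affine_vimage:
  fixes L :: "'a::euclidean_space \<Rightarrow> 'b::euclidean_space"
  assumes "linear L" "polyhedron Q"
  shows "polyhedron {x. L x + c \<in> Q}"
proof -
  obtain \<F> where \<F>: "finite \<F>" "Q = \<Inter>\<F>" "\<forall>h\<in>\<F>. \<exists>a b. a \<noteq> 0 \<and> h = {x. a \<bullet> x \<le> b}"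
    using assms(2) unfolding polyhedron_def by blast
  have "polyhedron {x. L x + c \<in> h}" if "h \<in> \<F>" for h
  proof -
    obtain a b where "h = {x. a \<bullet> x \<le> b}"
      using bspec[OF \<F>(3) \<open>h \<in> \<F>\<close>] by blast
    \<comment> \<open>The normal \<open>adjoint L a\<close> may vanish; the preimage is then empty
      or the whole space, which still counts as a polyhedron.\<close>
    then have "{x. L x + c \<in> h} = {x. adjoint L a \<bullet> x \<le> b - a \<bullet> c}"
      by (simp add: inner_add_right adjoint_clauses(2)[OF assms(1)] le_diff_eq)
    then show ?thesis
      by (simp add: polyhedron_halfspace_le)
  qed
  moreover have "{x. L x + c \<in> Q} = \<Inter> ((\<lambda>h. {x. L x + c \<in> h}) ` \<F>)"
    using \<F>(2) by auto
  ultimately show ?thesis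
    using \<F>(1) by (auto intro!: polyhedron_Inter)
qed

section \<open>Composition and inversion of piecewise linear maps\<close>

lemma piecewise_linear_on_imp_continuous_on:
  assumes "piecewise_linear_on S f"
  shows "continuous_on S f"
proof -
  obtain \<P> where \<P>: "finite \<P>" "\<Union>\<P> = S"
    "\<forall>P\<in>\<P>. polytope P \<and> (\<exists>L c. linear L \<and> (\<forall>x\<in>P. f x = L x + c))"
    using assms unfolding piecewise_linear_on_def by blast
  have "continuous_on P f" if P: "P \<in> \<P>" for P
  proof -
    obtain L c where "linear L" "\<forall>x\<in>P. f x = L x + c"
      using \<P>(3) P by blast
    then show ?thesis
      by (auto simp: linear_continuous_on linear_linear intro!: continuous_on_add
          intro: continuous_on_eq[of _ "\<lambda>x. L x + c"])
  qed
  then have "continuous_on (\<Union>P\<in>\<P>. P) f"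
    using \<P> by (intro continuous_on_closed_Union) (auto intro: polytope_imp_closed)
  then show ?thesis
    using \<P>(2) by simp
qed

text \<open>The pieces of the composite are the sets of points of a piece \<open>P\<close> that
  \<open>f\<close> sends into a piece \<open>Q\<close>. Since \<open>f\<close> is affine on
  \<open>P\<close>, such a set is the intersection of a polytope with a polyhedron.\<close>

lemma piecewise_linear_on_compose:
  assumes f: "piecewise_linear_on S f" and g: "piecewise_linear_on T g" and "f ` S \<subseteq> T"
  shows "piecewise_linear_on S (g \<circ> f)"
proof -
  obtain \<P> where \<P>: "finite \<P>" "\<Union>\<P> = S"
    "\<forall>P\<in>\<P>. polytope P \<and> (\<exists>L c. linear L \<and> (\<forall>x\<in>P. f x = L x + c))"
    using f unfolding piecewise_linear_on_def by blast
  obtain \<Q> where \<Q>: "finite \<Q>" "\<Union>\<Q> = T"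
    "\<forall>Q\<in>\<Q>. polytope Q \<and> (\<exists>L c. linear L \<and> (\<forall>x\<in>Q. g x = L x + c))"
    using g unfolding piecewise_linear_on_def by blast
  let ?R = "(\<lambda>(P, Q). {x \<in> P. f x \<in> Q}) ` (\<P> \<times> \<Q>)"
  have "polytope {x \<in> P. f x \<in> Q} \<and> (\<exists>L c. linear L \<and> (\<forall>x\<in>{x \<in> P. f x \<in> Q}. (g \<circ> f) x = L x + c))"
    if "P \<in> \<P>" "Q \<in> \<Q>" for P Q
  proof -
    obtain L c where L: "linear L" "\<forall>x\<in>P. f x = L x + c"
      using \<P>(3) \<open>P \<in> \<P>\<close> by blast
    obtain L' c' where L': "linear L'" "\<forall>x\<in>Q. g x = L' x + c'"
      using \<Q>(3) \<open>Q \<in> \<Q>\<close> by blast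
    have "{x \<in> P. f x \<in> Q} = P \<inter> {x. L x + c \<in> Q}"
      using L(2) by auto
    then have "polytope {x \<in> P. f x \<in> Q}"
      using \<P>(3) \<Q>(3) that L(1)
      by (simp add: polytope_Int_polyhedron polyhedron_affine_vimage polytope_imp_polyhedron)
    moreover have "\<forall>x\<in>{x \<in> P. f x \<in> Q}. (g \<circ> f) x = (L' \<circ> L) x + (L' c + c')"
      using L L' by (auto simp: linear_add)
    ultimately show ?thesis
      using linear_compose[OF L(1) L'(1)] by blast
  qed
  moreover have "\<Union>?R = S"
  proof
    show "\<Union>?R \<subseteq> S"
      using \<P>(2) by blast
    show "S \<subseteq> \<Union>?R"
    proof
      fix x assume "x \<in> S"
      then obtain P Q where "P \<in> \<P>" "x \<in> P" "Q \<in> \<Q>" "f x \<in> Q"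
        using \<P>(2) \<Q>(2) \<open>f ` S \<subseteq> T\<close> by blast
      then show "x \<in> \<Union>?R"
        by (intro UnionI[of "{x \<in> P. f x \<in> Q}"] image_eqI[of _ _ "(P, Q)"]) auto
    qed
  qed
  ultimately show ?thesis
    unfolding piecewise_linear_on_def using \<P>(1) \<Q>(1)
    by (intro exI[of _ ?R]) auto
qed

lemma PL_homeomorphicI:
  assumes "piecewise_linear_on S f" "piecewise_linear_on T g"
    "\<And>x. x \<in> S \<Longrightarrow> f x \<in> T" "\<And>y. y \<in> T \<Longrightarrow> g y \<in> S"
    "\<And>x. x \<in> S \<Longrightarrow> g (f x) = x" "\<And>y. y \<in> T \<Longrightarrow> f (g y) = y"
  shows "PL_homeomorphic S T"
proof -
  have "f ` S = T"
  proof
    show "T \<subseteq> f ` S"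
      using assms(4,6) by (metis imageI subsetI)
  qed (use assms(3) in blast)
  moreover have "g ` T = S"
  proof
    show "S \<subseteq> g ` T"
      using assms(3,5) by (metis imageI subsetI)
  qed (use assms(4) in blast)
  ultimately show ?thesis
    unfolding PL_homeomorphic_def homeomorphism_def
    using assms piecewise_linear_on_imp_continuous_on[OF assms(1)]
      piecewise_linear_on_imp_continuous_on[OF assms(2)]
    by blast
qed

lemma PL_homeomorphic_sym: "PL_homeomorphic S T \<Longrightarrow> PL_homeomorphic T S"
  unfolding PL_homeomorphic_def by (meson homeomorphism_sym)

lemma PL_homeomorphic_trans:
  assumes "PL_homeomorphic S T" "PL_homeomorphic T U"
  shows "PL_homeomorphic S U"
proof -
  obtain f g f' g' where *: "homeomorphism S T f g" "piecewise_linear_on S f" "piecewise_linear_on T g"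
    "homeomorphism T U f' g'" "piecewise_linear_on T f'" "piecewise_linear_on U g'"
    using assms unfolding PL_homeomorphic_def by blast
  then have "homeomorphism S U (f' \<circ> f) (g \<circ> g')"
    by (blast intro: homeomorphism_compose)
  moreover have "piecewise_linear_on S (f' \<circ> f)" "piecewise_linear_on U (g \<circ> g')"
    using * by (auto intro!: piecewise_linear_on_compose[of _ _ T] simp: homeomorphism_def)
  ultimately show ?thesis
    unfolding PL_homeomorphic_def by blast
qed

lemma PL_homeomorphic_imp_homeomorphic: "PL_homeomorphic S T \<Longrightarrow> S homeomorphic T"
  unfolding PL_homeomorphic_def homeomorphic_def by blast

text \<open>A linear map that is injective on a convex set has an affine inverse there because
  differences of points of the set span the directions that occur.\<close>

lemma linear_inj_on_convex_affine_inverse: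
  fixes f :: "'a::euclidean_space \<Rightarrow> 'b::euclidean_space"
  assumes f: "linear f" and inj: "inj_on f P" and P: "convex P"
  shows "\<exists>L c. linear L \<and> (\<forall>x\<in>P. L (f x) + c = x)"
proof (cases "P = {}")
  case True
  then show ?thesis
    by (intro exI[of _ "\<lambda>_. 0"]) (auto simp: linear_iff)
next
  case False
  then obtain a where a: "a \<in> P"
    by blast
  \<comment> \<open>The cone of directions from \<open>a\<close> into \<open>P\<close>. Its
    difference set \<open>?T\<close> below is a subspace that contains \<open>P - a\<close>, and
    injectivity of \<open>f\<close> on \<open>P\<close> carries over to it.\<close>
  let ?C = "{r *\<^sub>R (x - a) |r x. 0 \<le> r \<and> x \<in> P}"
  have add: "u + w \<in> ?C" if u: "u \<in> ?C" and w: "w \<in> ?C" for u w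
  proof -
    obtain r x where 1: "u = r *\<^sub>R (x - a)" "0 \<le> r" "x \<in> P"
      using u by blast
    obtain s y where 2: "w = s *\<^sub>R (y - a)" "0 \<le> s" "y \<in> P"
      using w by blast
    note * = 1 2
    show ?thesis
    proof (cases "r + s = 0")
      case True
      then have "u + w = 0 *\<^sub>R (a - a)" using * by (simp add: add_nonneg_eq_0_iff)
      then show ?thesis using a by blast
    next
      case False
      let ?z = "(r / (r + s)) *\<^sub>R x + (s / (r + s)) *\<^sub>R y"
      have "?z \<in> P"
        using * False P by (intro convexD) (auto simp flip: add_divide_distrib)
      moreover have "(r + s) *\<^sub>R ?z = r *\<^sub>R x + s *\<^sub>R y"
        using False by (simp add: scaleR_add_right)
      then have "(r + s) *\<^sub>R (?z - a) = (r *\<^sub>R x + s *\<^sub>R y) - (r + s) *\<^sub>R a"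
        by (simp only: scaleR_diff_right)
      then have "u + w = (r + s) *\<^sub>R (?z - a)"
        using *(1,4) by (simp add: scaleR_diff_right scaleR_left_distrib)
      ultimately show ?thesis
        using * by (metis (mono_tags, lifting) add_nonneg_nonneg mem_Collect_eq)
    qed
  qed
  have scale: "t *\<^sub>R u \<in> ?C" if "u \<in> ?C" "0 \<le> t" for u t
  proof -
    obtain r x where "u = r *\<^sub>R (x - a)" "0 \<le> r" "x \<in> P"
      using \<open>u \<in> ?C\<close> by blast
    then have "t *\<^sub>R u = (t * r) *\<^sub>R (x - a)" "0 \<le> t * r"
      using \<open>0 \<le> t\<close> by auto
    then show ?thesis
      using \<open>x \<in> P\<close> by blast
  qed
  let ?T = "{u - w |u w. u \<in> ?C \<and> w \<in> ?C}"
  have zero: "0 \<in> ?C"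
    using a by force
  have "subspace ?T"
  proof (rule subspaceI)
    show "0 \<in> ?T" using zero by force
    fix p q assume "p \<in> ?T" "q \<in> ?T"
    obtain u w where "p = u - w" "u \<in> ?C" "w \<in> ?C"
      using \<open>p \<in> ?T\<close> by blast
    obtain u' w' where "q = u' - w'" "u' \<in> ?C" "w' \<in> ?C"
      using \<open>q \<in> ?T\<close> by blast
    have "p + q = (u + u') - (w + w')"
      using \<open>p = u - w\<close> \<open>q = u' - w'\<close> by simp
    moreover have "u + u' \<in> ?C" "w + w' \<in> ?C"
      by (intro add \<open>u \<in> ?C\<close> \<open>w \<in> ?C\<close> \<open>u' \<in> ?C\<close> \<open>w' \<in> ?C\<close>)+
    ultimately show "p + q \<in> ?T" by blast
  next
    fix t p assume "p \<in> ?T"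
    then obtain u w where *: "p = u - w" "u \<in> ?C" "w \<in> ?C" by blast
    show "t *\<^sub>R p \<in> ?T"
    proof (cases "0 \<le> t")
      case True
      note scale[OF *(2) True] scale[OF *(3) True]
      moreover have "t *\<^sub>R p = t *\<^sub>R u - t *\<^sub>R w"
        by (simp add: *(1) scaleR_diff_right)
      ultimately show ?thesis by blast
    next
      case False
      then have "0 \<le> - t"
        by simp
      note scale[OF *(2) this] scale[OF *(3) this]
      moreover have "t *\<^sub>R p = (- t) *\<^sub>R w - (- t) *\<^sub>R u"
        by (simp add: *(1) scaleR_diff_right)
      ultimately show ?thesis by blast
    qed
  qed
  moreover have "inj_on f ?T"
  proof (subst linear_injective_on_subspace_0)
    show "linear f" by fact
    show "subspace ?T" by fact
    show "\<forall>x\<in>?T. f x = 0 \<longrightarrow> x = 0"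
    proof (intro ballI impI)
      fix p assume "p \<in> ?T" and p0: "f p = 0"
      obtain u w where uw: "p = u - w" "u \<in> ?C" "w \<in> ?C"
        using \<open>p \<in> ?T\<close> by blast
      obtain r x where 1: "u = r *\<^sub>R (x - a)" "0 \<le> r" "x \<in> P"
        using uw(2) by blast
      obtain s y where 2: "w = s *\<^sub>R (y - a)" "0 \<le> s" "y \<in> P"
        using uw(3) by blast
      have *: "p = r *\<^sub>R (x - a) - s *\<^sub>R (y - a)" "0 \<le> r" "x \<in> P" "0 \<le> s" "y \<in> P"
        using uw(1) 1 2 by simp_all
      \<comment> \<open>Scaling by \<open>?e\<close> brings both coefficients \<open>r\<close> and
        \<open>s\<close> below 1, so that \<open>?x\<close> and \<open>?y\<close> lie on segments
        from \<open>a\<close> inside \<open>P\<close>, where \<open>f\<close> is known to be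
        injective.\<close>
      let ?e = "1 / (1 + r + s)"
      let ?x = "a + (?e * r) *\<^sub>R (x - a)" and ?y = "a + (?e * s) *\<^sub>R (y - a)"
      have e: "0 < ?e" "0 \<le> ?e * r" "?e * r \<le> 1" "0 \<le> ?e * s" "?e * s \<le> 1"
        using * by (auto simp: divide_simps)
      have mem: "a + t *\<^sub>R (z - a) \<in> P" if "0 \<le> t" "t \<le> 1" "z \<in> P" for t z
      proof -
        have "a + t *\<^sub>R (z - a) = (1 - t) *\<^sub>R a + t *\<^sub>R z" by (simp add: algebra_simps)
        then show ?thesis using that a P by (auto intro: convexD_alt)
      qed
      have diff: "?x - ?y = ?e *\<^sub>R p"
        by (simp add: *(1) algebra_simps)
      then have "f ?x - f ?y = ?e *\<^sub>R f p"
        by (simp only: linear_diff[OF f, symmetric] diff linear_cmul[OF f])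
      then have "f ?x = f ?y"
        using p0 by simp
      then have "?x = ?y"
        by (rule inj_onD[OF inj _ mem[OF e(2,3) *(3)] mem[OF e(4,5) *(5)]])
      then show "p = 0"
        using diff e by simp
    qed
  qed
  moreover have "x - a \<in> ?T" if "x \<in> P" for x
  proof -
    have "x - a = 1 *\<^sub>R (x - a)" by simp
    then have "x - a \<in> ?C"
      using that zero_le_one by blast
    moreover have "x - a = (x - a) - 0" by simp
    ultimately show ?thesis
      using zero by blast
  qed
  ultimately obtain T where T: "subspace T" "inj_on f T" "\<And>x. x \<in> P \<Longrightarrow> x - a \<in> T"
    by (rule that)
  have "inj_on f (span T)"
    using T(1,2) by (simp add: span_eq_iff[THEN iffD2])
  then obtain L where L: "linear L" "\<forall>x\<in>span T. L (f x) = x"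
    using linear_inj_on_left_inverse[OF f] by blast
  have "L (f x) + (a - L (f a)) = x" if "x \<in> P" for x
  proof -
    have "L (f (x - a)) = x - a"
      using L(2) T(3)[OF that] by (simp add: span_base)
    then show ?thesis
      by (simp add: linear_diff[OF f] linear_diff[OF L(1)] algebra_simps)
  qed
  then show ?thesis
    using L(1) by blast
qed

text \<open>Injectivity on the whole union makes the inverse well defined, but no single affine map
  need invert \<open>f\<close> on \<open>S\<close>; an affine inverse is taken on each convex
  piece.\<close>

lemma PL_homeomorphic_linear_image:
  fixes f :: "'a::euclidean_space \<Rightarrow> 'b::euclidean_space"
  assumes f: "linear f" and inj: "inj_on f S" and S: "finite \<P>" "\<Union>\<P> = S" "\<forall>P\<in>\<P>. polytope P"
  shows "PL_homeomorphic S (f ` S)"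
proof (rule PL_homeomorphicI)
  show "piecewise_linear_on S f"
    unfolding piecewise_linear_on_def using S f
    by (intro exI[of _ \<P>]) (auto intro!: exI[of _ f] exI[of _ 0])
  show "piecewise_linear_on (f ` S) (inv_into S f)"
    unfolding piecewise_linear_on_def
  proof (intro exI[of _ "(`) f ` \<P>"] conjI ballI)
    show "finite ((`) f ` \<P>)" "\<Union> ((`) f ` \<P>) = f ` S"
      using S by auto
    fix Q assume "Q \<in> (`) f ` \<P>"
    then obtain P where P: "P \<in> \<P>" "Q = f ` P" by blast
    then show "polytope Q"
      using S f by (auto intro: polytope_linear_image)
    have "inj_on f P" "P \<subseteq> S"
      using P S inj by (auto intro: inj_on_subset)
    moreover have "convex P"
      using P S by (auto intro: polytope_imp_convex)
    ultimately obtain L c where "linear L" "\<forall>x\<in>P. L (f x) + c = x"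
      using linear_inj_on_convex_affine_inverse[OF f] by blast
    then show "\<exists>L c. linear L \<and> (\<forall>x\<in>Q. inv_into S f x = L x + c)"
      using P \<open>P \<subseteq> S\<close> inj by (intro exI[of _ L] exI[of _ c]) auto
  qed
qed (use inj in \<open>auto simp: inv_into_into f_inv_into_f\<close>)

text \<open>The relabelling extends to a linear map of barycentric coordinates. Injectivity is asked
  only on vertices that occur, because all other coordinates vanish on the realization and
  \<open>vtx\<close> is not injective on the auxiliary labels.\<close>

lemma PL_homeomorphic_relabel:
  fixes e :: "'v::finite \<Rightarrow> 'w::finite" and K :: "'v set set"
  assumes e: "inj_on e (\<Union>K)"
  shows "PL_homeomorphic (underlying_space K) (underlying_space ((`) e ` K))"
proof -
  let ?f = "\<lambda>x::real^'v. \<Sum>v\<in>UNIV. x $ v *\<^sub>R axis (e v) (1::real)"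
  have f: "linear ?f"
    by (auto simp: linear_iff sum.distrib scaleR_add_left scaleR_sum_right)
  have f_axis: "?f (axis v 1) = axis (e v) 1" for v
    by (simp add: axis_def if_distrib[of "\<lambda>r. r *\<^sub>R _"] cong: if_cong)
  have "?f ` (convex hull ((\<lambda>v. axis v 1) ` F)) = convex hull ((\<lambda>v. axis v 1) ` e ` F)" for F
    by (simp only: convex_hull_linear_image[OF f] image_image f_axis)
  then have im: "?f ` underlying_space K = underlying_space ((`) e ` K)"
    by (auto simp: underlying_space_def image_UN)
  have nth: "?f x $ e w = x $ w" if x: "x \<in> underlying_space K" and "w \<in> \<Union>K" for x w
  proof -
    have zero: "x $ v = 0" if "v \<notin> \<Union>K" for v
      using x that by (auto simp: underlying_space_def convex_hull_axis)
    have "?f x $ e w = (\<Sum>v\<in>UNIV. if v = w then x $ v else 0)"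
      unfolding sum_component
    proof (rule sum.cong)
      fix v
      show "(x $ v *\<^sub>R axis (e v) (1::real)) $ e w = (if v = w then x $ v else 0)"
        using zero[of v] e \<open>w \<in> \<Union>K\<close> by (auto simp: axis_def inj_on_def)
    qed simp
    then show ?thesis by simp
  qed
  have inj: "inj_on ?f (underlying_space K)"
  proof (rule inj_onI)
    fix x y assume x: "x \<in> underlying_space K" and y: "y \<in> underlying_space K" and eq: "?f x = ?f y"
    show "x = y"
      unfolding vec_eq_iff
    proof
      fix v show "x $ v = y $ v"
      proof (cases "v \<in> \<Union>K")
        case True
        then show ?thesis using nth[OF x True] nth[OF y True] eq by simp
      next
        case False
        then show ?thesis using x y by (auto simp: underlying_space_def convex_hull_axis)
      qed
    qed
  qed
  show ?thesis
    unfolding im[symmetric]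
    by (rule PL_homeomorphic_linear_image[OF f inj, of "(\<lambda>F. convex hull ((\<lambda>v. axis v 1) ` F)) ` K"])
      (auto simp: underlying_space_def polytope_axis_hull)
qed

text \<open>The conditions say that the link of \<open>A\<close> is the boundary of the simplex
  \<open>B\<close> and that \<open>B\<close> is not a face; the flip replaces the join of
  \<open>A\<close> with the boundary of \<open>B\<close> by the join of the boundary of
  \<open>A\<close> with \<open>B\<close>. A one-element \<open>B\<close> stars a maximal face
  \<open>A\<close> with a new vertex, and a one-element \<open>A\<close> removes a vertex.\<close>

definition bistellar :: "'a set \<Rightarrow> 'a set \<Rightarrow> 'a set set \<Rightarrow> 'a set set \<Rightarrow> bool" where
  "bistellar A B K K' \<longleftrightarrow>
     A \<inter> B = {} \<and> A \<noteq> {} \<and> B \<noteq> {} \<and> finite A \<and> finite B \<and>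
     (\<forall>F\<in>K. A \<subseteq> F \<longrightarrow> F \<subseteq> A \<union> B) \<and> (\<forall>F\<in>K. \<not> B \<subseteq> F) \<and> (\<forall>b\<in>B. A \<union> B - {b} \<in> K) \<and>
     K' = {F \<in> K. \<not> A \<subseteq> F} \<union> {F. B \<subseteq> F \<and> F \<subseteq> A \<union> B \<and> \<not> A \<subseteq> F}"

lemma bistellar_abstract_complex:
  assumes flip: "bistellar A B K K'" and K: "abstract_complex K"
  shows "abstract_complex K'"
proof -
  have K': "K' = {F \<in> K. \<not> A \<subseteq> F} \<union> {F. B \<subseteq> F \<and> F \<subseteq> A \<union> B \<and> \<not> A \<subseteq> F}"
    and AB: "finite (A \<union> B)" "B \<noteq> {}" and mem: "\<And>b. b \<in> B \<Longrightarrow> A \<union> B - {b} \<in> K"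
    using flip unfolding bistellar_def by blast+
  have fin: "finite K" "\<And>F. F \<in> K \<Longrightarrow> finite F" "\<And>F. F \<in> K \<Longrightarrow> F \<noteq> {}"
    using K by (simp_all add: abstract_complex_def)
  have "K' \<subseteq> K \<union> Pow (A \<union> B)"
    unfolding K' by blast
  then have "finite K'"
    using fin(1) AB(1) by (meson finite_Pow_iff finite_UnI finite_subset)
  moreover have "finite F \<and> F \<noteq> {}" if "F \<in> K'" for F
    using that fin(2,3) AB finite_subset unfolding K' by blast
  moreover have "G \<in> K'" if F: "F \<in> K'" and G: "G \<subseteq> F" "G \<noteq> {}" for F G
  proof -
    have nA: "\<not> A \<subseteq> G"
      using F G unfolding K' by blast
    show ?thesis
    proof (cases "B \<subseteq> G")
      case True
      show ?thesis
      proof (cases "F \<in> K")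
        case True
        then show ?thesis
          using nA abstract_complex_subset[OF K _ G] unfolding K' by blast
      next
        case False
        then show ?thesis
          using True F G nA unfolding K' by blast
      qed
    next
      case False
      then obtain b where b: "b \<in> B" "b \<notin> G" by blast
      have "F \<in> K \<or> G \<subseteq> A \<union> B - {b}"
        using F G b unfolding K' by blast
      then have "G \<in> K"
        using abstract_complex_subset[OF K] G mem[OF b(1)] by blast
      then show ?thesis
        using nA unfolding K' by blast
    qed
  qed
  ultimately show ?thesis
    unfolding abstract_complex_def by blast
qed

lemma bistellar_sym:
  assumes flip: "bistellar A B K K'" and K: "abstract_complex K"
  shows "bistellar B A K' K"
proof -
  have K': "K' = {F \<in> K. \<not> A \<subseteq> F} \<union> {F. B \<subseteq> F \<and> F \<subseteq> A \<union> B \<and> \<not> A \<subseteq> F}"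
    and AB: "A \<inter> B = {}" "A \<noteq> {}" "B \<noteq> {}" "finite A" "finite B"
    and mem: "\<And>b. b \<in> B \<Longrightarrow> A \<union> B - {b} \<in> K"
    and link: "\<And>F. F \<in> K \<Longrightarrow> A \<subseteq> F \<Longrightarrow> F \<subseteq> A \<union> B" and nB: "\<And>F. F \<in> K \<Longrightarrow> \<not> B \<subseteq> F"
    using flip unfolding bistellar_def by blast+
  have sub: "F \<in> K" if "A \<subseteq> F" "F \<subseteq> B \<union> A" "\<not> B \<subseteq> F" for F
  proof -
    obtain b where "b \<in> B" "b \<notin> F" using \<open>\<not> B \<subseteq> F\<close> by blast
    then show ?thesis
      using that AB(2) abstract_complex_subset[OF K mem[of b], of F] by blast
  qed
  have "K = {F \<in> K'. \<not> B \<subseteq> F} \<union> {F. A \<subseteq> F \<and> F \<subseteq> B \<union> A \<and> \<not> B \<subseteq> F}"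
    (is "_ = ?R")
  proof
    show "K \<subseteq> ?R"
      using link nB unfolding K' by blast
    show "?R \<subseteq> K"
      using sub unfolding K' by blast
  qed
  moreover have "B \<union> A - {a} \<in> K'" if "a \<in> A" for a
    using AB(1) that unfolding K' by blast
  moreover have "\<forall>F\<in>K'. B \<subseteq> F \<longrightarrow> F \<subseteq> B \<union> A" "\<forall>F\<in>K'. \<not> A \<subseteq> F"
    using nB unfolding K' by blast+
  ultimately show ?thesis
    using AB unfolding bistellar_def by blast
qed

text \<open>Mass is moved from \<open>A\<close> to \<open>B\<close> until a barycentric coordinate in \<open>A\<close> vanishes. A face
  that contains \<open>A\<close> does not contain \<open>B\<close>, so the amount that was moved can be read off as the
  minimum over \<open>B\<close> afterwards.\<close>

definition bistellar_map :: "'v set \<Rightarrow> 'v set \<Rightarrow> real ^ 'v \<Rightarrow> real ^ ('v::finite)" where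
  "bistellar_map A B x = (\<chi> v. x $ v + (if v \<in> B then real (card A) / real (card B)
      else if v \<in> A then -1 else 0) * Min ((\<lambda>v. x $ v) ` A))"

lemma bistellar_map_piecewise_linear:
  fixes K :: "'v::finite set set"
  assumes "A \<noteq> {}"
  shows "piecewise_linear_on (underlying_space K) (bistellar_map A B)"
proof -
  let ?H = "\<lambda>F. convex hull ((\<lambda>v. axis v (1::real)) ` F)"
  \<comment> \<open>The chamber on which the coordinate \<open>a\<close> is the smallest one over
    \<open>A\<close>. There the minimum is itself a coordinate and the map is linear.\<close>
  let ?C = "\<lambda>a. {x::real^'v. \<forall>w\<in>A. x $ a \<le> x $ w}"
  let ?\<P> = "(\<lambda>(F, a). ?H F \<inter> ?C a) ` (K \<times> A)"
  have min: "Min ((\<lambda>v. x $ v) ` A) = x $ a" if "a \<in> A" "x \<in> ?C a" for x a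
    using that by (intro Min_eqI) auto
  have ex: "\<exists>a\<in>A. x \<in> ?C a" for x :: "real^'v"
  proof -
    have "Min ((\<lambda>v. x $ v) ` A) \<in> (\<lambda>v. x $ v) ` A"
      using assms by (intro Min_in) auto
    then obtain a where a: "a \<in> A" "Min ((\<lambda>v. x $ v) ` A) = x $ a" by blast
    have "Min ((\<lambda>v. x $ v) ` A) \<le> x $ w" if "w \<in> A" for w
      using that by (intro Min_le) auto
    then show ?thesis
      using a by auto
  qed
  have "\<Union>?\<P> = underlying_space K"
  proof (intro equalityI subsetI)
    fix x assume "x \<in> \<Union>?\<P>"
    then show "x \<in> underlying_space K"
      by (auto simp: underlying_space_def)
  next
    fix x assume "x \<in> underlying_space K"
    then obtain F where "F \<in> K" "x \<in> ?H F"
      unfolding underlying_space_def by blast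
    moreover obtain a where "a \<in> A" "x \<in> ?C a"
      using ex by blast
    ultimately show "x \<in> \<Union>?\<P>"
      by (intro UnionI[of "?H F \<inter> ?C a"] image_eqI[of _ _ "(F, a)"]) simp_all
  qed
  moreover have "polytope (?H F \<inter> ?C a)" for F a
  proof -
    have "?C a = (\<Inter>w\<in>A. {x. (axis a 1 - axis w 1) \<bullet> x \<le> 0})"
      by (auto simp: inner_diff_left inner_axis')
    then have "polyhedron (?C a)"
      by (auto intro!: polyhedron_Inter polyhedron_halfspace_le)
    then show ?thesis
      by (intro polytope_Int_polyhedron polytope_axis_hull)
  qed
  moreover have "\<exists>L c. linear L \<and> (\<forall>x\<in>?H F \<inter> ?C a. bistellar_map A B x = L x + c)" if "a \<in> A" for F a
  proof -
    let ?L = "\<lambda>x::real^'v. \<chi> v. x $ v + (if v \<in> B then real (card A) / real (card B)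
      else if v \<in> A then -1 else 0) * x $ a"
    have "linear ?L"
      by (simp add: linear_iff vec_eq_iff algebra_simps)
    moreover have "\<forall>x\<in>?H F \<inter> ?C a. bistellar_map A B x = ?L x + 0"
      using min[OF \<open>a \<in> A\<close>] by (auto simp: bistellar_map_def)
    ultimately show ?thesis by blast
  qed
  ultimately show ?thesis
    unfolding piecewise_linear_on_def
    by (intro exI[of _ ?\<P>]) auto
qed

text \<open>Let \<open>t\<close> be the minimum over \<open>A\<close>. If \<open>t\<close> is 0, the
  point stays where it is and its support does not contain \<open>A\<close>. If \<open>t\<close> is
  positive, the support contains \<open>A\<close>, so it lies in \<open>A \<union> B\<close>;
  afterwards it contains \<open>B\<close> and misses the vertex of \<open>A\<close> where the
  minimum was attained.\<close>

lemma
  fixes K :: "'v::finite set set"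
  assumes flip: "bistellar A B K K'" and K: "abstract_complex K" and x: "x \<in> underlying_space K"
  shows bistellar_map_in: "bistellar_map A B x \<in> underlying_space K'"
    and bistellar_map_inverse: "bistellar_map B A (bistellar_map A B x) = x"
proof -
  note f = flip[unfolded bistellar_def]
  have K': "K' = {F \<in> K. \<not> A \<subseteq> F} \<union> {F. B \<subseteq> F \<and> F \<subseteq> A \<union> B \<and> \<not> A \<subseteq> F}"
    using flip unfolding bistellar_def by blast
  let ?S = "{v. x $ v \<noteq> 0}"
  define t where "t = Min ((\<lambda>v. x $ v) ` A)"
  have x': "\<And>v. 0 \<le> x $ v" "(\<Sum>v\<in>UNIV. x $ v) = 1" "?S \<in> K"
    using x in_underlying_space_iff[OF K] by auto
  have "t \<in> (\<lambda>v. x $ v) ` A"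
    unfolding t_def using f by (intro Min_in) auto
  then obtain a where a: "a \<in> A" "t = x $ a" by blast
  have le: "t \<le> x $ v" if "v \<in> A" for v
    unfolding t_def using f that by (intro Min_le) auto
  have map: "bistellar_map A B x $ v = x $ v + (if v \<in> B then real (card A) / real (card B)
      else if v \<in> A then -1 else 0) * t" for v
    by (simp add: bistellar_map_def t_def)
  have t0: "0 \<le> t" using a x' by simp
  have card0: "card A > 0" "card B > 0"
    using f by (auto simp: card_gt_0_iff)
  have nonneg: "0 \<le> bistellar_map A B x $ v" for v
    using t0 le x' by (auto simp: map)
  have "(\<Sum>v\<in>UNIV. bistellar_map A B x $ v) =
    (\<Sum>v\<in>UNIV. x $ v + ((if v \<in> B then real (card A) / real (card B) * t else 0) +
      (if v \<in> A then - t else 0)))"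
    using f by (intro sum.cong) (auto simp: map)
  also have "\<dots> = (\<Sum>v\<in>UNIV. x $ v) + (real (card B) * (real (card A) / real (card B) * t) - real (card A) * t)"
    by (simp add: sum.distrib sum.If_cases)
  also have "\<dots> = 1"
    using x' f by simp
  finally have sum1: "(\<Sum>v\<in>UNIV. bistellar_map A B x $ v) = 1" .
  have "{v. bistellar_map A B x $ v \<noteq> 0} \<in> K'"
  proof (cases "t = 0")
    case True
    then have "a \<notin> ?S" using a by simp
    then show ?thesis
      using True a f x' by (auto simp: map)
  next
    case False
    then have "A \<subseteq> ?S"
      using le t0 by force
    then have "?S \<subseteq> A \<union> B" using f x' by blast
    moreover have "B \<subseteq> {v. bistellar_map A B x $ v \<noteq> 0}"
    proof
      fix v assume "v \<in> B"
      then have "bistellar_map A B x $ v > 0"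
        using False t0 card0 x'(1)[of v] by (auto simp: map intro!: add_nonneg_pos)
      then show "v \<in> {v. bistellar_map A B x $ v \<noteq> 0}" by simp
    qed
    moreover have "bistellar_map A B x $ a = 0"
      using a f by (auto simp: map)
    moreover have "{v. bistellar_map A B x $ v \<noteq> 0} \<subseteq> ?S \<union> A \<union> B"
      by (auto simp: map)
    ultimately have "B \<subseteq> {v. bistellar_map A B x $ v \<noteq> 0}"
      "{v. bistellar_map A B x $ v \<noteq> 0} \<subseteq> A \<union> B" "\<not> A \<subseteq> {v. bistellar_map A B x $ v \<noteq> 0}"
      using a(1) by blast+
    then show ?thesis
      using K' by blast
  qed
  then show "bistellar_map A B x \<in> underlying_space K'"
    using nonneg sum1 in_underlying_space_iff[OF bistellar_abstract_complex[OF flip K]] by blast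
  have "\<forall>F\<in>K. \<not> B \<subseteq> F"
    using flip unfolding bistellar_def by blast
  \<comment> \<open>The support is a face and does not contain \<open>B\<close>, so some coordinate
    in \<open>B\<close> was 0. It now equals the amount that was added, which is therefore the
    minimum over \<open>B\<close> that the inverse flip removes.\<close>
  from bspec[OF this x'(3)] obtain b where b: "b \<in> B" "x $ b = 0"
    by auto
  have "Min ((\<lambda>v. bistellar_map A B x $ v) ` B) = real (card A) / real (card B) * t"
  proof (rule Min_eqI)
    show "real (card A) / real (card B) * t \<in> ($) (bistellar_map A B x) ` B"
      using b by (auto simp: map intro!: image_eqI[of _ _ b])
  qed (use x' in \<open>auto simp: map\<close>)
  then show "bistellar_map B A (bistellar_map A B x) = x"
    using card0 f by (auto simp: vec_eq_iff map bistellar_map_def[of B A])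
qed

lemma bistellar_PL_homeomorphic:
  fixes K :: "'v::finite set set"
  assumes "bistellar A B K K'" "abstract_complex K"
  shows "PL_homeomorphic (underlying_space K) (underlying_space K')"
proof (rule PL_homeomorphicI)
  note sym = bistellar_sym[OF assms] bistellar_abstract_complex[OF assms]
  show "piecewise_linear_on (underlying_space K) (bistellar_map A B)"
    "piecewise_linear_on (underlying_space K') (bistellar_map B A)"
    using assms by (auto intro!: bistellar_map_piecewise_linear simp: bistellar_def)
qed (use assms bistellar_sym[OF assms] bistellar_abstract_complex[OF assms] in
    \<open>auto intro: bistellar_map_in bistellar_map_inverse\<close>)

section \<open>Boundaries of simplices as spheres\<close>

lemma aff_dim_axis_hull: "aff_dim ((\<lambda>v::'v::finite. axis v (1::real)) ` F) = int (card F) - 1"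
  and affine_independent_axis: "\<not> affine_dependent ((\<lambda>v::'v::finite. axis v (1::real)) ` F)"
proof -
  have "independent ((\<lambda>v::'v. axis v (1::real)) ` F)"
    by (rule independent_mono[OF independent_Basis]) (auto simp: Basis_vec_def)
  then show ind: "\<not> affine_dependent ((\<lambda>v::'v. axis v (1::real)) ` F)"
    using affine_dependent_imp_dependent by blast
  have "inj_on (\<lambda>v::'v. axis v (1::real)) F"
    by (auto simp: inj_on_def axis_eq_axis)
  then show "aff_dim ((\<lambda>v::'v. axis v (1::real)) ` F) = int (card F) - 1"
    using aff_dim_affine_independent[OF ind] by (simp add: card_image)
qed

text \<open>The realization of the boundary complex is the relative frontier of a simplex, and
  bounded convex sets of equal affine dimension have homeomorphic relative frontiers; the other
  convex set is the unit ball.\<close>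

lemma simplex_boundary_homeomorphic_sphere:
  fixes F :: "'v::finite set"
  assumes "card F = DIM('n::euclidean_space) + 1"
  shows "underlying_space {G. G \<noteq> {} \<and> G \<subset> F} homeomorphic sphere (0::'n) 1"
proof -
  let ?e = "\<lambda>v::'v. axis v (1::real)"
  have e: "inj ?e"
    by (auto simp: inj_on_def axis_eq_axis)
  have card: "card F \<ge> 2"
    using assms DIM_positive[where 'a='n] by linarith
  have "underlying_space {G. G \<noteq> {} \<and> G \<subset> F} = rel_frontier (convex hull (?e ` F))"
    unfolding rel_frontier_convex_hull_cases[OF affine_independent_axis]
  proof
    have "\<exists>x\<in>F. convex hull (?e ` G) \<subseteq> convex hull (?e ` F - {?e x})" if G: "G \<subset> F" for G
    proof -
      obtain x where "x \<in> F" "x \<notin> G" using G by blast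
      then have "?e ` G \<subseteq> ?e ` F - {?e x}"
        using G e by (auto simp: inj_on_def)
      then show ?thesis
        using \<open>x \<in> F\<close> hull_mono by blast
    qed
    note ex = this
    show "underlying_space {G. G \<noteq> {} \<and> G \<subset> F} \<subseteq> \<Union> {convex hull (?e ` F - {x}) |x. x \<in> ?e ` F}"
    proof
      fix y assume "y \<in> underlying_space {G. G \<noteq> {} \<and> G \<subset> F}"
      then obtain G where "G \<subset> F" "y \<in> convex hull (?e ` G)"
        by (auto simp: underlying_space_def)
      then obtain x where "x \<in> F" "y \<in> convex hull (?e ` F - {?e x})"
        using ex[of G] by auto
      then show "y \<in> \<Union> {convex hull (?e ` F - {x}) |x. x \<in> ?e ` F}"
        by (intro UnionI[of "convex hull (?e ` F - {?e x})"]) auto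
    qed
    show "\<Union> {convex hull (?e ` F - {x}) |x. x \<in> ?e ` F} \<subseteq> underlying_space {G. G \<noteq> {} \<and> G \<subset> F}"
    proof
      fix y assume "y \<in> \<Union> {convex hull (?e ` F - {x}) |x. x \<in> ?e ` F}"
      then obtain x where x: "x \<in> F" "y \<in> convex hull (?e ` F - {?e x})"
        by auto
      have "card (F - {x}) \<noteq> 0"
        using card x(1) by (simp add: card_Diff_singleton)
      then have "F - {x} \<noteq> {}"
        by (metis card.empty)
      moreover have "?e ` F - {?e x} = ?e ` (F - {x})"
        using e by (auto simp: inj_on_def)
      ultimately show "y \<in> underlying_space {G. G \<noteq> {} \<and> G \<subset> F}"
        unfolding underlying_space_def using x by (intro UN_I[of "F - {x}"]) auto
    qed
  qed
  also have "\<dots> homeomorphic rel_frontier (cball (0::'n) 1)"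
  proof (rule homeomorphic_rel_frontiers_convex_bounded_sets)
    show "bounded (convex hull (?e ` F))"
      by (intro bounded_convex_hull finite_imp_bounded) simp
    show "aff_dim (convex hull (?e ` F)) = aff_dim (cball (0::'n) 1)"
      by (simp add: aff_dim_convex_hull aff_dim_axis_hull aff_dim_cball assms)
  qed auto
  also have "rel_frontier (cball (0::'n) 1) = sphere 0 1"
    by (simp add: rel_frontier_cball)
  finally show ?thesis .
qed

lemma sphere_homeomorphic_nsphere:
  "top_of_set (sphere (0::'n::euclidean_space) 1) homeomorphic_space nsphere (DIM('n) - 1)"
proof -
  obtain f :: "(nat \<Rightarrow> real) \<Rightarrow> 'n" and g where
    "homeomorphic_maps (nsphere (DIM('n) - 1)) (top_of_set (sphere 0 1 \<inter> span Basis)) f g"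
    by (rule homeomorphic_maps_nsphere_euclidean_sphere[OF independent_Basis orthogonal_Basis refl])
      (auto simp: norm_Basis)
  then show ?thesis
    by (metis homeomorphic_space_def homeomorphic_space_sym inf_top_right span_Basis)
qed

lemma simplex_boundary_homeomorphic_nsphere_DIM:
  fixes F :: "'v::finite set"
  assumes "card F = d + 2" "DIM('n::euclidean_space) = d + 1"
  shows "top_of_set (underlying_space {G. G \<noteq> {} \<and> G \<subset> F}) homeomorphic_space nsphere d"
proof -
  have "underlying_space {G. G \<noteq> {} \<and> G \<subset> F} homeomorphic sphere (0::'n) 1"
    by (rule simplex_boundary_homeomorphic_sphere) (use assms in simp)
  then have "top_of_set (underlying_space {G. G \<noteq> {} \<and> G \<subset> F}) homeomorphic_space
      top_of_set (sphere (0::'n) 1)"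
    by simp
  then show ?thesis
    by (rule homeomorphic_space_trans) (use sphere_homeomorphic_nsphere[where 'n='n] assms in simp)
qed

text \<open>The dimension of a Euclidean space is fixed by its type, so each \<open>d\<close> from 0
  to 3 is served by a type of its own, of dimension 1 to 4.\<close>

lemma simplex_boundary_homeomorphic_nsphere:
  fixes F :: "'v::finite set"
  assumes "card F = d + 2" "d \<le> 3"
  shows "top_of_set (underlying_space {G. G \<noteq> {} \<and> G \<subset> F}) homeomorphic_space nsphere d"
proof -
  have "d = 0 \<or> d = 1 \<or> d = 2 \<or> d = 3"
    using assms(2) by linarith
  then show ?thesis
    using simplex_boundary_homeomorphic_nsphere_DIM[OF assms(1), where 'n=real]
      simplex_boundary_homeomorphic_nsphere_DIM[OF assms(1), where 'n=complex]
      simplex_boundary_homeomorphic_nsphere_DIM[OF assms(1), where 'n="real \<times> complex"]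
      simplex_boundary_homeomorphic_nsphere_DIM[OF assms(1), where 'n="complex \<times> complex"]
    by auto
qed

section \<open>Flips of facet lists\<close>

text \<open>The certificates are evaluated by rewriting with code equations. These list predicates
  use conditionals so that a test ends at the first entry that decides it.\<close>

fun mem :: "'a \<Rightarrow> 'a list \<Rightarrow> bool" where
  "mem x [] = False"
| "mem x (y # ys) = (if x = y then True else mem x ys)"

fun sub :: "'a list \<Rightarrow> 'a list \<Rightarrow> bool" where
  "sub [] f = True"
| "sub (x # a) f = (if mem x f then sub a f else False)"

fun all :: "('a \<Rightarrow> bool) \<Rightarrow> 'a list \<Rightarrow> bool" where
  "all P [] = True"
| "all P (x # xs) = (if P x then all P xs else False)"

fun ex :: "('a \<Rightarrow> bool) \<Rightarrow> 'a list \<Rightarrow> bool" where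
  "ex P [] = False"
| "ex P (x # xs) = (if P x then True else ex P xs)"

fun split :: "('a \<Rightarrow> bool) \<Rightarrow> 'a list \<Rightarrow> 'a list \<Rightarrow> 'a list \<Rightarrow> 'a list \<times> 'a list" where
  "split P [] S R = (S, R)"
| "split P (x # xs) S R = (if P x then split P xs (x # S) R else split P xs S (x # R))"

lemma mem_iff [simp]: "mem x ys \<longleftrightarrow> x \<in> set ys"
  by (induction ys) auto

lemma sub_iff [simp]: "sub a f \<longleftrightarrow> set a \<subseteq> set f"
  by (induction a) auto

lemma all_iff [simp]: "all P xs \<longleftrightarrow> (\<forall>x\<in>set xs. P x)"
  by (induction xs) auto

lemma ex_iff [simp]: "ex P xs \<longleftrightarrow> (\<exists>x\<in>set xs. P x)"
  by (induction xs) auto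

lemma split_set:
  "split P xs S R = (S', R') \<Longrightarrow>
    set S' = set S \<union> {x \<in> set xs. P x} \<and> set R' = set R \<union> {x \<in> set xs. \<not> P x}"
  by (induction xs arbitrary: S R) (auto split: if_splits)

definition complex_of :: "'a list list \<Rightarrow> 'a set set" where
  "complex_of fs = {F. F \<noteq> {} \<and> (\<exists>f\<in>set fs. F \<subseteq> set f)}"

lemma complex_of_abstract_complex: "abstract_complex (complex_of fs)"
proof -
  have "complex_of fs \<subseteq> (\<Union>f\<in>set fs. Pow (set f))"
    by (auto simp: complex_of_def)
  then have "finite (complex_of fs)"
    by (rule finite_subset) auto
  moreover have "finite F \<and> F \<noteq> {}" if "F \<in> complex_of fs" for F
    using that finite_subset[OF _ finite_set] unfolding complex_of_def by blast
  moreover have "G \<in> complex_of fs" if "F \<in> complex_of fs" "G \<subseteq> F" "G \<noteq> {}" for F G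
    using that unfolding complex_of_def by blast
  ultimately show ?thesis
    unfolding abstract_complex_def by blast
qed

text \<open>The flip on facet lists, where \<open>S\<close> collects the facets that contain
  \<open>A\<close>. The conditions of \<open>bistellar\<close> quantify over all faces, but each of
  them is inherited between faces and facets, so testing facets is enough. A move that is not a
  legal flip yields \<open>None\<close>, which lets a faulty certificate fail.\<close>

definition flip :: "'a list \<Rightarrow> 'a list \<Rightarrow> 'a list list \<Rightarrow> 'a list list option" where
  "flip A B fs =
    (let AB = A @ B; (S, R) = split (sub A) fs [] [] in
     if all (\<lambda>f. sub f AB) S then
     if all (\<lambda>a. \<not> mem a B) A then
     if all (\<lambda>f. \<not> sub B f) fs then
     if all (\<lambda>b. ex (sub (removeAll b AB)) S) B then
     if A \<noteq> [] \<and> B \<noteq> [] then Some (map (\<lambda>a. removeAll a AB) A @ R)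
     else None else None else None else None else None)"

fun flips :: "('a list \<times> 'a list) list \<Rightarrow> 'a list list \<Rightarrow> 'a list list option" where
  "flips [] fs = Some fs"
| "flips (m # ms) fs = (case flip (fst m) (snd m) fs of None \<Rightarrow> None | Some gs \<Rightarrow> flips ms gs)"

lemma flip_bistellar:
  assumes "flip A B fs = Some gs"
  shows "bistellar (set A) (set B) (complex_of fs) (complex_of gs)"
proof -
  obtain S R where SR: "split (sub A) fs [] [] = (S, R)"
    by fastforce
  have S: "set S = {f \<in> set fs. set A \<subseteq> set f}" and R: "set R = {f \<in> set fs. \<not> set A \<subseteq> set f}"
    using split_set[OF SR] by auto
  have link: "\<And>f. f \<in> set S \<Longrightarrow> set f \<subseteq> set A \<union> set B" and disj: "set A \<inter> set B = {}"
    and nB: "\<And>f. f \<in> set fs \<Longrightarrow> \<not> set B \<subseteq> set f"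
    and ne: "A \<noteq> []" "B \<noteq> []" and gs: "gs = map (\<lambda>a. removeAll a (A @ B)) A @ R"
    using assms by (auto simp: flip_def SR Let_def split: if_splits)
  have "\<forall>b\<in>set B. \<exists>f\<in>set S. set A \<union> set B - {b} \<subseteq> set f"
    using assms by (simp add: flip_def SR Let_def Un_Diff split: if_splits)
  then have mem: "\<And>b. b \<in> set B \<Longrightarrow> \<exists>f\<in>set S. set A \<union> set B - {b} \<subseteq> set f"
    by blast
  have gs_iff: "G \<in> complex_of gs \<longleftrightarrow> G \<noteq> {} \<and> ((\<exists>a\<in>set A. G \<subseteq> set A \<union> set B - {a}) \<or> (\<exists>f\<in>set R. G \<subseteq> set f))" for G
    unfolding gs complex_of_def by (simp add: bex_Un Un_Diff)
  have "complex_of gs = {F \<in> complex_of fs. \<not> set A \<subseteq> F} \<union>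
      {F. set B \<subseteq> F \<and> F \<subseteq> set A \<union> set B \<and> \<not> set A \<subseteq> F}" (is "_ = ?R")
  proof (intro equalityI subsetI)
    fix G assume G: "G \<in> complex_of gs"
    show "G \<in> ?R"
    proof (cases "\<exists>f\<in>set R. G \<subseteq> set f")
      case True
      then show ?thesis
        using G unfolding gs_iff complex_of_def R by blast
    next
      case False
      then obtain a where a: "a \<in> set A" "G \<subseteq> set A \<union> set B - {a}" and "G \<noteq> {}"
        using G unfolding gs_iff by blast
      show ?thesis
      proof (cases "set B \<subseteq> G")
        case True
        then show ?thesis using a by blast
      next
        case False
        \<comment> \<open>A face inside a new facet that misses some \<open>b\<close> of
          \<open>B\<close> is an old one: it lies in \<open>A \<union> B - {b}\<close>, which is
          contained in a facet through \<open>A\<close>.\<close>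
        then obtain b where "b \<in> set B" "b \<notin> G" by blast
        then obtain f where "f \<in> set S" "set A \<union> set B - {b} \<subseteq> set f"
          using mem by blast
        then show ?thesis
          using a \<open>G \<noteq> {}\<close> \<open>b \<notin> G\<close> unfolding complex_of_def S by blast
      qed
    qed
  next
    fix G assume G: "G \<in> ?R"
    then obtain a where a: "a \<in> set A" "a \<notin> G" by blast
    have "G \<noteq> {}"
      using G ne unfolding complex_of_def by auto
    moreover have "(\<exists>f\<in>set R. G \<subseteq> set f) \<or> G \<subseteq> set A \<union> set B"
      using G link unfolding complex_of_def R S by blast
    ultimately show "G \<in> complex_of gs"
      unfolding gs_iff using a by blast
  qed
  moreover have "\<forall>F\<in>complex_of fs. set A \<subseteq> F \<longrightarrow> F \<subseteq> set A \<union> set B"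
    using link unfolding complex_of_def S by blast
  moreover have "\<forall>F\<in>complex_of fs. \<not> set B \<subseteq> F"
    using nB unfolding complex_of_def by blast
  moreover have "set A \<union> set B - {b} \<in> complex_of fs" if "b \<in> set B" for b
    using mem[OF that] ne disj that unfolding complex_of_def S by (auto simp: neq_Nil_conv)
  ultimately show ?thesis
    using ne disj unfolding bistellar_def by simp
qed

lemma PL_homeomorphic_refl: "PL_homeomorphic (underlying_space K) (underlying_space (K::'v::finite set set))"
  using PL_homeomorphic_relabel[of "\<lambda>v. v" K] by simp

lemma flips_PL_homeomorphic:
  fixes fs :: "'v::finite list list"
  assumes "flips ms fs = Some gs"
  shows "PL_homeomorphic (underlying_space (complex_of fs)) (underlying_space (complex_of gs))"
  using assms
proof (induction ms arbitrary: fs)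
  case Nil
  then show ?case by (simp add: PL_homeomorphic_refl)
next
  case (Cons m ms)
  then obtain hs where "flip (fst m) (snd m) fs = Some hs" "flips ms hs = Some gs"
    by (auto split: option.splits)
  then show ?case
    using Cons.IH bistellar_PL_homeomorphic[OF flip_bistellar complex_of_abstract_complex]
      PL_homeomorphic_trans by blast
qed

section \<open>Flip sequences as certificates for sphere links\<close>

definition same_complex :: "'a list list \<Rightarrow> 'a list list \<Rightarrow> bool" where
  "same_complex fs gs \<longleftrightarrow> all (\<lambda>f. ex (sub f) gs) fs \<and> all (\<lambda>g. ex (sub g) fs) gs"

lemma same_complex: "same_complex fs gs \<Longrightarrow> complex_of fs = complex_of gs"
  unfolding same_complex_def complex_of_def
  by (auto; meson order_trans)

definition flips_to :: "('a list \<times> 'a list) list \<Rightarrow> 'a list list \<Rightarrow> 'a list list \<Rightarrow> bool" where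
  "flips_to ms fs gs \<longleftrightarrow> (case flips ms fs of None \<Rightarrow> False | Some hs \<Rightarrow> same_complex hs gs)"

lemma flips_to_PL_homeomorphic:
  fixes fs :: "'v::finite list list"
  assumes "flips_to ms fs gs"
  shows "PL_homeomorphic (underlying_space (complex_of fs)) (underlying_space (complex_of gs))"
  using assms flips_PL_homeomorphic same_complex
  by (fastforce simp: flips_to_def split: option.splits)

definition simplex_boundary :: "'a list \<Rightarrow> 'a list list" where
  "simplex_boundary t = map (\<lambda>x. removeAll x t) t"

lemma complex_of_simplex_boundary: "complex_of (simplex_boundary t) = {G. G \<noteq> {} \<and> G \<subset> set t}"
  by (auto simp: complex_of_def simplex_boundary_def)

lemma flips_to_simplex_boundary_sphere:
  fixes fs :: "'v::finite list list"
  assumes "flips_to ms fs (simplex_boundary t)" "distinct t" "length t = d + 2" "d \<le> 3"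
  shows "triangulated_sphere (int d) (complex_of fs)"
proof -
  have "underlying_space (complex_of fs) homeomorphic underlying_space {G. G \<noteq> {} \<and> G \<subset> set t}"
    using flips_to_PL_homeomorphic[OF assms(1)] PL_homeomorphic_imp_homeomorphic
    by (simp add: complex_of_simplex_boundary)
  then have "top_of_set (underlying_space (complex_of fs)) homeomorphic_space
      top_of_set (underlying_space {G. G \<noteq> {} \<and> G \<subset> set t})"
    by simp
  also have "\<dots> homeomorphic_space nsphere d"
    using assms by (intro simplex_boundary_homeomorphic_nsphere) (simp_all add: distinct_card)
  finally show ?thesis
    by (simp add: triangulated_sphere_def complex_of_abstract_complex)
qed

definition link_facets :: "'a list \<Rightarrow> 'a list list \<Rightarrow> 'a list list" where
  "link_facets F fs = map (filter (\<lambda>x. \<not> mem x F)) (filter (sub F) fs)"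

lemma link_complex_of:
  assumes "F \<noteq> []"
  shows "link (set F) (complex_of fs) = complex_of (link_facets F fs)"
  using assms by (auto simp: link_def complex_of_def link_facets_def; blast)

lemma abstract_complex_image:
  assumes "abstract_complex K"
  shows "abstract_complex ((`) e ` K)"
  unfolding abstract_complex_def
proof (intro conjI ballI allI impI)
  show "finite F" "F \<noteq> {}" if "F \<in> (`) e ` K" for F
    using assms that by (auto simp: abstract_complex_def)
  show "finite ((`) e ` K)"
    using assms by (auto simp: abstract_complex_def)
  fix F G assume "F \<in> (`) e ` K" and G: "G \<subseteq> F \<and> G \<noteq> {}"
  then obtain F' where "F' \<in> K" "F = e ` F'" by blast
  moreover obtain G' where "G' \<subseteq> F'" "G = e ` G'"
    using G \<open>F = e ` F'\<close> by (metis subset_imageE)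
  ultimately show "G \<in> (`) e ` K"
    using G abstract_complex_subset[OF assms, of F' G'] by blast
qed

lemma triangulated_sphere_image:
  fixes e :: "'v::finite \<Rightarrow> 'w::finite"
  assumes "triangulated_sphere d K" "inj_on e (\<Union>K)"
  shows "triangulated_sphere d ((`) e ` K)"
proof -
  have h: "underlying_space ((`) e ` K) homeomorphic underlying_space K"
    using PL_homeomorphic_relabel[OF assms(2)]
    by (intro PL_homeomorphic_imp_homeomorphic) (rule PL_homeomorphic_sym)
  then have "underlying_space ((`) e ` K) = {}" if "underlying_space K = {}"
    using that by (simp add: homeomorphic_empty)
  moreover have "top_of_set (underlying_space ((`) e ` K)) homeomorphic_space nsphere (nat d)"
    if "top_of_set (underlying_space K) homeomorphic_space nsphere (nat d)"
    by (rule homeomorphic_space_trans[OF _ that]) (simp add: h)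
  ultimately show ?thesis
    using assms(1) abstract_complex_image by (auto simp: triangulated_sphere_def)
qed

lemma link_image:
  assumes "inj_on e (\<Union>K)" "F \<in> K"
  shows "link (e ` F) ((`) e ` K) = (`) e ` link F K"
proof -
  have eq: "e ` G \<inter> e ` F = e ` (G \<inter> F)" "e ` G = e ` H \<longleftrightarrow> G = H"
    if "G \<subseteq> \<Union>K" "H \<subseteq> \<Union>K" for G H
    using inj_on_image_Int[OF assms(1) that(1), of F] inj_on_image_eq_iff[OF assms(1) that] assms(2)
    by auto
  have "G \<in> link (e ` F) ((`) e ` K) \<longleftrightarrow> (\<exists>H\<in>K. G = e ` H \<and> e ` H \<inter> e ` F = {} \<and> e ` (H \<union> F) \<in> (`) e ` K)" for G
    by (auto simp: link_def image_Un)
  also have "\<dots> G \<longleftrightarrow> (\<exists>H\<in>K. G = e ` H \<and> H \<inter> F = {} \<and> H \<union> F \<in> K)" for G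
  proof (rule bex_cong[OF refl])
    fix H assume "H \<in> K"
    then have "e ` H \<inter> e ` F = e ` (H \<inter> F)"
      using eq(1)[of H H] by blast
    moreover have "e ` (H \<union> F) \<in> (`) e ` K \<longleftrightarrow> H \<union> F \<in> K"
      using eq(2)[of "H \<union> F"] \<open>H \<in> K\<close> assms(2) by (auto simp del: image_Un) 
    ultimately show "(G = e ` H \<and> e ` H \<inter> e ` F = {} \<and> e ` (H \<union> F) \<in> (`) e ` K) \<longleftrightarrow>
        (G = e ` H \<and> H \<inter> F = {} \<and> H \<union> F \<in> K)"
      by simp
  qed
  finally show ?thesis
    by (auto simp: link_def)
qed

lemma combinatorial_manifold_image:
  fixes e :: "'v::finite \<Rightarrow> 'w::finite"
  assumes K: "combinatorial_manifold n K" and e: "inj_on e (\<Union>K)"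
  shows "combinatorial_manifold n ((`) e ` K)"
  unfolding combinatorial_manifold_def
proof (intro conjI ballI allI impI)
  show "abstract_complex ((`) e ` K)"
    using K by (intro abstract_complex_image) (simp add: combinatorial_manifold_def)
  have card: "card (e ` F) = card F" if "F \<in> K" for F
    using e that by (intro card_image) (auto intro: inj_on_subset)
  show "card G \<le> n + 1" if "G \<in> (`) e ` K" for G
    using that K card by (auto simp: combinatorial_manifold_def)
  fix k G assume k: "k \<le> n" and G: "G \<in> faces k ((`) e ` K)"
  then obtain F where F: "F \<in> K" "G = e ` F" "card F = k + 1"
    using card by (auto simp: faces_def)
  then have "triangulated_sphere (int n - int k - 1) (link F K)"
    using K k by (auto simp: combinatorial_manifold_def faces_def)
  moreover have "link F K \<subseteq> K"
    by (auto simp: link_def)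
  ultimately show "triangulated_sphere (int n - int k - 1) (link G ((`) e ` K))"
    unfolding F(2) link_image[OF e F(1)]
    by (intro triangulated_sphere_image inj_on_subset[OF e]) auto
qed

text \<open>Only one representative of every orbit of faces under a group of symmetries, given by the
  powers of \<open>r\<close>, has to be equipped with a sequence of flips.\<close>

lemma combinatorial_manifold_complex_of:
  fixes fs :: "'v::finite list list" and r :: "'v \<Rightarrow> 'v"
  assumes r: "inj r" "(`) r ` complex_of fs = complex_of fs"
    and card: "\<And>f. f \<in> set fs \<Longrightarrow> distinct f \<and> length f = n + 1" and n: "n \<le> 4"
    and cover: "\<And>F. F \<in> complex_of fs \<Longrightarrow> card F \<le> n \<Longrightarrow>
      \<exists>k ms t G. G \<noteq> [] \<and> F = (r ^^ k) ` set G \<and> flips_to ms (link_facets G fs) (simplex_boundary t) \<and>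
        distinct t \<and> length t + card F = n + 2"
  shows "combinatorial_manifold n (complex_of fs)"
  unfolding combinatorial_manifold_def
proof (intro conjI ballI allI impI)
  show "abstract_complex (complex_of fs)"
    by (rule complex_of_abstract_complex)
  show le: "card F \<le> n + 1" if "F \<in> complex_of fs" for F
  proof -
    obtain f where "f \<in> set fs" "F \<subseteq> set f"
      using \<open>F \<in> complex_of fs\<close> by (auto simp: complex_of_def)
    then show ?thesis
      using card[of f] card_mono[of "set f" F] by (simp add: distinct_card)
  qed
  have pow: "inj (r ^^ k)" "(`) (r ^^ k) ` complex_of fs = complex_of fs" for k
  proof -
    show "inj (r ^^ k)"
      using r(1) by (rule inj_fn)
    show "(`) (r ^^ k) ` complex_of fs = complex_of fs"
    proof (induction k)
      case (Suc k)
      have "(`) (r ^^ Suc k) ` complex_of fs = (`) r ` (`) (r ^^ k) ` complex_of fs"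
        by (simp add: image_comp comp_def)
      then show ?case
        using Suc r(2) by simp
    qed simp
  qed
  fix k F assume k: "k \<le> n" and "F \<in> faces k (complex_of fs)"
  then have F: "F \<in> complex_of fs" "card F = k + 1"
    by (auto simp: faces_def)
  show "triangulated_sphere (int n - int k - 1) (link F (complex_of fs))"
  proof (cases "k = n")
    case True
    have "link F (complex_of fs) = {}"
    proof (rule ccontr)
      assume "link F (complex_of fs) \<noteq> {}"
      then obtain G where G: "G \<in> complex_of fs" "G \<inter> F = {}" "G \<union> F \<in> complex_of fs"
        by (auto simp: link_def)
      then have "finite G" "finite F" "G \<noteq> {}"
        using complex_of_abstract_complex[of fs] F(1) unfolding abstract_complex_def by blast+
      then have "card (G \<union> F) > n + 1"
        using G(2) F(2) True by (simp add: card_Un_disjoint card_gt_0_iff)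
      then show False using le[OF G(3)] by simp
    qed
    then show ?thesis
      using True by (simp add: triangulated_sphere_def abstract_complex_def underlying_space_def)
  next
    case False
    then obtain j ms t G where *: "G \<noteq> []" "F = (r ^^ j) ` set G"
      "flips_to ms (link_facets G fs) (simplex_boundary t)" "distinct t" "length t + card F = n + 2"
      using cover[OF F(1)] F(2) k by force
    have "\<exists>H\<in>complex_of fs. F = (r ^^ j) ` H"
      using F(1) pow(2)[of j] by (metis imageE)
    then have G: "set G \<in> complex_of fs"
      using *(2) pow(1)[of j] by (metis inj_image_eq_iff)
    have "triangulated_sphere (int (n - k - 1)) (complex_of (link_facets G fs))"
      using * F(2) k n False by (intro flips_to_simplex_boundary_sphere[of ms _ t]) auto
    then have "triangulated_sphere (int (n - k - 1)) (link (set G) (complex_of fs))"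
      using link_complex_of[OF *(1)] by simp
    \<comment> \<open>The power \<open>r ^^ j\<close> maps the complex onto itself, so it carries
      the link of the representative to the link of \<open>F\<close>.\<close>
    then have "triangulated_sphere (int (n - k - 1)) (link ((r ^^ j) ` set G) ((`) (r ^^ j) ` complex_of fs))"
      using G pow(1) by (subst link_image) (auto intro!: triangulated_sphere_image intro: inj_on_subset)
    moreover have "int (n - k - 1) = int n - int k - 1"
      using k False by linarith
    ultimately show ?thesis
      by (simp only: *(2) pow(2))
  qed
qed

section \<open>Triangulated products of two spheres\<close>

text \<open>The six monotone lattice paths through a 3 by 3 grid are the 4-simplices of the standard
  triangulation of a product of two triangles. The parameter \<open>T\<close> names the grid points,
  so the same lists serve for pairs of indices and for labels.\<close>

definition staircase_paths :: "('a \<Rightarrow> 'b \<Rightarrow> 'c) \<Rightarrow> 'a \<times> 'a \<times> 'a \<Rightarrow> 'b \<times> 'b \<times> 'b \<Rightarrow> 'c list list" where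
  "staircase_paths T = (\<lambda>(i, j, k) (p, q, r).
    [[T i p, T i q, T i r, T j r, T k r], [T i p, T i q, T j q, T j r, T k r],
     [T i p, T i q, T j q, T k q, T k r], [T i p, T j p, T j q, T j r, T k r],
     [T i p, T j p, T j q, T k q, T k r], [T i p, T j p, T k p, T k q, T k r]])"

definition triples :: "'a \<times> 'a \<times> 'a \<times> 'a \<Rightarrow> ('a \<times> 'a \<times> 'a) list" where
  "triples = (\<lambda>(i, j, k, l). [(i, j, k), (i, j, l), (i, k, l), (j, k, l)])"

definition staircase :: "('a \<Rightarrow> 'b \<Rightarrow> 'c) \<Rightarrow> 'a \<times> 'a \<times> 'a \<times> 'a \<Rightarrow> 'b \<times> 'b \<times> 'b \<times> 'b \<Rightarrow> 'c list list" where
  "staircase T rs cs = concat (map (\<lambda>r. concat (map (staircase_paths T r) (triples cs))) (triples rs))"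

lemma atMost_eq_insert: "{..i} = insert i {..<i::'a::order}"
  by auto

text \<open>This is the uniqueness of the monotone coupling of two distributions. In a chain there
  cannot be both a nonzero entry to the right of a corner and one below it, so the sum over a corner
  rectangle is the smaller of the two partial sums of the marginals. Corner sums are thus determined
  by the marginals, and they determine the entries.\<close>

lemma chain_supported_unique:
  fixes x y :: "'a::{finite,wellorder} \<Rightarrow> 'b::{finite,wellorder} \<Rightarrow> real"
  assumes chain: "\<And>i j k l. x i j \<noteq> 0 \<Longrightarrow> x k l \<noteq> 0 \<Longrightarrow> i \<le> k \<and> j \<le> l \<or> k \<le> i \<and> l \<le> j"
      "\<And>i j k l. y i j \<noteq> 0 \<Longrightarrow> y k l \<noteq> 0 \<Longrightarrow> i \<le> k \<and> j \<le> l \<or> k \<le> i \<and> l \<le> j"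
    and nonneg: "\<And>i j. 0 \<le> x i j" "\<And>i j. 0 \<le> y i j"
    and rows: "\<And>i. (\<Sum>j\<in>UNIV. x i j) = (\<Sum>j\<in>UNIV. y i j)"
    and cols: "\<And>j. (\<Sum>i\<in>UNIV. x i j) = (\<Sum>i\<in>UNIV. y i j)"
  shows "x i j = y i j"
proof -
  have corner: "(\<Sum>a\<in>{..i}. \<Sum>b\<in>{..j}. z a b) =
      min (\<Sum>a\<in>{..i}. \<Sum>b\<in>UNIV. z a b) (\<Sum>b\<in>{..j}. \<Sum>a\<in>UNIV. z a b)"
    if chain: "\<And>i j k l. z i j \<noteq> 0 \<Longrightarrow> z k l \<noteq> 0 \<Longrightarrow> i \<le> k \<and> j \<le> l \<or> k \<le> i \<and> l \<le> j"
      and nonneg: "\<And>i j. 0 \<le> z i j" for z :: "'a \<Rightarrow> 'b \<Rightarrow> real" and i j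
  proof -
    have swap: "(\<Sum>a\<in>{..i}. \<Sum>b\<in>{..j}. z a b) = (\<Sum>b\<in>{..j}. \<Sum>a\<in>{..i}. z a b)"
      by (rule sum.swap)
    have le: "(\<Sum>a\<in>{..i}. \<Sum>b\<in>{..j}. z a b) \<le> (\<Sum>a\<in>{..i}. \<Sum>b\<in>UNIV. z a b)"
      using nonneg by (intro sum_mono sum_mono2) auto
    have le': "(\<Sum>a\<in>{..i}. \<Sum>b\<in>{..j}. z a b) \<le> (\<Sum>b\<in>{..j}. \<Sum>a\<in>UNIV. z a b)"
      unfolding swap using nonneg by (intro sum_mono sum_mono2) auto
    show ?thesis
    proof (cases "\<exists>a b. a \<le> i \<and> j < b \<and> z a b \<noteq> 0")
      case False
      have "(\<Sum>b\<in>{..j}. z a b) = (\<Sum>b\<in>UNIV. z a b)" if "a \<le> i" for a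
      proof (intro sum.mono_neutral_left ballI)
        show "z a b = 0" if "b \<in> UNIV - {..j}" for b
          using False \<open>a \<le> i\<close> that by (metis DiffD2 atMost_iff not_le)
      qed auto
      then have "(\<Sum>a\<in>{..i}. \<Sum>b\<in>{..j}. z a b) = (\<Sum>a\<in>{..i}. \<Sum>b\<in>UNIV. z a b)"
        by (intro sum.cong[OF refl]) auto
      then show ?thesis using le le' by simp
    next
      case True
      then obtain a b where ab: "a \<le> i" "j < b" "z a b \<noteq> 0" by blast
      have "z k l = 0" if "i < k" "l \<le> j" for k l
      proof -
        have "\<not> b \<le> l" "\<not> k \<le> a"
          using ab that by (meson le_less_trans not_le)+
        then show ?thesis
          using chain[of a b k l] ab by blast
      qed
      then have "(\<Sum>a\<in>{..i}. z a b) = (\<Sum>a\<in>UNIV. z a b)" if "b \<le> j" for b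
        using that by (intro sum.mono_neutral_left) (auto simp: not_le)
      then have "(\<Sum>a\<in>{..i}. \<Sum>b\<in>{..j}. z a b) = (\<Sum>b\<in>{..j}. \<Sum>a\<in>UNIV. z a b)"
        unfolding swap by (intro sum.cong[OF refl]) auto
      then show ?thesis using le le' by simp
    qed
  qed
  have eq: "(\<Sum>a\<in>{..i}. \<Sum>b\<in>{..j}. x a b) = (\<Sum>a\<in>{..i}. \<Sum>b\<in>{..j}. y a b)" for i j
    using corner[where z=x and i=i and j=j] corner[where z=y and i=i and j=j] chain nonneg rows cols by simp
  show ?thesis
  \<comment> \<open>The last entry of a corner rectangle is its sum less the earlier rows and less
    the earlier part of the last row; the two nested inductions supply these.\<close>
  proof (induction i arbitrary: j rule: less_induct)
    case (less i)
    note outer = less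
    show ?case
    proof (induction j rule: less_induct)
      case (less j)
      have "(\<Sum>a\<in>{..<i}. \<Sum>b\<in>{..j}. x a b) = (\<Sum>a\<in>{..<i}. \<Sum>b\<in>{..j}. y a b)"
        using outer by simp
      moreover have "(\<Sum>b\<in>{..<j}. x i b) = (\<Sum>b\<in>{..<j}. y i b)"
        using less by simp
      ultimately show ?case
        using eq[where i=i and j=j] by (simp add: atMost_eq_insert)
    qed
  qed
qed

definition marginals :: "real ^ ('a \<times> 'b) \<Rightarrow> (real ^ 'a::finite) \<times> (real ^ 'b::finite)" where
  "marginals x = (\<chi> i. \<Sum>j\<in>UNIV. x $ (i, j), \<chi> j. \<Sum>i\<in>UNIV. x $ (i, j))"

lemma linear_marginals: "linear marginals"
  by (simp add: linear_iff marginals_def vec_eq_iff sum.distrib sum_distrib_left)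

lemma marginals_axis: "marginals (axis (i, j) 1) = (axis i 1, axis j 1)"
  by (auto simp: marginals_def axis_def vec_eq_iff)

lemma in_PL_S2_iff: "p \<in> PL_S2 \<longleftrightarrow> (\<forall>i. 0 \<le> p $ i) \<and> (\<Sum>i\<in>UNIV. p $ i) = 1 \<and> (\<exists>i. p $ i = 0)"
proof -
  have "abstract_complex {F :: 4 set. F \<noteq> {} \<and> F \<noteq> UNIV}"
    unfolding abstract_complex_def by auto
  note iff = in_underlying_space_iff[OF this, of p]
  have "{v. p $ v \<noteq> 0} \<noteq> {}" if "(\<Sum>i\<in>UNIV. p $ i) = 1"
    using that by force
  then show ?thesis
    unfolding PL_S2_def iff by auto
qed

lemma order_4: "(0::4) < 1" "(1::4) < 2" "(2::4) < 3" "(0::4) < 2" "(0::4) < 3" "(1::4) < 3"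
  by (simp_all add: less_bit0_def bit0.Rep_numeral bit0.Rep_0 bit0.Rep_1)

lemma exhaust_4: "(i::4) \<in> {0, 1, 2, 3}"
proof (cases i)
  case (of_int z)
  then have "z \<in> {0, 1, 2, 3}" by simp presburger
  then show ?thesis using of_int by auto
qed

abbreviation grid_facets :: "(4 \<times> 4) list list" where
  "grid_facets \<equiv> staircase Pair (0, 1, 2, 3) (0, 1, 2, 3)"

lemma staircase_paths_chain:
  fixes i j k :: "'a::linorder" and p q r :: "'b::linorder"
  assumes "i < j" "j < k" "p < q" "q < r" "f \<in> set (staircase_paths Pair (i, j, k) (p, q, r))"
    "u \<in> set f" "v \<in> set f"
  shows "fst u \<le> fst v \<and> snd u \<le> snd v \<or> fst v \<le> fst u \<and> snd v \<le> snd u"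
  using assms by (auto simp: staircase_paths_def)

lemma triples_4:
  assumes "(i, j, k) \<in> set (triples (0, 1, 2, 3 :: 4))"
  shows "i < j" "j < k" "\<exists>l. l \<notin> {i, j, k}"
proof -
  show "i < j" "j < k"
    using assms order_4 by (auto simp: triples_def)
  show "\<exists>l. l \<notin> {i, j, k}"
  proof (rule ccontr)
    assume "\<not> ?thesis"
    then have "{i, j, k} = UNIV" by blast
    moreover have "card {i, j, k} \<le> 3" by (simp add: card_insert_if)
    ultimately show False by simp
  qed
qed

lemma triples_4_missing: "\<exists>i j k. (i, j, k) \<in> set (triples (0, 1, 2, 3 :: 4)) \<and> UNIV - {l} = {i, j, k}"
proof -
  note less = order_4
  then have ne: "(0::4) \<noteq> 1" "(1::4) \<noteq> 2" "(2::4) \<noteq> 3" "(0::4) \<noteq> 2" "(0::4) \<noteq> 3" "(1::4) \<noteq> 3"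
    by auto
  have U: "UNIV = {0, 1, 2, 3 :: 4}"
    using exhaust_4 by blast
  consider "l = 0" | "l = 1" | "l = 2" | "l = 3"
    using exhaust_4[of l] by blast
  then have "UNIV - {l} = {1, 2, 3} \<or> UNIV - {l} = {0, 2, 3} \<or> UNIV - {l} = {0, 1, 3} \<or> UNIV - {l} = {0, 1, 2}"
    unfolding U by cases (use ne in \<open>auto simp: insert_Diff_if\<close>)
  then show ?thesis
    by (elim disjE) (auto simp: triples_def)
qed

lemma sum_axis_simplex:
  fixes p :: "real ^ 'v::finite"
  assumes "{i. p $ i \<noteq> 0} \<subseteq> {i, j, k}" "i \<noteq> j" "j \<noteq> k" "i \<noteq> k"
  shows "p = p $ i *\<^sub>R axis i 1 + p $ j *\<^sub>R axis j 1 + p $ k *\<^sub>R axis k 1"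
    and "(\<Sum>v\<in>UNIV. p $ v) = p $ i + p $ j + p $ k"
proof -
  show "p = p $ i *\<^sub>R axis i 1 + p $ j *\<^sub>R axis j 1 + p $ k *\<^sub>R axis k 1"
    using assms by (auto simp: vec_eq_iff axis_def)
  have "(\<Sum>v\<in>UNIV. p $ v) = (\<Sum>v\<in>{i, j, k}. p $ v)"
    using assms(1) by (intro sum.mono_neutral_right) auto
  then show "(\<Sum>v\<in>UNIV. p $ v) = p $ i + p $ j + p $ k"
    using assms(2-) by simp
qed

lemma sum_axis: "(\<Sum>v\<in>UNIV. axis a (1::real) $ v) = 1"
  by (simp add: axis_def)

lemma convex_hull_5I:
  fixes a b c d e :: "'v::finite"
  assumes "0 \<le> s1" "0 \<le> s2" "0 \<le> s3" "0 \<le> s4" "0 \<le> s5" "s1 + s2 + s3 + s4 + s5 = (1::real)"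
  shows "s1 *\<^sub>R axis a 1 + s2 *\<^sub>R axis b 1 + s3 *\<^sub>R axis c 1 + s4 *\<^sub>R axis d 1 + s5 *\<^sub>R (axis e 1 :: real ^ 'v)
    \<in> convex hull ((\<lambda>v. axis v 1) ` set [a, b, c, d, e])"
proof -
  define x :: "real ^ 'v" where "x = s1 *\<^sub>R axis a 1 + s2 *\<^sub>R axis b 1 + s3 *\<^sub>R axis c 1 +
    s4 *\<^sub>R axis d 1 + s5 *\<^sub>R axis e 1"
  have "(\<Sum>v\<in>UNIV. x $ v) = s1 + s2 + s3 + s4 + s5"
    by (simp add: x_def sum.distrib sum_axis flip: sum_distrib_left)
  moreover have "0 \<le> x $ v" for v
    using assms by (auto simp: x_def axis_def)
  moreover have "x $ v = 0" if "v \<notin> set [a, b, c, d, e]" for v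
    using that by (auto simp: x_def axis_def)
  ultimately show ?thesis
    unfolding convex_hull_axis x_def[symmetric] using assms(6) by simp
qed

text \<open>Each of the six monotone lattice paths covers the region in which the partial sums of the
  two probability vectors interleave in the corresponding order.\<close>

lemma staircase_paths_surj:
  fixes p :: "real ^ 'a::finite" and q :: "real ^ 'b::finite"
  assumes p: "{v. p $ v \<noteq> 0} \<subseteq> {i, j, k}" "i \<noteq> j" "j \<noteq> k" "i \<noteq> k"
      "\<forall>v. 0 \<le> p $ v" "(\<Sum>v\<in>UNIV. p $ v) = 1"
    and q: "{v. q $ v \<noteq> 0} \<subseteq> {l, m, n}" "l \<noteq> m" "m \<noteq> n" "l \<noteq> n"
      "\<forall>v. 0 \<le> q $ v" "(\<Sum>v\<in>UNIV. q $ v) = 1"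
  shows "\<exists>f\<in>set (staircase_paths Pair (i, j, k) (l, m, n)).
    (p, q) \<in> marginals ` (convex hull ((\<lambda>v. axis v 1) ` set f))"
proof -
  define a b c where "a = p $ i" and "b = p $ j" and "c = p $ k"
  define u v w where "u = q $ l" and "v = q $ m" and "w = q $ n"
  have pe: "p = a *\<^sub>R axis i 1 + b *\<^sub>R axis j 1 + c *\<^sub>R axis k 1" and p1: "a + b + c = 1"
    using sum_axis_simplex[OF p(1-4)] p(6) by (simp_all add: a_def b_def c_def)
  have qe: "q = u *\<^sub>R axis l 1 + v *\<^sub>R axis m 1 + w *\<^sub>R axis n 1" and q1: "u + v + w = 1"
    using sum_axis_simplex[OF q(1-4)] q(6) by (simp_all add: u_def v_def w_def)
  have nonneg: "0 \<le> a" "0 \<le> b" "0 \<le> c" "0 \<le> u" "0 \<le> v" "0 \<le> w"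
    using p(5) q(5) by (simp_all add: a_def b_def c_def u_def v_def w_def)
  \<comment> \<open>The weights along a path involve \<open>c\<close> if its last step changes the
    first index and \<open>w\<close> if it changes the second. The other variable is eliminated by
    one of these equations.\<close>
  have c: "c = u + v + w - a - b" and w: "w = a + b + c - u - v"
    using p1 q1 by simp_all
  have *: "(p, q) \<in> marginals ` (convex hull ((\<lambda>v. axis v 1) ` set [(i1, j1), (i2, j2), (i3, j3), (i4, j4), (i5, j5)]))"
    if "0 \<le> s1" "0 \<le> s2" "0 \<le> s3" "0 \<le> s4" "0 \<le> s5" "s1 + s2 + s3 + s4 + s5 = 1"
      "p = s1 *\<^sub>R axis i1 1 + s2 *\<^sub>R axis i2 1 + s3 *\<^sub>R axis i3 1 + s4 *\<^sub>R axis i4 1 + s5 *\<^sub>R axis i5 1"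
      "q = s1 *\<^sub>R axis j1 1 + s2 *\<^sub>R axis j2 1 + s3 *\<^sub>R axis j3 1 + s4 *\<^sub>R axis j4 1 + s5 *\<^sub>R axis j5 1"
    for s1 s2 s3 s4 s5 i1 i2 i3 i4 i5 j1 j2 j3 j4 j5
    by (rule image_eqI[OF _ convex_hull_5I[OF that(1-6)]])
      (simp add: that(7,8) linear_add[OF linear_marginals] linear_cmul[OF linear_marginals] marginals_axis)
  consider "u + v \<le> a" | "u \<le> a" "a \<le> u + v" "u + v \<le> a + b" | "u \<le> a" "a + b \<le> u + v"
    | "a \<le> u" "u + v \<le> a + b" | "a \<le> u" "u \<le> a + b" "a + b \<le> u + v" | "a + b \<le> u"
    using nonneg by linarith
  then show ?thesis
  proof cases
    case 1
    have "(p, q) \<in> marginals ` (convex hull ((\<lambda>v. axis v 1) ` set [(i, l), (i, m), (i, n), (j, n), (k, n)]))"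
      by (rule *[of u v "a - u - v" b c]) (use nonneg 1 p1 in linarith | simp add: pe qe[unfolded w] algebra_simps)+
    then show ?thesis by (simp add: staircase_paths_def)
  next
    case 2
    have "(p, q) \<in> marginals ` (convex hull ((\<lambda>v. axis v 1) ` set [(i, l), (i, m), (j, m), (j, n), (k, n)]))"
      by (rule *[of u "a - u" "u + v - a" "a + b - u - v" c]) (use nonneg 2 p1 in linarith | simp add: pe qe[unfolded w] algebra_simps)+
    then show ?thesis by (simp add: staircase_paths_def)
  next
    case 3
    have "(p, q) \<in> marginals ` (convex hull ((\<lambda>v. axis v 1) ` set [(i, l), (i, m), (j, m), (k, m), (k, n)]))"
      by (rule *[of u "a - u" b "u + v - a - b" w]) (use nonneg 3 q1 in linarith | simp add: pe[unfolded c] qe algebra_simps)+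
    then show ?thesis by (simp add: staircase_paths_def)
  next
    case 4
    have "(p, q) \<in> marginals ` (convex hull ((\<lambda>v. axis v 1) ` set [(i, l), (j, l), (j, m), (j, n), (k, n)]))"
      by (rule *[of a "u - a" v "a + b - u - v" c]) (use nonneg 4 p1 in linarith | simp add: pe qe[unfolded w] algebra_simps)+
    then show ?thesis by (simp add: staircase_paths_def)
  next
    case 5
    have "(p, q) \<in> marginals ` (convex hull ((\<lambda>v. axis v 1) ` set [(i, l), (j, l), (j, m), (k, m), (k, n)]))"
      by (rule *[of a "u - a" "a + b - u" "u + v - a - b" w]) (use nonneg 5 q1 in linarith | simp add: pe[unfolded c] qe algebra_simps)+
    then show ?thesis by (simp add: staircase_paths_def)
  next
    case 6
    have "(p, q) \<in> marginals ` (convex hull ((\<lambda>v. axis v 1) ` set [(i, l), (j, l), (k, l), (k, m), (k, n)]))"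
      by (rule *[of a b "u - a - b" v w]) (use nonneg 6 q1 in linarith | simp add: pe[unfolded c] qe algebra_simps)+
    then show ?thesis by (simp add: staircase_paths_def)
  qed
qed

text \<open>Supports of points of the staircase complex are chains, so row and column sums are
  injective on it; that they cover the product is the decomposition into path regions. The
  homeomorphism is the restriction of a linear map, hence piecewise linear in both
  directions.\<close>

lemma grid_PL_homeomorphic: "PL_homeomorphic (underlying_space (complex_of grid_facets)) PL_S2_times_S2"
proof -
  let ?K = "complex_of grid_facets"
  have path: "\<exists>r\<in>set (triples (0, 1, 2, 3)). \<exists>c\<in>set (triples (0, 1, 2, 3)).
      f \<in> set (staircase_paths Pair r c)" if "f \<in> set grid_facets" for f
    using that unfolding staircase_def by simp
  have x: "(\<forall>v. 0 \<le> x $ v) \<and> (\<Sum>v\<in>UNIV. x $ v) = 1 \<and> {v. x $ v \<noteq> 0} \<in> ?K"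
    if "x \<in> underlying_space ?K" for x
    using that in_underlying_space_iff[OF complex_of_abstract_complex] by blast
  have chain: "fst u \<le> fst v \<and> snd u \<le> snd v \<or> fst v \<le> fst u \<and> snd v \<le> snd u"
    if supp: "x \<in> underlying_space ?K" "x $ u \<noteq> 0" "x $ v \<noteq> 0" for x u v
  proof -
    obtain f where f: "f \<in> set grid_facets" "{v. x $ v \<noteq> 0} \<subseteq> set f"
      using x[OF supp(1)] by (auto simp: complex_of_def)
    obtain i j k p q r where "(i, j, k) \<in> set (triples (0, 1, 2, 3))" "(p, q, r) \<in> set (triples (0, 1, 2, 3))"
      "f \<in> set (staircase_paths Pair (i, j, k) (p, q, r))"
      using path[OF f(1)] by auto
    then show ?thesis
      using staircase_paths_chain[of i j k p q r f u v] triples_4(1,2) f(2) supp(2,3) by blast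
  qed
  have inj: "inj_on marginals (underlying_space ?K)"
  proof (rule inj_onI)
    fix x y assume xy: "x \<in> underlying_space ?K" "y \<in> underlying_space ?K" "marginals x = marginals y"
    have "x $ (i, j) = y $ (i, j)" for i j
    proof (rule chain_supported_unique[of "\<lambda>i j. x $ (i, j)" "\<lambda>i j. y $ (i, j)"])
      show "(\<Sum>j\<in>UNIV. x $ (i, j)) = (\<Sum>j\<in>UNIV. y $ (i, j))" for i
        using xy(3) by (simp add: marginals_def vec_eq_iff)
      show "(\<Sum>i\<in>UNIV. x $ (i, j)) = (\<Sum>i\<in>UNIV. y $ (i, j))" for j
        using xy(3) by (simp add: marginals_def vec_eq_iff)
    qed (use x[OF xy(1)] x[OF xy(2)] chain[OF xy(1)] chain[OF xy(2)] in fastforce)+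
    then show "x = y"
      by (simp add: vec_eq_iff)
  qed
  have "marginals ` underlying_space ?K = PL_S2_times_S2"
  proof (intro equalityI subsetI)
    fix z assume "z \<in> marginals ` underlying_space ?K"
    then obtain y where y: "y \<in> underlying_space ?K" "z = marginals y" by blast
    obtain f where f: "f \<in> set grid_facets" "{v. y $ v \<noteq> 0} \<subseteq> set f"
      using x[OF y(1)] by (auto simp: complex_of_def)
    obtain i j k p q r where ijk: "(i, j, k) \<in> set (triples (0, 1, 2, 3))" "(p, q, r) \<in> set (triples (0, 1, 2, 3))"
      "f \<in> set (staircase_paths Pair (i, j, k) (p, q, r))"
      using path[OF f(1)] by auto
    \<comment> \<open>A triple omits one of the four indices, so the row sum at that index is 0.
      This puts the first marginal on the boundary of the tetrahedron.\<close>
    obtain l where "l \<notin> {i, j, k}"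
      using triples_4(3)[OF ijk(1)] by blast
    then have "y $ (l, b) = 0" for b
      using f(2) ijk(3) by (auto simp: staircase_paths_def)
    then have "\<exists>l. (\<Sum>b\<in>UNIV. y $ (l, b)) = 0"
      by (intro exI[of _ l]) simp
    moreover obtain m where "m \<notin> {p, q, r}"
      using triples_4(3)[OF ijk(2)] by blast
    then have "y $ (a, m) = 0" for a
      using f(2) ijk(3) by (auto simp: staircase_paths_def)
    then have "\<exists>m. (\<Sum>a\<in>UNIV. y $ (a, m)) = 0"
      by (intro exI[of _ m]) simp
    moreover have "(\<Sum>a\<in>UNIV. \<Sum>b\<in>UNIV. y $ (a, b)) = 1"
      using x[OF y(1)] by (simp add: sum.cartesian_product)
    moreover from this have "(\<Sum>b\<in>UNIV. \<Sum>a\<in>UNIV. y $ (a, b)) = 1"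
      by (subst sum.swap)
    ultimately show "z \<in> PL_S2_times_S2"
      using x[OF y(1)] by (auto simp: y(2) PL_S2_times_S2_def in_PL_S2_iff marginals_def sum_nonneg)
  next
    fix z assume "z \<in> PL_S2_times_S2"
    then obtain p q where z: "z = (p, q)" "p \<in> PL_S2" "q \<in> PL_S2"
      by (auto simp: PL_S2_times_S2_def)
    obtain l m where lm: "p $ l = 0" "q $ m = 0"
      using z(2,3) by (auto simp: in_PL_S2_iff)
    obtain i j k where r: "(i, j, k) \<in> set (triples (0, 1, 2, 3))" "UNIV - {l} = {i, j, k}"
      using triples_4_missing by blast
    obtain i' j' k' where c: "(i', j', k') \<in> set (triples (0, 1, 2, 3))" "UNIV - {m} = {i', j', k'}"
      using triples_4_missing by blast
    have "{v. p $ v \<noteq> 0} \<subseteq> {i, j, k}" "{v. q $ v \<noteq> 0} \<subseteq> {i', j', k'}"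
      using lm r(2) c(2) by auto
    moreover note triples_4(1,2)[OF r(1)] triples_4(1,2)[OF c(1)]
    ultimately obtain f where f: "f \<in> set (staircase_paths Pair (i, j, k) (i', j', k'))"
      "(p, q) \<in> marginals ` (convex hull ((\<lambda>v. axis v 1) ` set f))"
      using staircase_paths_surj[of p i j k q i' j' k'] z(2,3) by (force simp: in_PL_S2_iff)
    have "f \<in> set grid_facets"
      using f(1) r(1) c(1) by (force simp: staircase_def)
    moreover have "f \<noteq> []"
      using f(1) by (auto simp: staircase_paths_def)
    ultimately have "set f \<in> ?K"
      by (auto simp: complex_of_def)
    then show "z \<in> marginals ` underlying_space ?K"
      using f(2) by (auto simp: z(1) underlying_space_def)
  qed
  then show ?thesis
    using PL_homeomorphic_linear_image[OF linear_marginals inj,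
        of "(\<lambda>F. convex hull ((\<lambda>v. axis v 1) ` F)) ` ?K"] complex_of_abstract_complex[of grid_facets]
    by (auto simp: abstract_complex_def underlying_space_def polytope_axis_hull)
qed

section \<open>Complexes with a cyclic symmetry\<close>

text \<open>The labels \<open>V0, \<dots>, V11\<close> stand for the twelve vertices; the other four occur only as
  auxiliary vertices in sequences of flips.\<close>

datatype label = V0 | V1 | V2 | V3 | V4 | V5 | V6 | V7 | V8 | V9 | V10 | V11 | V12 | V13 | V14 | V15

instance label :: finite
proof
  have "x \<in> set [V0, V1, V2, V3, V4, V5, V6, V7, V8, V9, V10, V11, V12, V13, V14, V15]" for x
    by (cases x) auto
  then have "(UNIV :: label set) \<subseteq> set [V0, V1, V2, V3, V4, V5, V6, V7, V8, V9, V10, V11, V12, V13, V14, V15]"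
    by (intro subsetI)
  then show "finite (UNIV :: label set)"
    by (rule finite_subset) (rule finite_set)
qed

primrec rot :: "label \<Rightarrow> label" where
  "rot V0 = V1"
| "rot V1 = V2"
| "rot V2 = V3"
| "rot V3 = V4"
| "rot V4 = V5"
| "rot V5 = V6"
| "rot V6 = V7"
| "rot V7 = V8"
| "rot V8 = V9"
| "rot V9 = V10"
| "rot V10 = V11"
| "rot V11 = V0"
| "rot V12 = V12"
| "rot V13 = V13"
| "rot V14 = V14"
| "rot V15 = V15"

text \<open>The value 0 at the four auxiliary labels is a default. Hence injectivity holds on
  \<open>core\<close> only, and \<open>realize\<close> is used for complexes whose vertices lie in
  \<open>core\<close>.\<close>

primrec vtx :: "label \<Rightarrow> 12" where
  "vtx V0 = 0"
| "vtx V1 = 1"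
| "vtx V2 = 2"
| "vtx V3 = 3"
| "vtx V4 = 4"
| "vtx V5 = 5"
| "vtx V6 = 6"
| "vtx V7 = 7"
| "vtx V8 = 8"
| "vtx V9 = 9"
| "vtx V10 = 10"
| "vtx V11 = 11"
| "vtx V12 = 0"
| "vtx V13 = 0"
| "vtx V14 = 0"
| "vtx V15 = 0"

abbreviation core :: "label list" where
  "core \<equiv> [V0, V1, V2, V3, V4, V5, V6, V7, V8, V9, V10, V11]"

primrec rotations :: "nat \<Rightarrow> label list \<Rightarrow> label list list" where
  "rotations 0 f = []"
| "rotations (Suc n) f = f # rotations n (map rot f)"

definition facets :: "label list list \<Rightarrow> label list list" where
  "facets bs = concat (map (rotations 12) bs)"

lemma rot_12: "rot ^^ 12 = id"
proof
  show "(rot ^^ 12) x = id x" for x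
    by (cases x) (simp_all add: eval_nat_numeral)
qed

lemma inj_rot: "inj rot"
proof -
  have "(rot ^^ 11) \<circ> rot = id"
    using funpow_Suc_right[of 11 rot] rot_12 by simp
  then show ?thesis
    by (metis inj_on_id inj_on_imageI2)
qed

lemma vtx_rot: "x \<in> set core \<Longrightarrow> vtx (rot x) = zeta (vtx x)"
  by (cases x) (simp_all add: zeta_eq)

lemma inj_on_vtx: "inj_on vtx (set core)"
  by (auto simp: inj_on_def)

lemma vtx_core: "vtx ` set core = UNIV"
  using exhaust_12 by auto

lemma in_rotations: "g \<in> set (rotations n f) \<longleftrightarrow> (\<exists>k<n. g = map (rot ^^ k) f)"
proof (induction n arbitrary: f)
  case (Suc n)
  have "(\<exists>k<Suc n. g = map (rot ^^ k) f) \<longleftrightarrow> g = f \<or> (\<exists>k<n. g = map (rot ^^ Suc k) f)"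
    by (auto simp: less_Suc_eq_0_disj)
  then show ?case
    by (simp add: Suc funpow_swap1 comp_def)
qed simp

lemma in_facets: "g \<in> set (facets bs) \<longleftrightarrow> (\<exists>b\<in>set bs. \<exists>k<12. g = map (rot ^^ k) b)"
  by (auto simp: facets_def in_rotations)

lemma facets_rot: "(`) rot ` complex_of (facets bs) = complex_of (facets bs)"
proof -
  have sub: "(`) rot ` complex_of (facets bs) \<subseteq> complex_of (facets bs)"
  proof (clarify)
    fix F assume "F \<in> complex_of (facets bs)"
    then obtain b k where bk: "F \<noteq> {}" "b \<in> set bs" "k < 12" "F \<subseteq> set (map (rot ^^ k) b)"
      by (auto simp: complex_of_def in_facets)
    have "\<exists>j<12. map (rot ^^ Suc k) b = map (rot ^^ j) b"
    proof (cases "k = 11")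
      case True
      have "map (rot ^^ Suc k) b = map (rot ^^ 0) b"
        unfolding True using rot_12 by simp
      then show ?thesis by (metis zero_less_numeral)
    next
      case False
      then show ?thesis using bk(3) by (intro exI[of _ "Suc k"]) simp
    qed
    then have "map (rot ^^ Suc k) b \<in> set (facets bs)"
      unfolding in_facets using bk(2) by blast
    moreover have "rot ` F \<subseteq> set (map (rot ^^ Suc k) b)"
      using bk(4) by auto
    ultimately show "rot ` F \<in> complex_of (facets bs)"
      using bk(1) unfolding complex_of_def by blast
  qed
  have fin: "finite (complex_of (facets bs))"
    using complex_of_abstract_complex[of "facets bs", unfolded abstract_complex_def] by (rule conjunct1)
  have inj: "inj_on ((`) rot) (complex_of (facets bs))"
    using inj_image_eq_iff[OF inj_rot] by (intro inj_onI) blast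
  show ?thesis
    by (rule endo_inj_surj[OF fin sub inj])
qed

text \<open>The link of a face with \<open>m\<close> vertices is a sphere of dimension
  \<open>4 - m\<close>, hence is compared with the boundary of a simplex with \<open>6 - m\<close>
  vertices; this explains the sum 6. Facets have the empty link and get no certificate.\<close>

definition link_certificate :: "label list list \<Rightarrow> label list \<times> (label list \<times> label list) list \<times> label list \<Rightarrow> bool" where
  "link_certificate fs = (\<lambda>(G, ms, t). flips_to ms (link_facets G fs) (simplex_boundary t) \<and>
     distinct t \<and> G \<noteq> [] \<and> distinct G \<and> length t + length G = 6)"

definition links_certified :: "label list list \<Rightarrow> (label list \<times> (label list \<times> label list) list \<times> label list) list \<Rightarrow> bool" where
  "links_certified bs cs = (let fs = facets bs in list_all (link_certificate fs) cs)"

definition faces_covered :: "label list list \<Rightarrow> label list list \<Rightarrow> bool" where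
  "faces_covered bs Gs \<longleftrightarrow> list_all (\<lambda>b. distinct b \<and> length b = 5 \<and> list_all (\<lambda>F. if F = [] then True else if length F = 5 then True
     else ex (\<lambda>H. ex (\<lambda>G. if sub G H then sub H G else False) Gs) (rotations 12 F)) (subseqs b)) bs"

lemma combinatorial_manifold_facets:
  assumes certs: "links_certified bs cs" and cover: "faces_covered bs (map fst cs)"
  shows "combinatorial_manifold 4 (complex_of (facets bs))"
proof (rule combinatorial_manifold_complex_of[OF inj_rot facets_rot])
  have b: "distinct b \<and> length b = 5" if "b \<in> set bs" for b
    using cover that by (auto simp: faces_covered_def list_all_iff)
  show "distinct f \<and> length f = 4 + 1" if "f \<in> set (facets bs)" for f
    using that b by (auto simp: in_facets distinct_map inj_on_subset[OF inj_fn[OF inj_rot] subset_UNIV])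
  fix F assume "F \<in> complex_of (facets bs)" and card: "card F \<le> 4"
  then obtain b k where bk: "F \<noteq> {}" "b \<in> set bs" "k < 12" "F \<subseteq> (rot ^^ k) ` set b"
    by (auto simp: complex_of_def in_facets)
  then obtain F0 where F0: "F0 \<subseteq> set b" "F = (rot ^^ k) ` F0"
    by (meson subset_imageE)
  then obtain l where l: "l \<in> set (subseqs b)" "set l = F0"
    using subseqs_powset[of b] by (metis (mono_tags, lifting) Pow_iff image_iff)
  have "distinct l"
    using l(1) b[OF bk(2)] by (simp add: subseqs_distinctD)
  have cardF: "card F = length l"
    using F0(2) l(2) \<open>distinct l\<close> inj_fn[OF inj_rot, of k]
    by (metis card_image distinct_card inj_on_subset subset_UNIV)
  then have "l \<noteq> []" "length l \<noteq> 5"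
    using bk(1) card F0(2) l(2) by auto
  then obtain H G where "H \<in> set (rotations 12 l)" "G \<in> set (map fst cs)" "set G = set H"
    using cover bk(2) l(1) by (fastforce simp: faces_covered_def list_all_iff split: if_splits)
  then obtain j ms t where j: "j < 12" "set G = (rot ^^ j) ` F0" and "(G, ms, t) \<in> set cs"
    using l(2) by (auto simp: in_rotations)
  then have c: "flips_to ms (link_facets G (facets bs)) (simplex_boundary t)" "distinct t" "G \<noteq> []" "distinct G"
      "length t + length G = 6"
    using certs by (auto simp: links_certified_def link_certificate_def list_all_iff Let_def)
  have "card F = length G"
    using cardF j(2) l(2) c(4) \<open>distinct l\<close> inj_fn[OF inj_rot, of j]
    by (metis card_image distinct_card inj_on_subset subset_UNIV)
  \<comment> \<open>Both \<open>F\<close> and \<open>G\<close> are rotations of \<open>F0\<close>,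
    by \<open>k\<close> and by \<open>j\<close> steps. Going back \<open>j\<close> steps is going
    forward \<open>12 - j\<close>, which keeps the exponent a natural number.\<close>
  have "(rot ^^ (k + (12 - j))) ((rot ^^ j) x) = (rot ^^ k) x" for x
  proof -
    have "(rot ^^ (k + (12 - j))) ((rot ^^ j) x) = (rot ^^ k) ((rot ^^ (12 - j + j)) x)"
      by (simp add: funpow_add)
    then show ?thesis using j(1) by (simp add: rot_12)
  qed
  then have "F = (rot ^^ (k + (12 - j))) ` set G"
    unfolding F0(2) j(2) image_image by simp
  then show "\<exists>k ms t G. G \<noteq> [] \<and> F = (rot ^^ k) ` set G \<and>
      flips_to ms (link_facets G (facets bs)) (simplex_boundary t) \<and> distinct t \<and> length t + card F = 4 + 2"
    by (intro exI[of _ "k + (12 - j)"] exI[of _ ms] exI[of _ t] exI[of _ G])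
      (use c \<open>card F = length G\<close> in simp)
qed simp

text \<open>The order of a nontrivial rotation does not divide 5, so no such rotation fixes a set of
  five vertices. Six orbits of length twelve therefore make up the 72 facets; the same holds for the
  other two lists.\<close>

definition bases1 :: "label list list" where
  "bases1 =
   [[V0, V1, V2, V3, V4], [V0, V1, V8, V9, V10], [V0, V7, V2, V3, V4], [V0, V1, V8, V9, V4], [V0,
   V7, V2, V3, V10], [V0, V7, V2, V9, V4]]"

definition bases2 :: "label list list" where
  "bases2 =
   [[V0, V1, V2, V3, V4], [V0, V1, V8, V9, V10], [V0, V7, V2, V3, V4], [V0, V7, V8, V3, V4], [V0,
   V7, V2, V3, V10], [V0, V7, V2, V9, V4]]"

definition bases3 :: "label list list" where
  "bases3 =
   [[V0, V1, V2, V3, V4], [V0, V1, V2, V9, V4], [V0, V7, V8, V9, V4], [V0, V7, V2, V3, V4], [V0, V1,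
   V8, V3, V4], [V0, V7, V2, V9, V4]]"

section \<open>Vertex links\<close>

text \<open>One representative for each orbit of faces below dimension 4. The vertices form one
  orbit and the edges five; \<open>[V0, V4, V8]\<close> represents the only short orbit, of length
  4. The link of a 3-face is a pair of points, so its list of flips is empty.\<close>

definition links1 :: "(label list \<times> (label list \<times> label list) list \<times> label list) list" where
  "links1 =
   [([V0], [([V9, V10], [V1, V8, V11]), ([V2, V9], [V4, V5, V7]), ([V7, V10], [V2, V3, V5]), ([V1,
   V9], [V4, V8, V11]), ([V2, V11], [V1, V3, V10]), ([V9, V11], [V4, V7, V8]), ([V9], [V4, V5, V7,
   V8]), ([V7, V11], [V3, V4, V8]), ([V2, V7], [V3, V4, V5]), ([V7], [V3, V4, V5, V8]), ([V2, V4],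
   [V1, V3, V5]), ([V2], [V1, V3, V5, V10]), ([V4, V5], [V1, V3, V8]), ([V4], [V1, V3, V8, V11]),
   ([V5], [V1, V3, V8, V10])], [V1, V3, V8, V10, V11]), ([V0, V1], [([V3], [V2, V4, V11]), ([V8,
   V9], [V4, V10]), ([V9], [V4, V10, V11]), ([V8], [V4, V5, V10]), ([V11], [V2, V4, V10])], [V2, V4,
   V5, V10]), ([V0, V2], [([V9], [V4, V5, V7]), ([V11], [V1, V3, V10]), ([V1, V10], [V3, V5]),
   ([V10], [V3, V5, V7]), ([V7], [V3, V4, V5])], [V1, V3, V4, V5]), ([V0, V3], [([V1], [V2, V4,
   V11]), ([V4], [V2, V7, V11]), ([V2], [V7, V10, V11]), ([V11], [V7, V8, V10])], [V5, V7, V8,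
   V10]), ([V0, V4], [([V8], [V1, V5, V9]), ([V5], [V1, V2, V9]), ([V2, V9], [V1, V7]), ([V2], [V1,
   V3, V7]), ([V3], [V1, V7, V11])], [V1, V7, V9, V11]), ([V0, V5], [([V3], [V7, V8, V10]), ([V4,
   V9], [V2, V8]), ([V4], [V1, V2, V8]), ([V1], [V2, V8, V10]), ([V10], [V2, V7, V8])], [V2, V7, V8,
   V9]), ([V0, V1, V2], [([V11], [V3, V10]), ([V3], [V4, V10])], [V4, V5, V10]), ([V0, V1, V3], [],
   [V2, V4, V11]), ([V0, V1, V4], [([V8], [V5, V9]), ([V9], [V5, V11]), ([V5], [V2, V11])], [V2, V3,
   V11]), ([V0, V1, V5], [([V4], [V2, V8])], [V2, V8, V10]), ([V0, V1, V8], [([V4], [V5, V9])], [V5,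
   V9, V10]), ([V0, V1, V9], [([V11], [V4, V10])], [V4, V8, V10]), ([V0, V1, V10], [([V8], [V5,
   V9]), ([V5], [V2, V9])], [V2, V9, V11]), ([V0, V2, V4], [([V7], [V3, V9]), ([V1], [V3, V5])],
   [V3, V5, V9]), ([V0, V2, V5], [([V1], [V4, V10]), ([V7], [V9, V10])], [V4, V9, V10]), ([V0, V2,
   V7], [([V3], [V4, V10]), ([V4], [V9, V10])], [V5, V9, V10]), ([V0, V2, V9], [], [V4, V5, V7]),
   ([V0, V3, V7], [([V11], [V4, V8]), ([V5], [V8, V10]), ([V10], [V2, V8])], [V2, V4, V8]), ([V0,
   V3, V8], [([V5], [V7, V10])], [V7, V10, V11]), ([V0, V4, V8], [], [V1, V5, V9]), ([V0, V1, V2,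
   V3], [], [V4, V11]), ([V0, V1, V2, V4], [], [V3, V5]), ([V0, V1, V2, V5], [], [V4, V10]), ([V0,
   V1, V2, V10], [], [V5, V11]), ([V0, V1, V3, V4], [], [V2, V11]), ([V0, V1, V4, V5], [], [V2,
   V8]), ([V0, V1, V4, V8], [], [V5, V9]), ([V0, V1, V4, V9], [], [V8, V11]), ([V0, V1, V5, V8], [],
   [V4, V10]), ([V0, V1, V5, V10], [], [V2, V8]), ([V0, V1, V8, V10], [], [V5, V9]), ([V0, V2, V4,
   V7], [], [V3, V9]), ([V0, V2, V4, V9], [], [V5, V7]), ([V0, V2, V5, V7], [], [V9, V10]), ([V0,
   V2, V5, V9], [], [V4, V7])]"

lemma combinatorial_manifold_1: "combinatorial_manifold 4 (complex_of (facets bases1))"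
proof (rule combinatorial_manifold_facets)
  show "links_certified bases1 links1"
    by code_simp
  show "faces_covered bases1 (map fst links1)"
    by code_simp
qed

definition links2 :: "(label list \<times> (label list \<times> label list) list \<times> label list) list" where
  "links2 =
   [([V0], [([V1, V3], [V2, V4, V11]), ([V4, V5], [V1, V2, V9]), ([V1, V8], [V5, V9, V10]), ([V1,
   V4], [V2, V9, V11]), ([V4, V9], [V2, V7, V11]), ([V3, V5], [V7, V8, V10]), ([V5, V8], [V7, V9,
   V10]), ([V8, V9], [V7, V10, V11]), ([V2, V4], [V3, V7, V11]), ([V4], [V3, V7, V8, V11]), ([V8],
   [V3, V7, V10, V11]), ([V3], [V2, V7, V10, V11]), ([V1, V5], [V2, V9, V10]), ([V5], [V2, V7, V9,
   V10]), ([V7], [V2, V9, V10, V11])], [V1, V2, V9, V10, V11]), ([V0, V1], [([V8], [V5, V9, V10]),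
   ([V3], [V2, V4, V11]), ([V4, V5], [V2, V9]), ([V4], [V2, V9, V11]), ([V5], [V2, V9, V10])], [V2,
   V9, V10, V11]), ([V0, V2], [([V9], [V4, V5, V7]), ([V11], [V1, V3, V10]), ([V5, V10], [V1, V7]),
   ([V10], [V1, V3, V7]), ([V5], [V1, V4, V7])], [V1, V3, V4, V7]), ([V0, V3], [([V1], [V2, V4,
   V11]), ([V10, V11], [V2, V8]), ([V11], [V2, V4, V8]), ([V5], [V7, V8, V10]), ([V4], [V2, V7,
   V8])], [V2, V7, V8, V10]), ([V0, V4], [([V8], [V3, V7, V11]), ([V5], [V1, V2, V9]), ([V9, V11],
   [V1, V7]), ([V9], [V1, V2, V7]), ([V11], [V1, V3, V7])], [V1, V2, V3, V7]), ([V0, V5], [([V3],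
   [V7, V8, V10]), ([V4], [V1, V2, V9]), ([V8, V10], [V1, V7]), ([V8], [V1, V7, V9]), ([V9], [V1,
   V2, V7])], [V1, V2, V7, V10]), ([V0, V1, V2], [([V5], [V4, V10]), ([V11], [V3, V10])], [V3, V4,
   V10]), ([V0, V1, V3], [], [V2, V4, V11]), ([V0, V1, V4], [([V2], [V3, V5]), ([V3], [V5, V11])],
   [V5, V9, V11]), ([V0, V1, V5], [([V2], [V4, V10]), ([V10], [V4, V8])], [V4, V8, V9]), ([V0, V1,
   V8], [], [V5, V9, V10]), ([V0, V1, V9], [([V10], [V8, V11]), ([V4], [V5, V11])], [V5, V8, V11]),
   ([V0, V1, V10], [([V11], [V2, V9]), ([V2], [V5, V9])], [V5, V8, V9]), ([V0, V2, V4], [([V5], [V1,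
   V9]), ([V7], [V3, V9])], [V1, V3, V9]), ([V0, V2, V5], [([V9], [V4, V7]), ([V1], [V4, V10])],
   [V4, V7, V10]), ([V0, V2, V7], [([V4], [V3, V9]), ([V10], [V3, V5])], [V3, V5, V9]), ([V0, V2,
   V9], [], [V4, V5, V7]), ([V0, V3, V7], [([V2], [V4, V10]), ([V5], [V8, V10])], [V4, V8, V10]),
   ([V0, V3, V8], [([V10], [V5, V11]), ([V5], [V7, V11])], [V4, V7, V11]), ([V0, V4, V8], [], [V3,
   V7, V11]), ([V0, V1, V2, V3], [], [V4, V11]), ([V0, V1, V2, V4], [], [V3, V5]), ([V0, V1, V2,
   V5], [], [V4, V10]), ([V0, V1, V2, V10], [], [V5, V11]), ([V0, V1, V3, V4], [], [V2, V11]), ([V0,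
   V1, V4, V5], [], [V2, V9]), ([V0, V1, V4, V9], [], [V5, V11]), ([V0, V1, V5, V8], [], [V9, V10]),
   ([V0, V1, V5, V9], [], [V4, V8]), ([V0, V1, V5, V10], [], [V2, V8]), ([V0, V1, V8, V10], [], [V5,
   V9]), ([V0, V2, V4, V7], [], [V3, V9]), ([V0, V2, V4, V9], [], [V5, V7]), ([V0, V2, V5, V7], [],
   [V9, V10]), ([V0, V2, V5, V9], [], [V4, V7])]"

lemma combinatorial_manifold_2: "combinatorial_manifold 4 (complex_of (facets bases2))"
proof (rule combinatorial_manifold_facets)
  show "links_certified bases2 links2"
    by code_simp
  show "faces_covered bases2 (map fst links2)"
    by code_simp
qed

definition links3 :: "(label list \<times> (label list \<times> label list) list \<times> label list) list" where
  "links3 =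
   [([V0], [([V7, V8], [V4, V5, V9]), ([V7, V9], [V2, V4, V5]), ([V2, V9], [V1, V4, V5]), ([V4,
   V11], [V1, V8, V9]), ([V4, V9], [V1, V5, V8]), ([V4, V7], [V2, V3, V5]), ([V5, V7], [V2, V3,
   V10]), ([V7], [V2, V3, V10, V11]), ([V2, V4], [V1, V3, V5]), ([V4], [V1, V3, V5, V8]), ([V2, V5],
   [V1, V3, V10]), ([V2], [V1, V3, V10, V11]), ([V9, V11], [V1, V8, V10]), ([V11], [V1, V3, V8,
   V10]), ([V3], [V1, V5, V8, V10])], [V1, V5, V8, V9, V10]), ([V0, V1], [([V8], [V3, V4, V11]),
   ([V5], [V2, V9, V10]), ([V3], [V2, V4, V11]), ([V4], [V2, V9, V11])], [V2, V9, V10, V11]), ([V0,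
   V2], [([V3, V4], [V1, V7]), ([V4], [V1, V7, V9]), ([V9], [V1, V5, V7]), ([V5], [V1, V7, V10]),
   ([V10], [V1, V7, V11])], [V1, V3, V7, V11]), ([V0, V3], [([V2, V7], [V4, V11]), ([V2], [V1, V4,
   V11]), ([V1], [V4, V8, V11]), ([V10, V11], [V7, V8]), ([V11], [V4, V7, V8]), ([V10], [V5, V7,
   V8])], [V4, V5, V7, V8]), ([V0, V4], [([V5], [V3, V7, V8]), ([V11], [V1, V8, V9]), ([V7, V8],
   [V3, V9]), ([V8], [V1, V3, V9]), ([V7], [V2, V3, V9])], [V1, V2, V3, V9]), ([V0, V5], [([V1],
   [V2, V9, V10]), ([V4], [V3, V7, V8]), ([V2], [V7, V9, V10]), ([V3], [V7, V8, V10])], [V7, V8, V9,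
   V10]), ([V0, V1, V2], [([V9], [V4, V5]), ([V5], [V4, V10]), ([V3], [V4, V11])], [V4, V10, V11]),
   ([V0, V1, V3], [([V4], [V2, V8])], [V2, V8, V11]), ([V0, V1, V4], [([V9], [V2, V11]), ([V8], [V3,
   V11])], [V2, V3, V11]), ([V0, V1, V5], [], [V2, V9, V10]), ([V0, V1, V8], [], [V3, V4, V11]),
   ([V0, V1, V9], [([V2], [V4, V5]), ([V11], [V4, V10])], [V4, V5, V10]), ([V0, V1, V10], [([V2],
   [V5, V11])], [V5, V9, V11]), ([V0, V2, V4], [([V1], [V3, V9])], [V3, V7, V9]), ([V0, V2, V5],
   [([V9], [V1, V7])], [V1, V7, V10]), ([V0, V2, V7], [([V5], [V9, V10]), ([V3], [V4, V11]), ([V4],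
   [V9, V11])], [V9, V10, V11]), ([V0, V2, V9], [([V5], [V1, V7])], [V1, V4, V7]), ([V0, V3, V7],
   [([V2], [V4, V11]), ([V4], [V5, V11])], [V5, V10, V11]), ([V0, V3, V8], [([V4], [V1, V5]), ([V1],
   [V5, V11])], [V5, V10, V11]), ([V0, V4, V8], [([V11], [V1, V9]), ([V7], [V5, V9]), ([V3], [V1,
   V5])], [V1, V5, V9]), ([V0, V1, V2, V3], [], [V4, V11]), ([V0, V1, V2, V4], [], [V3, V9]), ([V0,
   V1, V2, V5], [], [V9, V10]), ([V0, V1, V2, V9], [], [V4, V5]), ([V0, V1, V2, V10], [], [V5,
   V11]), ([V0, V1, V3, V4], [], [V2, V8]), ([V0, V1, V3, V8], [], [V4, V11]), ([V0, V1, V4, V8],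
   [], [V3, V11]), ([V0, V1, V4, V9], [], [V2, V11]), ([V0, V1, V5, V9], [], [V2, V10]), ([V0, V1,
   V5, V10], [], [V2, V9]), ([V0, V2, V4, V7], [], [V3, V9]), ([V0, V2, V4, V9], [], [V1, V7]),
   ([V0, V2, V5, V7], [], [V9, V10]), ([V0, V2, V5, V9], [], [V1, V7])]"

lemma combinatorial_manifold_3: "combinatorial_manifold 4 (complex_of (facets bases3))"
proof (rule combinatorial_manifold_facets)
  show "links_certified bases3 links3"
    by code_simp
  show "faces_covered bases3 (map fst links3)"
    by code_simp
qed

section \<open>Flip sequences to the product of two spheres\<close>

lemma complex_of_map: "complex_of (map (map e) fs) = (`) e ` complex_of fs"
proof (intro equalityI subsetI)
  fix F assume "F \<in> complex_of (map (map e) fs)"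
  then obtain f where "F \<noteq> {}" "f \<in> set fs" "F \<subseteq> e ` set f"
    by (auto simp: complex_of_def)
  moreover then obtain G where "G \<subseteq> set f" "F = e ` G"
    by (meson subset_imageE)
  ultimately show "F \<in> (`) e ` complex_of fs"
    by (auto simp: complex_of_def)
next
  fix F assume "F \<in> (`) e ` complex_of fs"
  then obtain G f where "F = e ` G" "G \<noteq> {}" "f \<in> set fs" "G \<subseteq> set f"
    by (auto simp: complex_of_def)
  then show "F \<in> complex_of (map (map e) fs)"
    unfolding complex_of_def by (auto intro!: bexI[of _ f])
qed

lemma map_staircase: "map (map e) (staircase T rs cs) = staircase (\<lambda>i j. e (T i j)) rs cs"
  by (simp add: staircase_def map_concat comp_def staircase_paths_def split_def)

lemma of_nat_4_eq_iff:
  assumes "m < 4" "n < 4"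
  shows "of_nat m = (of_nat n :: 4) \<longleftrightarrow> m = n"
proof -
  have "m \<in> {0, 1, 2, 3}" "n \<in> {0, 1, 2, 3}"
    using assms by auto
  then show ?thesis by auto
qed

text \<open>The list \<open>cs\<close> fills the 4 by 4 grid row by row, so quotient and remainder
  of a position by 4 recover the grid point. This gives the relabelling to the complex on
  pairs.\<close>

lemma staircase_cells_PL_homeomorphic:
  fixes cs :: "'v::finite list"
  assumes cs: "distinct cs" "length cs = 16"
  shows "PL_homeomorphic (underlying_space (complex_of (staircase (\<lambda>i j. cs ! (4 * i + j)) (0, 1, 2, 3) (0, 1, 2, 3))))
    PL_S2_times_S2"
proof -
  let ?fs = "staircase (\<lambda>i j. cs ! (4 * i + j)) (0, 1, 2, 3) (0, 1, 2, 3)"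
  define idx where "idx l = (THE n. n < 16 \<and> cs ! n = l)" for l
  have idx: "idx (cs ! n) = n" if "n < 16" for n
    unfolding idx_def using that cs by (intro the_equality) (auto simp: nth_eq_iff_index_eq)
  define e where "e l = (of_nat (idx l div 4) :: 4, of_nat (idx l mod 4) :: 4)" for l
  have e: "e (cs ! (4 * i + j)) = (of_nat i, of_nat j)" if "i < 4" "j < 4" for i j
    using that by (simp add: e_def idx)
  have "inj_on e (set cs)"
  proof (rule inj_onI)
    fix x y assume "x \<in> set cs" "y \<in> set cs" and eq: "e x = e y"
    then obtain m n where mn: "x = cs ! m" "y = cs ! n" "m < 16" "n < 16"
      using cs(2) by (metis in_set_conv_nth)
    then have "m div 4 < 4" "n div 4 < 4"
      by auto
    then have "m div 4 = n div 4" "m mod 4 = n mod 4"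
      using eq of_nat_4_eq_iff[of "m div 4" "n div 4"] of_nat_4_eq_iff[of "m mod 4" "n mod 4"]
      by (simp_all add: e_def mn idx)
    then have "m = n"
      by (metis div_mult_mod_eq)
    then show "x = y"
      using mn by simp
  qed
  moreover have "\<Union> (complex_of ?fs) \<subseteq> set cs"
    using cs(2) by (auto simp: complex_of_def staircase_def staircase_paths_def triples_def)
  ultimately have "inj_on e (\<Union> (complex_of ?fs))"
    by (rule inj_on_subset)
  moreover have "map (map e) ?fs = grid_facets"
  proof -
    have 0: "e (cs ! j) = (0, of_nat j)" if "j < 4" for j
      using e[of 0 j] that by simp
    show ?thesis
      unfolding map_staircase
      using 0[of 0] 0[of 1] 0[of 2] 0[of 3] e[of 1 0] e[of 1 1] e[of 1 2] e[of 1 3]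
        e[of 2 0] e[of 2 1] e[of 2 2] e[of 2 3] e[of 3 0] e[of 3 1] e[of 3 2] e[of 3 3]
      by (simp add: staircase_def staircase_paths_def triples_def)
  qed
  ultimately have "PL_homeomorphic (underlying_space (complex_of ?fs)) (underlying_space (complex_of grid_facets))"
    using PL_homeomorphic_relabel[of e "complex_of ?fs"] by (simp flip: complex_of_map)
  then show ?thesis
    using grid_PL_homeomorphic by (rule PL_homeomorphic_trans)
qed

text \<open>The four moves from a facet to a single label place \<open>V13\<close>,
  \<open>V14\<close>, \<open>V15\<close> and \<open>V12\<close> in the interior of facets. They
  bring the number of vertices up to the 16 of the grid, whose arrangement is recorded in
  \<open>cells1\<close>.\<close>

definition path1 :: "(label list \<times> label list) list" where
  "path1 =
   [([V4, V6, V7, V8], [V5, V11]), ([V0, V1, V2, V3, V4], [V13]), ([V1, V2, V3, V4], [V5, V13]),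
   ([V1, V2, V4], [V0, V5, V13]), ([V0, V2, V4, V5], [V9, V13]), ([V0, V2, V5, V10], [V1, V7]),
   ([V2, V5, V10], [V1, V7, V9]), ([V4, V7, V8], [V3, V5, V11]), ([V0, V2, V4, V9], [V7, V13]),
   ([V0, V4, V7, V9], [V11, V13]), ([V3, V4, V5, V8, V11], [V14]), ([V4, V5, V8, V11], [V6, V14]),
   ([V0, V2, V9], [V5, V7, V13]), ([V0, V2, V5], [V1, V7, V13]), ([V0, V5, V7, V9], [V8, V13]),
   ([V0, V5, V9], [V4, V8, V13]), ([V0, V4, V5], [V1, V8, V13]), ([V0, V5, V13], [V1, V7, V8]),
   ([V2, V5, V7], [V1, V9, V13]), ([V3, V4, V6], [V2, V5, V7]), ([V4, V6, V7], [V2, V5, V11]), ([V1,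
   V8, V11], [V3, V4, V6]), ([V4, V8, V11], [V3, V6, V14]), ([V6, V9, V11], [V1, V2, V4]), ([V1, V2,
   V5, V6], [V3, V9]), ([V0, V9, V10], [V1, V8, V11]), ([V0, V1, V9], [V4, V8, V11]), ([V1, V8, V9,
   V11], [V4, V10]), ([V1, V8, V9], [V4, V6, V10]), ([V1, V6, V8], [V3, V4, V10]), ([V3, V4, V6,
   V8], [V10, V14]), ([V3, V6, V8], [V10, V11, V14]), ([V3, V6, V10, V11], [V2, V14]), ([V0, V2,
   V4], [V3, V7, V13]), ([V5, V7, V13], [V1, V8, V9]), ([V2, V3, V4], [V5, V7, V13]), ([V1, V6,
   V11], [V2, V3, V4]), ([V3, V6, V11], [V2, V4, V14]), ([V3, V6, V14], [V2, V4, V10]), ([V4, V6,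
   V11], [V2, V5, V14]), ([V2, V3, V4, V11, V14], [V15]), ([V2, V4, V11, V14], [V5, V15]), ([V4,
   V11, V14], [V3, V5, V15]), ([V7, V8, V10], [V6, V9, V11]), ([V8, V9, V10], [V4, V6, V11]), ([V6,
   V8, V10], [V4, V11, V14]), ([V0, V1, V5], [V7, V8, V10]), ([V1, V5, V7], [V8, V9, V10]), ([V5,
   V7, V9], [V6, V8, V10]), ([V1, V5, V6], [V3, V9, V10]), ([V1, V5, V10], [V3, V8, V9]), ([V5, V9,
   V10], [V3, V6, V8]), ([V0, V5], [V3, V7, V8, V10]), ([V5, V10], [V3, V6, V7, V8]), ([V5, V7, V8],
   [V3, V6, V11]), ([V5, V8, V11], [V3, V6, V14]), ([V0, V4, V9], [V8, V11, V13]), ([V0, V4, V8],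
   [V1, V11, V13]), ([V0, V4, V7], [V3, V11, V13]), ([V0, V4], [V1, V3, V11, V13]), ([V0, V3, V7,
   V11, V13], [V12]), ([V0, V9], [V7, V8, V11, V13]), ([V0, V7, V11, V13], [V8, V12]), ([V0, V7,
   V11], [V3, V8, V12]), ([V1, V2, V5], [V3, V9, V13]), ([V1, V5, V9], [V3, V8, V13]), ([V1, V5],
   [V3, V4, V8, V13]), ([V2, V9, V10], [V1, V7, V11]), ([V1, V2, V10], [V0, V7, V11]), ([V3, V4,
   V6], [V1, V2, V10]), ([V5, V8, V13], [V3, V4, V9]), ([V5, V8, V9], [V3, V4, V6]), ([V2, V4, V13],
   [V5, V7, V9]), ([V2, V5, V13], [V3, V7, V9]), ([V5, V13], [V3, V4, V7, V9]), ([V5, V8], [V3, V4,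
   V6, V14]), ([V1, V3, V6], [V2, V9, V10]), ([V1, V6], [V2, V4, V9, V10]), ([V2, V9, V13], [V1, V3,
   V7]), ([V2, V13], [V0, V1, V3, V7]), ([V4, V7, V13], [V3, V9, V11]), ([V3, V4, V7], [V5, V9,
   V11]), ([V4, V7], [V2, V5, V9, V11])]"

definition cells1 :: "label list" where
  "cells1 = [V11, V7, V0, V12, V4, V9, V1, V13, V14, V6, V10, V8, V15, V5, V2, V3]"

lemma facets1_PL_homeomorphic: "PL_homeomorphic (underlying_space (complex_of (facets bases1))) PL_S2_times_S2"
proof -
  have "flips_to path1 (facets bases1) (staircase (\<lambda>i j. cells1 ! (4 * i + j)) (0, 1, 2, 3) (0, 1, 2, 3))"
    by code_simp
  moreover have "distinct cells1" "length cells1 = 16"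
    by (simp_all add: cells1_def)
  ultimately show ?thesis
    by (blast intro: PL_homeomorphic_trans flips_to_PL_homeomorphic staircase_cells_PL_homeomorphic)
qed

definition path2 :: "(label list \<times> label list) list" where
  "path2 =
   [([V1, V4, V5, V8, V9], [V13]), ([V1, V4, V8, V9], [V6, V13]), ([V4, V8, V9], [V5, V6, V13]),
   ([V5, V6, V8, V9], [V7, V13]), ([V5, V7, V8, V9], [V0, V13]), ([V5, V8, V9], [V0, V1, V13]),
   ([V0, V7, V11], [V4, V8, V9]), ([V0, V4, V8, V11], [V3, V9]), ([V0, V4, V8], [V3, V7, V9]), ([V0,
   V4, V11], [V1, V3, V9]), ([V1, V8, V9, V10], [V0, V6]), ([V1, V8, V9], [V0, V6, V13]), ([V3, V4,
   V11], [V1, V8, V9]), ([V8, V9, V13], [V0, V6, V7]), ([V5, V6, V8], [V4, V7, V13]), ([V4, V5, V6,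
   V7], [V3, V13]), ([V4, V5, V7], [V3, V8, V13]), ([V2, V6, V7], [V3, V4, V11]), ([V2, V3, V4, V6],
   [V5, V11]), ([V2, V3, V6], [V1, V5, V11]), ([V2, V4, V6], [V5, V9, V11]), ([V1, V5, V9], [V0, V4,
   V13]), ([V2, V6, V11], [V1, V5, V9]), ([V1, V5, V13], [V0, V4, V8]), ([V0, V2, V9], [V4, V5,
   V7]), ([V1, V10, V11], [V0, V2, V9]), ([V0, V2, V5, V7], [V4, V10]), ([V5, V9, V10], [V2, V6,
   V7]), ([V2, V5, V6, V10], [V1, V7]), ([V3, V6, V8], [V1, V10, V11]), ([V4, V7, V13], [V3, V6,
   V8]), ([V2, V3, V10], [V0, V7, V11]), ([V5, V7, V8], [V0, V3, V13]), ([V1, V3, V6], [V5, V10,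
   V11]), ([V3, V6, V10], [V5, V7, V11]), ([V3, V7, V10], [V0, V5, V11]), ([V7, V8, V13], [V0, V3,
   V6]), ([V0, V3, V6, V7, V13], [V12]), ([V0, V6, V7, V13], [V9, V12]), ([V1, V3, V10], [V5, V8,
   V11]), ([V1, V3, V4, V5], [V2, V8]), ([V1, V3, V5], [V2, V8, V11]), ([V0, V1, V11], [V2, V3,
   V9]), ([V1, V3, V11], [V2, V8, V9]), ([V3, V9, V11], [V0, V2, V8]), ([V0, V9, V11], [V2, V8,
   V10]), ([V1, V9, V10], [V0, V2, V6]), ([V0, V9, V10], [V2, V6, V8]), ([V5, V6, V10], [V1, V7,
   V11]), ([V6, V10, V11], [V1, V7, V8]), ([V6, V8, V11], [V1, V4, V7]), ([V4, V8, V11], [V1, V7,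
   V9]), ([V2, V3, V7], [V0, V4, V11]), ([V0, V2, V7], [V4, V10, V11]), ([V0, V2, V4, V10, V11],
   [V14]), ([V0, V2, V4, V11], [V3, V14]), ([V2, V7, V11], [V4, V9, V10]), ([V2, V4, V7], [V5, V9,
   V10]), ([V4, V5, V7], [V0, V9, V10]), ([V4, V7, V10], [V0, V9, V11]), ([V0, V4, V10, V11], [V9,
   V14]), ([V0, V4, V7], [V3, V9, V11]), ([V0, V4, V11], [V3, V9, V14]), ([V4, V8, V9], [V1, V3,
   V7]), ([V4, V7, V9], [V1, V3, V11]), ([V4, V7, V11], [V1, V3, V6]), ([V6, V7, V11], [V1, V3,
   V5]), ([V1, V4, V11], [V3, V6, V9]), ([V4, V6, V11], [V3, V5, V9]), ([V6, V11], [V1, V3, V5,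
   V9]), ([V4, V5, V6], [V3, V9, V13]), ([V4, V6, V9], [V1, V3, V13]), ([V3, V6, V9], [V1, V5,
   V13]), ([V3, V5, V6], [V1, V7, V13]), ([V4, V7], [V1, V3, V6, V8]), ([V4, V6], [V1, V3, V8,
   V13]), ([V0, V7, V8], [V3, V6, V9]), ([V0, V6, V7], [V3, V9, V12]), ([V3, V10], [V0, V5, V8,
   V11]), ([V1, V10, V11], [V5, V7, V8]), ([V5, V10, V11], [V0, V7, V8]), ([V5, V8, V10], [V0, V1,
   V7]), ([V6, V9, V10], [V2, V7, V8]), ([V8, V9, V10], [V2, V7, V11]), ([V0, V4, V9, V10, V14],
   [V15]), ([V0, V4, V10, V14], [V2, V15]), ([V8, V10, V11], [V0, V2, V7]), ([V2, V8, V10], [V0, V6,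
   V7]), ([V8, V10], [V0, V1, V6, V7]), ([V6, V10], [V0, V1, V2, V7]), ([V2, V4, V9], [V5, V10,
   V11]), ([V1, V10], [V0, V2, V5, V7]), ([V0, V1, V3], [V2, V4, V9]), ([V0, V3, V4], [V2, V9,
   V14]), ([V0, V4, V14], [V2, V9, V15]), ([V5, V8, V13], [V0, V3, V4]), ([V4, V8, V13], [V0, V1,
   V3]), ([V8, V13], [V0, V1, V3, V6]), ([V0, V2, V3, V9], [V8, V14]), ([V0, V2, V3], [V8, V11,
   V14]), ([V2, V3, V5], [V4, V8, V11]), ([V2, V3, V11], [V4, V8, V14]), ([V2, V3, V14], [V4, V8,
   V9]), ([V2, V3], [V1, V4, V8, V9]), ([V3, V5, V8], [V0, V4, V11]), ([V3, V8, V11], [V0, V4,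
   V14]), ([V1, V7, V9], [V3, V8, V11]), ([V2, V5, V6], [V1, V7, V9]), ([V5, V6], [V1, V7, V9,
   V13]), ([V1, V2, V11], [V5, V8, V9]), ([V1, V9, V11], [V3, V5, V8]), ([V1, V11], [V3, V5, V7,
   V8])]"

definition cells2 :: "label list" where
  "cells2 = [V0, V7, V6, V12, V4, V5, V1, V13, V14, V11, V8, V3, V15, V10, V2, V9]"

lemma facets2_PL_homeomorphic: "PL_homeomorphic (underlying_space (complex_of (facets bases2))) PL_S2_times_S2"
proof -
  have "flips_to path2 (facets bases2) (staircase (\<lambda>i j. cells2 ! (4 * i + j)) (0, 1, 2, 3) (0, 1, 2, 3))"
    by code_simp
  moreover have "distinct cells2" "length cells2 = 16"
    by (simp_all add: cells2_def)
  ultimately show ?thesis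
    by (blast intro: PL_homeomorphic_trans flips_to_PL_homeomorphic staircase_cells_PL_homeomorphic)
qed

definition path3 :: "(label list \<times> label list) list" where
  "path3 =
   [([V2, V4, V6, V11], [V3, V9]), ([V2, V4, V11], [V3, V7, V9]), ([V2, V4, V7], [V0, V3, V9]),
   ([V2, V5, V7, V10], [V0, V6]), ([V0, V2, V6, V7, V10], [V15]), ([V4, V6, V7, V8], [V5, V11]),
   ([V4, V6, V8], [V1, V5, V11]), ([V1, V4, V6], [V5, V9, V11]), ([V2, V5, V7], [V0, V6, V9]), ([V2,
   V3, V5, V6], [V4, V10]), ([V2, V3, V5], [V1, V4, V10]), ([V2, V3, V10], [V1, V4, V6]), ([V3, V5,
   V6], [V4, V7, V10]), ([V3, V4, V6, V7, V10], [V14]), ([V1, V3, V5], [V4, V8, V10]), ([V1, V3,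
   V10], [V4, V6, V8]), ([V3, V4, V6, V10], [V8, V14]), ([V3, V6, V10], [V7, V8, V14]), ([V6, V7,
   V9, V10], [V2, V8]), ([V6, V7, V8, V10], [V2, V14]), ([V3, V5, V7], [V0, V4, V10]), ([V3, V5],
   [V0, V4, V8, V10]), ([V3, V4, V8, V10], [V0, V14]), ([V7, V9, V10], [V2, V8, V11]), ([V2, V7, V8,
   V10], [V11, V14]), ([V7, V8, V10], [V3, V11, V14]), ([V0, V4, V5], [V7, V8, V10]), ([V0, V5, V8],
   [V7, V9, V10]), ([V0, V7, V8], [V4, V9, V10]), ([V0, V8, V9], [V4, V10, V11]), ([V1, V2, V9],
   [V0, V4, V5]), ([V2, V5, V9], [V0, V4, V6]), ([V2, V4, V9], [V0, V3, V6]), ([V4, V5, V8, V10],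
   [V1, V7]), ([V3, V8, V10], [V0, V11, V14]), ([V3, V10, V11], [V0, V7, V14]), ([V7, V10, V11],
   [V0, V2, V14]), ([V10, V11, V14], [V0, V2, V8]), ([V2, V11, V14], [V0, V7, V8]), ([V11, V14],
   [V0, V3, V7, V8]), ([V2, V3, V4], [V0, V1, V6]), ([V1, V3, V4], [V0, V6, V8]), ([V3, V4, V8],
   [V0, V6, V14]), ([V0, V2, V7, V10], [V14, V15]), ([V2, V7, V10], [V6, V14, V15]), ([V1, V4, V9],
   [V0, V5, V11]), ([V1, V6, V8, V11], [V3, V5]), ([V6, V8, V11], [V3, V5, V7]), ([V6, V7, V11],
   [V3, V4, V5]), ([V4, V6, V11], [V3, V5, V9]), ([V4, V6, V9], [V0, V3, V5]), ([V5, V7, V11], [V3,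
   V4, V8]), ([V0, V1, V9], [V5, V10, V11]), ([V6, V10, V11], [V1, V2, V9]), ([V6, V9, V10], [V1,
   V2, V8]), ([V5, V8, V10], [V1, V7, V9]), ([V5, V8, V9], [V1, V6, V7]), ([V6, V8, V9], [V1, V2,
   V7]), ([V1, V8, V9], [V2, V7, V10]), ([V2, V8, V9], [V7, V10, V11]), ([V2, V9, V10], [V1, V7,
   V11]), ([V2, V6, V11], [V1, V3, V9]), ([V2, V9, V11], [V1, V3, V7]), ([V2, V3, V11], [V0, V1,
   V7]), ([V1, V9, V10], [V5, V7, V11]), ([V2, V3, V7], [V0, V1, V9]), ([V2, V3], [V0, V1, V6, V9]),
   ([V2, V9], [V0, V1, V6, V7]), ([V0, V1, V3, V6, V9], [V13]), ([V0, V1, V3, V9], [V7, V13]), ([V0,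
   V3, V7, V9, V13], [V12]), ([V1, V3, V7, V9], [V11, V13]), ([V3, V7, V9, V13], [V11, V12]), ([V0,
   V1, V9], [V6, V7, V13]), ([V0, V6, V7, V9], [V5, V13]), ([V6, V7, V9], [V1, V5, V13]), ([V6,
   V11], [V1, V3, V5, V9]), ([V1, V7, V9], [V5, V11, V13]), ([V1, V9, V11], [V3, V5, V13]), ([V1,
   V9], [V3, V5, V6, V13]), ([V6, V9], [V0, V3, V5, V13]), ([V1, V3, V7], [V0, V11, V13]), ([V3, V7,
   V13], [V0, V11, V12]), ([V5, V8, V11], [V1, V3, V4]), ([V4, V5, V8], [V1, V3, V7]), ([V5, V8],
   [V1, V3, V6, V7]), ([V1, V5, V6], [V3, V7, V13]), ([V0, V2, V4], [V1, V5, V6]), ([V2, V4], [V1,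
   V5, V6, V10]), ([V2, V5], [V0, V1, V6, V10]), ([V3, V10], [V0, V4, V7, V14]), ([V8, V9], [V4, V7,
   V10, V11])]"

definition cells3 :: "label list" where
  "cells3 = [V0, V11, V9, V12, V6, V1, V5, V13, V14, V8, V4, V3, V15, V2, V10, V7]"

lemma facets3_PL_homeomorphic: "PL_homeomorphic (underlying_space (complex_of (facets bases3))) PL_S2_times_S2"
proof -
  have "flips_to path3 (facets bases3) (staircase (\<lambda>i j. cells3 ! (4 * i + j)) (0, 1, 2, 3) (0, 1, 2, 3))"
    by code_simp
  moreover have "distinct cells3" "length cells3 = 16"
    by (simp_all add: cells3_def)
  ultimately show ?thesis
    by (blast intro: PL_homeomorphic_trans flips_to_PL_homeomorphic staircase_cells_PL_homeomorphic)
qed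

section \<open>Face counts\<close>

text \<open>Subsets are counted by deciding vertex by vertex whether to include it. Including a
  vertex discards the facets without it, so branches that lead to nonfaces are cut early. Integers
  are returned because the results enter an alternating sum.\<close>

fun kcount :: "nat \<Rightarrow> 'a list \<Rightarrow> 'a list list \<Rightarrow> int" where
  "kcount 0 xs fs = (if fs = [] then 0 else 1)"
| "kcount (Suc k) [] fs = 0"
| "kcount (Suc k) (x # xs) fs =
    (if fs = [] then 0 else kcount k xs (filter (mem x) fs) + kcount (Suc k) xs fs)"

lemma kcount:
  assumes "distinct xs"
  shows "kcount k xs fs = int (card {F. F \<subseteq> set xs \<and> card F = k \<and> (\<exists>f\<in>set fs. F \<subseteq> set f)})"
  using assms
proof (induction k xs fs rule: kcount.induct)
  case (1 xs fs)
  have "{F. F \<subseteq> set xs \<and> card F = 0 \<and> (\<exists>f\<in>set fs. F \<subseteq> set f)} = (if fs = [] then {} else {{}})"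
    using finite_subset[OF _ finite_set[of xs]] by (cases fs) auto
  then show ?case by simp
next
  case (2 k fs)
  have "{F. F \<subseteq> set [] \<and> card F = Suc k \<and> (\<exists>f\<in>set fs. F \<subseteq> set f)} = {}"
    by auto
  then show ?case by (metis card.empty kcount.simps(2) of_nat_0)
next
  case (3 k x xs fs)
  show ?case
  proof (cases "fs = []")
    case False
    let ?S = "{F. F \<subseteq> set (x # xs) \<and> card F = Suc k \<and> (\<exists>f\<in>set fs. F \<subseteq> set f)}"
    let ?A = "{F. F \<subseteq> set xs \<and> card F = k \<and> (\<exists>f\<in>set (filter (mem x) fs). F \<subseteq> set f)}"
    let ?B = "{F. F \<subseteq> set xs \<and> card F = Suc k \<and> (\<exists>f\<in>set fs. F \<subseteq> set f)}"
    have x: "x \<notin> set xs" using 3(3) by simp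
    have fin: "finite ?A" "finite ?B"
      by (rule finite_subset[of _ "Pow (set xs)"]; auto)+
    have "?S = insert x ` ?A \<union> ?B"
    proof (intro equalityI subsetI)
      fix F assume F: "F \<in> ?S"
      show "F \<in> insert x ` ?A \<union> ?B"
      proof (cases "x \<in> F")
        case True
        have "finite F" using F finite_subset[of F "set (x # xs)"] by simp
        then have "F - {x} \<in> ?A"
          using F True by auto
        then show ?thesis
          using True by (intro UnI1 image_eqI[of _ _ "F - {x}"]) auto
      qed (use F in auto)
    next
      fix F assume "F \<in> insert x ` ?A \<union> ?B"
      then show "F \<in> ?S"
      proof
        assume "F \<in> insert x ` ?A"
        then obtain G where G: "G \<in> ?A" "F = insert x G" by blast
        then have "finite G" "x \<notin> G"
          using x finite_subset[of G "set xs"] by auto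
        then show ?thesis
          using G by auto
      qed auto
    qed
    moreover have "insert x ` ?A \<inter> ?B = {}"
      using x by auto
    moreover have "inj_on (insert x) ?A"
      using x by (intro inj_onI) (metis (no_types, lifting) insert_ident mem_Collect_eq subsetD)
    ultimately have "card ?S = card ?A + card ?B"
      using fin by (simp add: card_Un_disjoint card_image)
    then show ?thesis
      using 3 False by simp
  qed simp
qed

declare kcount.simps [simp del]

section \<open>Transfer from labels to the vertex type of the theorem\<close>

definition realize :: "label list list \<Rightarrow> 12 set set" where
  "realize bs = (`) vtx ` complex_of (facets bs)"

definition in_core :: "label list list \<Rightarrow> bool" where
  "in_core bs \<longleftrightarrow> (\<forall>b\<in>set bs. set b \<subseteq> set core)"

lemma rot_core: "rot ` set core = set core"
  by auto

lemma rot_pow_core: "(rot ^^ k) ` set core = set core"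
proof (induction k)
  case (Suc k)
  have "(rot ^^ Suc k) ` set core = rot ` (rot ^^ k) ` set core"
    by (simp only: funpow.simps image_comp)
  also have "\<dots> = set core"
    by (simp only: Suc rot_core)
  finally show ?case .
qed simp

lemma facets_core: "in_core bs \<Longrightarrow> f \<in> set (facets bs) \<Longrightarrow> set f \<subseteq> set core"
  using rot_pow_core by (fastforce simp: in_core_def in_facets)

lemma complex_of_core: "in_core bs \<Longrightarrow> F \<in> complex_of (facets bs) \<Longrightarrow> F \<subseteq> set core"
  using facets_core unfolding complex_of_def by blast

lemma inj_on_vtx_complex: "in_core bs \<Longrightarrow> inj_on vtx (\<Union> (complex_of (facets bs)))"
  by (rule inj_on_subset[OF inj_on_vtx]) (use complex_of_core in blast)

lemma vtx_image_eq_iff: "F \<subseteq> set core \<Longrightarrow> G \<subseteq> set core \<Longrightarrow> vtx ` F = vtx ` G \<longleftrightarrow> F = G"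
  by (rule inj_on_image_eq_iff[OF inj_on_vtx])

lemma vtx_in_realize:
  assumes "in_core bs" "F \<subseteq> set core"
  shows "vtx ` F \<in> realize bs \<longleftrightarrow> F \<in> complex_of (facets bs)"
proof
  assume "vtx ` F \<in> realize bs"
  then obtain G where G: "G \<in> complex_of (facets bs)" "vtx ` F = vtx ` G"
    unfolding realize_def by blast
  then show "F \<in> complex_of (facets bs)"
    using vtx_image_eq_iff[OF assms(2) complex_of_core[OF assms(1) G(1)]] by simp
qed (simp add: realize_def)

lemma realize_abstract_complex: "abstract_complex (realize bs)"
  unfolding realize_def by (intro abstract_complex_image complex_of_abstract_complex)

lemma f_number_realize:
  assumes "in_core bs"
  shows "int (f_number i (realize bs)) = kcount (Suc i) core (facets bs)"
proof -
  let ?S = "{F. F \<subseteq> set core \<and> card F = Suc i \<and> (\<exists>f\<in>set (facets bs). F \<subseteq> set f)}"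
  have card: "card (vtx ` F) = card F" if "F \<subseteq> set core" for F
    using that by (intro card_image inj_on_subset[OF inj_on_vtx])
  have "faces i (realize bs) = (`) vtx ` ?S"
  proof (intro equalityI subsetI)
    fix F assume "F \<in> faces i (realize bs)"
    then obtain G where "G \<in> complex_of (facets bs)" "F = vtx ` G" "card F = Suc i"
      by (auto simp: faces_def realize_def)
    then show "F \<in> (`) vtx ` ?S"
      using complex_of_core[OF assms] card by (auto simp: complex_of_def)
  next
    fix F assume "F \<in> (`) vtx ` ?S"
    then obtain G where "F = vtx ` G" "G \<subseteq> set core" "card G = Suc i" "\<exists>f\<in>set (facets bs). G \<subseteq> set f"
      by blast
    moreover from this have "G \<noteq> {}" by auto
    ultimately show "F \<in> faces i (realize bs)"
      using card by (auto simp: faces_def realize_def complex_of_def)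
  qed
  moreover have "inj_on ((`) vtx) ?S"
  proof (rule inj_onI)
    fix F G assume "F \<in> ?S" "G \<in> ?S" "vtx ` F = vtx ` G"
    then show "F = G"
      using vtx_image_eq_iff[of F G] by simp
  qed
  ultimately have "f_number i (realize bs) = card ?S"
    by (simp add: f_number_def card_image)
  then show ?thesis
    by (subst kcount) simp_all
qed

lemma zeta_image_realize: "in_core bs \<Longrightarrow> (`) zeta ` realize bs = realize bs"
proof -
  assume bs: "in_core bs"
  have "zeta ` vtx ` F = vtx ` rot ` F" if "F \<in> complex_of (facets bs)" for F
    unfolding image_image
  proof (rule image_cong[OF refl])
    show "zeta (vtx x) = vtx (rot x)" if "x \<in> F" for x
      using complex_of_core[OF bs \<open>F \<in> complex_of (facets bs)\<close>] vtx_rot[of x] that by auto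
  qed
  then have "(`) zeta ` realize bs = (`) vtx ` (`) rot ` complex_of (facets bs)"
    unfolding realize_def image_image[of "(`) zeta"] image_image[of "(`) vtx"] by (intro image_cong[OF refl])
  then show ?thesis
    by (simp add: facets_rot realize_def)
qed

lemma bij_zeta: "bij zeta"
proof (rule bijI')
  show "\<exists>x. y = zeta x" for y
    by (rule exI[of _ "y - 1"]) (simp add: zeta_eq)
qed (simp add: zeta_eq)

lemma euler_char_realize:
  assumes "in_core bs" "\<forall>F\<in>realize bs. card F \<le> 5" "vertices (realize bs) = UNIV"
  shows "euler_char (realize bs) = kcount 1 core (facets bs) - kcount 2 core (facets bs)
    + kcount 3 core (facets bs) - kcount 4 core (facets bs) + kcount 5 core (facets bs)"
proof -
  have zero: "f_number i (realize bs) = 0" if "i \<ge> 5" for i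
  proof -
    have "faces i (realize bs) = {}"
      using assms(2) that by (fastforce simp: faces_def)
    then show ?thesis
      by (simp add: f_number_def)
  qed
  have "euler_char (realize bs) = (\<Sum>i<12. (-1) ^ i * int (f_number i (realize bs)))"
    by (simp add: euler_char_def assms(3))
  also have "\<dots> = (\<Sum>i<5. (-1) ^ i * int (f_number i (realize bs)))"
    using zero by (intro sum.mono_neutral_right) auto
  finally show ?thesis
    by (simp add: f_number_realize[OF assms(1)] eval_nat_numeral)
qed

text \<open>The index of \<open>kcount\<close> is the number of vertices of a face and exceeds its
  dimension by one. The constants come from 72 = 6 * 12 = 18 * 4.\<close>

definition counts_ok :: "label list list \<Rightarrow> bool" where
  "counts_ok bs = (let fs = facets bs in
     kcount 5 core fs = 72 \<and> kcount 1 core fs = 12 \<and>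
     kcount 1 core fs - kcount 2 core fs + kcount 3 core fs - kcount 4 core fs + kcount 5 core fs = 4)"

lemma admissible_realize:
  assumes K: "combinatorial_manifold 4 (complex_of (facets bs))" and bs: "list_all (list_all (\<lambda>v. mem v core)) bs"
    and counts: "counts_ok bs" and diag: "\<not> ex (sub [V0, V6]) (facets bs)"
    and vert: "all (\<lambda>v. ex (mem v) (facets bs)) core"
  shows "admissible (realize bs)"
proof -
  have core: "in_core bs"
    using bs by (auto simp: in_core_def list_all_iff)
  have M: "combinatorial_manifold 4 (realize bs)"
    unfolding realize_def by (rule combinatorial_manifold_image[OF K inj_on_vtx_complex[OF core]])
  then have card: "\<forall>F\<in>realize bs. card F \<le> 5"
    by (simp add: combinatorial_manifold_def)
  have "vtx x \<in> vertices (realize bs)" if "x \<in> set core" for x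
  proof -
    have "{x} \<in> complex_of (facets bs)"
      using vert that unfolding all_iff ex_iff mem_iff by (auto simp: complex_of_def)
    then have "vtx ` {x} \<in> realize bs"
      unfolding realize_def by (rule imageI)
    then show ?thesis
      unfolding vertices_def by blast
  qed
  then have "vtx ` set core \<subseteq> vertices (realize bs)"
    by (intro image_subsetI)
  then have V: "vertices (realize bs) = UNIV"
    unfolding vtx_core by (rule top.extremum_uniqueI)
  have "F \<in> realize bs \<longleftrightarrow> zeta ` F \<in> realize bs" for F
  proof
    assume "zeta ` F \<in> realize bs"
    then obtain G where G: "G \<in> realize bs" "zeta ` F = zeta ` G"
      using zeta_image_realize[OF core] by (metis imageE)
    then have "F = G"
      using inj_image_eq_iff[OF bij_is_inj[OF bij_zeta]] by simp
    then show "F \<in> realize bs"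
      using G(1) by simp
  next
    assume "F \<in> realize bs"
    then show "zeta ` F \<in> realize bs"
      using zeta_image_realize[OF core] by (metis imageI)
  qed
  then have "automorphism (realize bs) zeta"
    using bij_zeta by (simp add: automorphism_def V permutes_def bij_iff)
  moreover have "{0, 6} \<notin> realize bs"
  proof -
    have "{V0, V6} \<notin> complex_of (facets bs)"
      using diag by (auto simp: complex_of_def)
    then have "vtx ` {V0, V6} \<notin> realize bs"
      by (subst vtx_in_realize[OF core]) auto
    then show ?thesis by simp
  qed
  then have "diagonal {0, 6} (realize bs)"
    by (simp add: diagonal_def V)
  moreover have "int (f_number 4 (realize bs)) = 72" "int (f_number 0 (realize bs)) = 12" "euler_char (realize bs) = 4"
    using counts f_number_realize[OF core] euler_char_realize[OF core card V]
    by (simp_all add: counts_ok_def Let_def flip: One_nat_def)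
  ultimately show ?thesis
    unfolding admissible_def using M V by simp
qed

lemma admissible_counts_ok:
  assumes "admissible (realize bs)" "in_core bs"
  shows "counts_ok bs"
proof -
  have card: "\<forall>F\<in>realize bs. card F \<le> 5"
    using assms(1) by (simp add: admissible_def combinatorial_manifold_def)
  have "f_number 4 (realize bs) = 72" "f_number 0 (realize bs) = 12" "euler_char (realize bs) = 4"
    using assms(1) by (auto simp: admissible_def)
  then show ?thesis
    using f_number_realize[OF assms(2), of 4] f_number_realize[OF assms(2), of 0]
      euler_char_realize[OF assms(2) card] assms(1)
    by (simp add: counts_ok_def Let_def admissible_def flip: One_nat_def)
qed

text \<open>Faces have at most five vertices, so the link of a 3-face consists of single vertices
  and its realization is a set of distinct basis vectors. Being homeomorphic to the 0-sphere, this
  set has two elements.\<close>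

lemma ridge_in_two_facets:
  assumes M: "combinatorial_manifold 4 M" and R: "R \<in> M" "card R = 4"
  shows "card {v. v \<notin> R \<and> insert v R \<in> M} = 2"
proof -
  let ?W = "{v. v \<notin> R \<and> insert v R \<in> M}"
  have ac: "abstract_complex M" and card: "\<And>F. F \<in> M \<Longrightarrow> card F \<le> 5"
    using M by (simp_all add: combinatorial_manifold_def)
  have finR: "finite R" using R(2) card.infinite by fastforce
  have "link R M = (\<lambda>v. {v}) ` ?W"
  proof (intro equalityI subsetI)
    fix G assume "G \<in> link R M"
    then have G: "G \<in> M" "G \<inter> R = {}" "G \<union> R \<in> M"
      by (auto simp: link_def)
    then have "finite G" "G \<noteq> {}"
      using ac unfolding abstract_complex_def by blast+
    moreover have "card (G \<union> R) \<le> 5"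
      using G(3) card by blast
    moreover from calculation have "card G \<noteq> 0" by simp
    moreover have "card (G \<union> R) = card G + card R"
      using calculation(1) finR G(2) by (rule card_Un_disjoint)
    ultimately have "card G = 1"
      using R(2) by linarith
    then obtain v where "G = {v}" by (auto simp: card_1_singleton_iff)
    then show "G \<in> (\<lambda>v. {v}) ` ?W"
      using G by auto
  next
    fix G assume "G \<in> (\<lambda>v. {v}) ` ?W"
    then obtain v where v: "G = {v}" "v \<notin> R" "insert v R \<in> M" by blast
    have "{v} \<in> M"
      by (rule abstract_complex_subset[OF ac v(3)]) auto
    then show "G \<in> link R M"
      using v by (auto simp: link_def)
  qed
  then have space: "underlying_space (link R M) = (\<lambda>v. axis v 1) ` ?W"
    by (auto simp: underlying_space_def)
  have "R \<in> faces 3 M"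
    using R by (simp add: faces_def)
  moreover have "\<forall>k\<le>4. \<forall>F\<in>faces k M. triangulated_sphere (int 4 - int k - 1) (link F M)"
    using M unfolding combinatorial_manifold_def by blast
  ultimately have "triangulated_sphere 0 (link R M)"
    by (elim allE[of _ 3]) simp
  then have "top_of_set (underlying_space (link R M)) homeomorphic_space nsphere 0"
    by (simp add: triangulated_sphere_def)
  also have "nsphere 0 homeomorphic_space top_of_set (sphere (0::real) 1)"
    by (rule homeomorphic_space_sym[THEN iffD1]) (use sphere_homeomorphic_nsphere[where 'n=real] in simp)
  finally have "underlying_space (link R M) homeomorphic sphere (0::real) 1"
    by simp
  then obtain f g where "homeomorphism (underlying_space (link R M)) (sphere (0::real) 1) f g"
    unfolding homeomorphic_def by blast
  then have "bij_betw f (underlying_space (link R M)) (sphere (0::real) 1)"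
    by (metis bij_betw_def homeomorphism_def inj_on_inverseI)
  then have "card (underlying_space (link R M)) = card (sphere (0::real) 1)"
    by (rule bij_betw_same_card)
  also have "sphere (0::real) 1 = {-1, 1}"
    by (auto simp: sphere_def)
  finally have "card ((\<lambda>v. axis v (1::real)) ` ?W) = 2"
    unfolding space by simp
  moreover have "inj_on (\<lambda>v. axis v (1::real)) ?W"
    by (auto simp: inj_on_def axis_eq_axis)
  ultimately show ?thesis
    by (simp add: card_image)
qed

text \<open>Below dimension \<open>n\<close> the link is a sphere of dimension at least 0 and hence
  nonempty, so the face can be enlarged; the induction is on the codimension.\<close>

lemma face_in_facet:
  assumes M: "combinatorial_manifold n M" and F: "F \<in> M"
  shows "\<exists>G\<in>M. F \<subseteq> G \<and> card G = n + 1"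
  using F
proof (induction "n + 1 - card F" arbitrary: F rule: less_induct)
  case less
  have ac: "abstract_complex M" and card: "\<And>F. F \<in> M \<Longrightarrow> card F \<le> n + 1"
    using M by (simp_all add: combinatorial_manifold_def)
  have fin: "\<And>F. F \<in> M \<Longrightarrow> finite F \<and> F \<noteq> {}"
    using ac unfolding abstract_complex_def by blast
  show ?case
  proof (cases "card F = n + 1")
    case False
    define k where "k = card F - 1"
    have k: "card F = k + 1" "k < n"
    proof -
      have "card F \<noteq> 0" "card F \<le> n + 1"
        using card[OF less(2)] fin[OF less(2)] by simp_all
      then show "card F = k + 1" "k < n"
        using False unfolding k_def by linarith+
    qed
    then have "triangulated_sphere (int n - int k - 1) (link F M)"
      using M less(2) by (simp add: combinatorial_manifold_def faces_def)
    then have "top_of_set (underlying_space (link F M)) homeomorphic_space nsphere (nat (int n - int k - 1))"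
      using k(2) by (auto simp: triangulated_sphere_def)
    then have "underlying_space (link F M) \<noteq> {}"
      by (metis homeomorphic_empty_space_eq nonempty_nsphere topspace_euclidean_subtopology null_topspace_iff_trivial)
    then obtain G where G: "G \<in> M" "G \<inter> F = {}" "G \<union> F \<in> M"
      by (auto simp: underlying_space_def link_def)
    have "card (G \<union> F) > card F"
      using G fin[OF G(1)] fin[OF less(2)] by (simp add: card_Un_disjoint card_gt_0_iff)
    then have "n + 1 - card (G \<union> F) < n + 1 - card F"
      using card[OF G(3)] by linarith
    then show ?thesis
      using less(1)[OF _ G(3)] by blast
  qed (use less in blast)
qed

section \<open>Facet orbits\<close>

definition anti :: "label \<Rightarrow> label" where
  "anti x = rot (rot (rot (rot (rot (rot x)))))"

fun first_rot :: "(label list \<Rightarrow> bool) \<Rightarrow> nat \<Rightarrow> label list \<Rightarrow> label list" where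
  "first_rot P 0 l = l"
| "first_rot P (Suc n) l = (if P l then l else first_rot P n (map rot l))"

lemma first_rot: "\<exists>k. first_rot P n l = map (rot ^^ k) l"
proof (induction n arbitrary: l)
  case 0
  show ?case by (intro exI[of _ 0]) simp
next
  case (Suc n)
  obtain k where "first_rot P n (map rot l) = map (rot ^^ k) (map rot l)"
    using Suc by blast
  then have "first_rot P n (map rot l) = map (rot ^^ Suc k) l"
    by (simp add: funpow_swap1)
  moreover have "l = map (rot ^^ 0) l" by simp
  ultimately show ?case by (metis first_rot.simps(2))
qed

text \<open>Every facet can be rotated so that it contains \<open>V0\<close> and misses \<open>V5\<close> and \<open>V11\<close>; it then
  consists of \<open>V0\<close> and one vertex of each of four antipodal pairs.\<close>

definition canon :: "label list \<Rightarrow> label list" where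
  "canon l =
    (let H = first_rot (\<lambda>H. if mem V0 H then if mem V5 H then False else \<not> mem V11 H else False) 12 l;
       C = [V0, if mem V1 H then V1 else V7, if mem V2 H then V2 else V8,
         if mem V3 H then V3 else V9, if mem V4 H then V4 else V10]
     in if sub H C then if sub C H then C else l else l)"

text \<open>The fallback to \<open>l\<close> in \<open>canon\<close> makes this hold for every list.
  That the normal form is reached for the lists that matter is a finite check,
  \<open>canon_transversals\<close>.\<close>

lemma canon: "\<exists>k. set (canon l) = (rot ^^ k) ` set l"
proof -
  have "\<exists>k. set (if sub H C then if sub C H then C else l else l) = (rot ^^ k) ` set l"
    if H: "set H = (rot ^^ j) ` set l" for H C j
  proof (cases "set H = set C")
    case True
    then show ?thesis
      using H by (intro exI[of _ j]) simp
  next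
    case False
    then have "(if sub H C then if sub C H then C else l else l) = l"
      by auto
    then show ?thesis
      by (intro exI[of _ 0]) simp
  qed
  moreover have "\<exists>j. set (first_rot P 12 l) = (rot ^^ j) ` set l" for P
    using first_rot by (metis set_map)
  ultimately show ?thesis
    unfolding canon_def Let_def by blast
qed

text \<open>The labels double as names of the sixteen orbits. The binary digits of the number, from
  the highest, say for the pairs of \<open>V1\<close>, \<open>V2\<close>, \<open>V3\<close> and
  \<open>V4\<close> whether the antipode is taken.\<close>

primrec base :: "label \<Rightarrow> label list" where
  "base V0 = [V0, V1, V2, V3, V4]"
| "base V1 = [V0, V1, V2, V3, V10]"
| "base V2 = [V0, V1, V2, V9, V4]"
| "base V3 = [V0, V1, V2, V9, V10]"
| "base V4 = [V0, V1, V8, V3, V4]"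
| "base V5 = [V0, V1, V8, V3, V10]"
| "base V6 = [V0, V1, V8, V9, V4]"
| "base V7 = [V0, V1, V8, V9, V10]"
| "base V8 = [V0, V7, V2, V3, V4]"
| "base V9 = [V0, V7, V2, V3, V10]"
| "base V10 = [V0, V7, V2, V9, V4]"
| "base V11 = [V0, V7, V2, V9, V10]"
| "base V12 = [V0, V7, V8, V3, V4]"
| "base V13 = [V0, V7, V8, V3, V10]"
| "base V14 = [V0, V7, V8, V9, V4]"
| "base V15 = [V0, V7, V8, V9, V10]"

definition all_labels :: "label list" where
  "all_labels = [V0, V1, V2, V3, V4, V5, V6, V7, V8, V9, V10, V11, V12, V13, V14, V15]"

text \<open>The value \<open>V0\<close> for an exhausted list is a default. Where indices of
  completed ridges are used, \<open>ridge_cofacets\<close> guarantees that the list really is one of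
  the sixteen bases.\<close>

fun base_index :: "label list \<Rightarrow> label list \<Rightarrow> label" where
  "base_index [] l = V0"
| "base_index (t # ts) l = (if base t = l then t else base_index ts l)"

fun transversals :: "nat \<Rightarrow> ('a \<times> 'a) list \<Rightarrow> 'a list list" where
  "transversals 0 ps = [[]]"
| "transversals (Suc k) [] = []"
| "transversals (Suc k) (p # ps) = map (Cons (fst p)) (transversals k ps) @
    map (Cons (snd p)) (transversals k ps) @ transversals (Suc k) ps"

lemma transversals:
  assumes "F \<subseteq> (\<Union>p\<in>set ps. {fst p, snd p})" "\<forall>p\<in>set ps. \<not> {fst p, snd p} \<subseteq> F" "finite F" "card F = k"
  shows "\<exists>l\<in>set (transversals k ps). set l = F"
  using assms
proof (induction k ps arbitrary: F rule: transversals.induct)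
  case (3 k p ps)
  have *: "\<exists>l\<in>set (transversals k ps). set l = F - {x}" if x: "x \<in> F" "x \<in> {fst p, snd p}" for x
  proof (rule 3(1))
    show "F - {x} \<subseteq> (\<Union>p\<in>set ps. {fst p, snd p})"
      using 3(4,5) x by auto
    show "\<forall>p\<in>set ps. \<not> {fst p, snd p} \<subseteq> F - {x}"
      using 3(5) by auto
    show "finite (F - {x})" "card (F - {x}) = k"
      using 3(6,7) x(1) by auto
  qed
  consider "fst p \<in> F" | "snd p \<in> F" | "fst p \<notin> F" "snd p \<notin> F" by blast
  then show ?case
  proof cases
    case 1
    then obtain l where "l \<in> set (transversals k ps)" "set l = F - {fst p}"
      using * by blast
    then show ?thesis
      using 1 by (intro bexI[of _ "fst p # l"]) auto
  next
    case 2
    then obtain l where "l \<in> set (transversals k ps)" "set l = F - {snd p}"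
      using * by blast
    then show ?thesis
      using 2 by (intro bexI[of _ "snd p # l"]) auto
  next
    case 3
    have "\<exists>l\<in>set (transversals (Suc k) ps). set l = F"
      using 3 "3.prems" by (intro "3.IH"(3)) auto
    then show ?thesis by auto
  qed
qed auto

definition pairs :: "(label \<times> label) list" where
  "pairs = [(V0, V6), (V1, V7), (V2, V8), (V3, V9), (V4, V10), (V5, V11)]"

text \<open>Five vertices without an antipodal pair miss exactly one pair. Rotating this pair to
  \<open>{V5, V11}\<close>, and by six more steps if needed, brings \<open>V0\<close> into the set
  and leaves four binary choices. This accounts for the 192 sets in 16 orbits of length 12.\<close>

lemma canon_transversals: "list_all (\<lambda>l. mem (canon l) (map base all_labels)) (transversals 5 pairs)"
  by code_simp

text \<open>A 3-face meets four of the six antipodal pairs, so only the four vertices of the other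
  two pairs can complete it to a facet.\<close>

definition cofacets :: "label list \<Rightarrow> label list" where
  "cofacets R = filter (\<lambda>v. if mem v R then False else \<not> mem (anti v) R) core"

text \<open>There are 240 sets of four vertices without an antipodal pair, and rotations act freely
  on them; these are representatives of the 20 orbits, grouped by the distance of the two pairs that
  are missed.\<close>

definition ridges :: "label list list" where
  "ridges = [[V0, V1, V2, V3], [V0, V1, V2, V9], [V0, V1, V3, V8], [V0, V1, V8, V9], [V0, V2, V3, V7], [V0, V2, V7, V9], [V0, V3, V7, V8], [V0, V7, V8, V9], [V0, V1, V2, V4], [V0, V1, V2, V10], [V0, V1, V4, V8], [V0, V1, V8, V10], [V0, V2, V4, V7], [V0, V2, V7, V10], [V0, V4, V7, V8], [V0, V7, V8, V10], [V0, V1, V3, V4], [V0, V1, V3, V10], [V0, V1, V4, V9], [V0, V3, V7, V10]]"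

text \<open>Each row lists the orbits of the four completions of a ridge. An index occurs twice when
  two completions lie in the same orbit; the multiplicity matters, since the number of completions
  that are facets must be 0 or 2.\<close>

definition ridge_constraints :: "label list list" where
  "ridge_constraints = [[V0, V15, V1, V0], [V2, V14, V3, V1], [V4, V13, V5, V2], [V6, V12, V7, V3], [V8, V11, V9, V4], [V10, V10, V11, V5], [V12, V9, V13, V6], [V14, V8, V15, V7], [V0, V7, V2, V15], [V1, V8, V3, V0], [V4, V6, V6, V14], [V5, V9, V7, V1], [V8, V5, V10, V13], [V9, V10, V11, V2], [V12, V4, V14, V12], [V13, V11, V15, V3], [V0, V3, V4, V7], [V1, V11, V5, V15], [V2, V12, V6, V8], [V9, V10, V13, V14]]"

lemma ridge_constraints: "map (\<lambda>R. map (\<lambda>v. base_index all_labels (canon (v # R))) (cofacets R)) ridges = ridge_constraints"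
  by code_simp

lemma ridge_cofacets: "list_all (\<lambda>R. distinct R \<and> length R = 4 \<and> list_all (\<lambda>v. mem v core) R \<and>
    list_all (\<lambda>v. mem (canon (v # R)) (map base all_labels)) (cofacets R)) ridges"
  by code_simp

text \<open>\<open>T\<close> holds the accepted and \<open>U\<close> the rejected orbits. An
  undecided index lets the constraint pass, so a branch is cut only by a constraint that is
  completely decided, and no solution is lost.\<close>

fun constraint_ok :: "label list \<Rightarrow> label list \<Rightarrow> label list \<Rightarrow> nat \<Rightarrow> bool" where
  "constraint_ok T U [] k = (k = 0 \<or> k = 2)"
| "constraint_ok T U (x # c) k =
    (if mem x T then constraint_ok T U c (Suc k) else if mem x U then constraint_ok T U c k else True)"

fun solutions :: "label list list \<Rightarrow> label list \<Rightarrow> label list \<Rightarrow> label list \<Rightarrow> label list list" where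
  "solutions C [] T U = [T]"
| "solutions C (x # xs) T U =
    (if all (\<lambda>c. constraint_ok (x # T) U c 0) C then solutions C xs (x # T) U else []) @
    (if all (\<lambda>c. constraint_ok T (x # U) c 0) C then solutions C xs T (x # U) else [])"

lemma constraint_ok:
  assumes "\<forall>x\<in>set T. P x" "\<forall>x\<in>set U. \<not> P x" "k + length (filter P c) \<in> {0, 2}"
  shows "constraint_ok T U c k"
  using assms by (induction c arbitrary: k) auto

lemma solutions_complete:
  assumes "\<forall>x\<in>set T. P x" "\<forall>x\<in>set U. \<not> P x" "\<forall>c\<in>set C. length (filter P c) \<in> {0, 2}"
  shows "\<exists>S\<in>set (solutions C xs T U). set S = set T \<union> {x \<in> set xs. P x}"
  using assms
proof (induction xs arbitrary: T U)
  case (Cons x xs)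
  show ?case
  proof (cases "P x")
    case True
    then have "\<forall>c\<in>set C. constraint_ok (x # T) U c 0"
      using Cons.prems by (intro ballI constraint_ok[of _ P]) auto
    moreover obtain S where "S \<in> set (solutions C xs (x # T) U)" "set S = set (x # T) \<union> {x \<in> set xs. P x}"
      using Cons.IH[of "x # T" U] Cons.prems True by auto
    ultimately show ?thesis
      using True by (intro bexI[of _ S]) auto
  next
    case False
    then have "\<forall>c\<in>set C. constraint_ok T (x # U) c 0"
      using Cons.prems by (intro ballI constraint_ok[of _ P]) auto
    moreover obtain S where "S \<in> set (solutions C xs T (x # U))" "set S = set T \<union> {x \<in> set xs. P x}"
      using Cons.IH[of T "x # U"] Cons.prems False by auto
    ultimately show ?thesis
      using False by (intro bexI[of _ S]) auto
  qed
qed auto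

text \<open>The order of the orbits makes constraints decidable early: the first three settle
  \<open>[V10, V10, V11, V5]\<close>, the next two \<open>[V8, V5, V10, V13]\<close>, and two more
  \<open>[V8, V11, V9, V4]\<close>.\<close>

definition candidates :: "label list list" where
  "candidates = solutions ridge_constraints [V10, V5, V11, V13, V8, V9, V4, V2, V14, V15, V1, V3, V0, V7, V6, V12] [] []"

primrec neg :: "label \<Rightarrow> label" where
  "neg V0 = V0"
| "neg V1 = V11"
| "neg V2 = V10"
| "neg V3 = V9"
| "neg V4 = V8"
| "neg V5 = V7"
| "neg V6 = V6"
| "neg V7 = V5"
| "neg V8 = V4"
| "neg V9 = V3"
| "neg V10 = V2"
| "neg V11 = V1"
| "neg V12 = V12"
| "neg V13 = V13"
| "neg V14 = V14"
| "neg V15 = V15"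

definition same_bases :: "label list list \<Rightarrow> label list list \<Rightarrow> bool" where
  "same_bases bs cs \<longleftrightarrow> all (\<lambda>b. mem b cs) bs \<and> all (\<lambda>b. mem b bs) cs"

text \<open>The third complex is invariant under \<open>neg\<close>, hence only two mirror images
  appear as separate solutions. The remaining solutions fail on the face numbers, and the full count
  is evaluated only for those with 72 facets.\<close>

lemma candidates: "list_all (\<lambda>S. let bs = map base S in
    if same_bases bs bases1 then True else if same_bases bs bases2 then True else if same_bases bs bases3 then True
    else if same_bases bs (map (\<lambda>b. canon (map neg b)) bases1) then True
    else if same_bases bs (map (\<lambda>b. canon (map neg b)) bases2) then True
    else if kcount 5 core (facets bs) = 72 then \<not> counts_ok bs else True) candidates"
  by code_simp

section \<open>Automorphisms\<close>

definition lab :: "12 \<Rightarrow> label" where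
  "lab = the_inv_into (set core) vtx"

lemma vtx_lab [simp]: "vtx (lab v) = v"
  unfolding lab_def by (rule f_the_inv_into_f[OF inj_on_vtx]) (use vtx_core in blast)

lemma lab_core: "lab v \<in> set core"
  unfolding lab_def by (rule the_inv_into_into[OF inj_on_vtx]) (use vtx_core in blast)+

lemma lab_vtx: "x \<in> set core \<Longrightarrow> lab (vtx x) = x"
  unfolding lab_def by (rule the_inv_into_f_f[OF inj_on_vtx])

text \<open>Each level chooses the image of one vertex and thereby of its antipode. The lists
  \<open>Q\<close> are nonfaces among the vertices assigned so far, and a choice that sends one of
  them into a facet is abandoned. A complete assignment that survives must be in \<open>L\<close>,
  so success means that \<open>L\<close> contains all survivors.\<close>

primrec search :: "label list list \<Rightarrow> label list list \<Rightarrow> (label \<times> label list list) list \<Rightarrow> label list \<Rightarrow> (label \<Rightarrow> label) \<Rightarrow> bool" where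
  "search fs L [] E \<sigma> = mem E L"
| "search fs L (l # lv) E \<sigma> = all (\<lambda>y. if mem y E then True else
     let \<tau> = \<sigma>(fst l := y, anti (fst l) := anti y) in
     if all (\<lambda>Q. \<not> ex (sub (map \<tau> Q)) fs) (snd l) then search fs L lv (anti y # y # E) \<tau> else True) core"

primrec levels_ok :: "label list list \<Rightarrow> (label \<times> label list list) list \<Rightarrow> label list \<Rightarrow> bool" where
  "levels_ok fs [] D = True"
| "levels_ok fs (l # lv) D = (if mem (fst l) core \<and> mem (anti (fst l)) core \<and> \<not> mem (fst l) D \<and> fst l \<noteq> anti (fst l) then
     if all (\<lambda>Q. Q \<noteq> [] \<and> sub Q (anti (fst l) # fst l # D) \<and> \<not> ex (sub Q) fs) (snd l)
     then levels_ok fs lv (anti (fst l) # fst l # D) else False else False)"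

primrec levels_domain :: "(label \<times> label list list) list \<Rightarrow> label list \<Rightarrow> label list" where
  "levels_domain [] D = D"
| "levels_domain (l # lv) D = levels_domain lv (anti (fst l) # fst l # D)"

text \<open>The branch that always chooses \<open>y = p x\<close> is never cut: the value is fresh
  because \<open>p\<close> is injective, and no nonface is sent into a facet because
  \<open>p\<close> reflects faces. It therefore reaches a leaf, where membership in \<open>L\<close>
  is demanded.\<close>

lemma search_complete:
  assumes p: "inj_on p (set core)" "p ` set core \<subseteq> set core" "\<forall>x\<in>set core. p (anti x) = anti (p x)"
    and face: "\<And>Q. Q \<noteq> [] \<Longrightarrow> set Q \<subseteq> set core \<Longrightarrow> \<exists>f\<in>set fs. p ` set Q \<subseteq> set f \<Longrightarrow> \<exists>f\<in>set fs. set Q \<subseteq> set f"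
    and "levels_ok fs lv D" "search fs L lv (map p D) \<sigma>" "\<forall>d\<in>set D. \<sigma> d = p d" "set D \<subseteq> set core"
  shows "map p (levels_domain lv D) \<in> set L"
  using assms(5-)
proof (induction lv arbitrary: D \<sigma>)
  case Nil
  then show ?case
    by (simp only: search.simps mem_iff levels_domain.simps)
next
  case (Cons l lv)
  define x where "x = fst l"
  have x: "x \<in> set core" "anti x \<in> set core" "x \<notin> set D" "x \<noteq> anti x"
    and tests: "\<forall>Q\<in>set (snd l). Q \<noteq> [] \<and> set Q \<subseteq> set (anti x # x # D) \<and> \<not> (\<exists>f\<in>set fs. set Q \<subseteq> set f)"
    and ok: "levels_ok fs lv (anti x # x # D)"
    using Cons.prems(1) by (simp_all add: x_def split: if_splits del: set_simps)
  define \<tau> where "\<tau> = \<sigma>(x := p x, anti x := anti (p x))"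
  have \<tau>: "\<forall>d\<in>set (anti x # x # D). \<tau> d = p d"
    using Cons.prems(3) p(3) x(1,4) by (auto simp: \<tau>_def)
  have D: "set (anti x # x # D) \<subseteq> set core"
    using Cons.prems(4) x by auto
  have "p x \<in> set core" using p(2) x(1) by blast
  moreover have "p x \<notin> set (map p D)"
  proof
    assume "p x \<in> set (map p D)"
    then obtain d where d: "d \<in> set D" "p x = p d"
      unfolding set_map by blast
    from d(2) have "x = d"
      by (rule inj_onD[OF p(1) _ x(1) subsetD[OF Cons.prems(4) d(1)]])
    then show False
      using x(3) d(1) by simp
  qed
  moreover have "\<not> (\<exists>f\<in>set fs. \<tau> ` set Q \<subseteq> set f)" if Q: "Q \<in> set (snd l)" for Q
  proof
    assume "\<exists>f\<in>set fs. \<tau> ` set Q \<subseteq> set f"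
    moreover have "\<tau> ` set Q = p ` set Q"
      using tests \<tau> Q by (intro image_cong) auto
    ultimately have "\<exists>f\<in>set fs. p ` set Q \<subseteq> set f" by simp
    moreover have "Q \<noteq> []" "set Q \<subseteq> set core"
      using tests Q D by blast+
    ultimately have "\<exists>f\<in>set fs. set Q \<subseteq> set f"
      using face by blast
    then show False using tests Q by blast
  qed
  moreover have "\<forall>y\<in>set core. (if mem y (map p D) then True else
      let \<tau> = \<sigma>(x := y, anti x := anti y) in
      if all (\<lambda>Q. \<not> ex (sub (map \<tau> Q)) fs) (snd l) then search fs L lv (anti y # y # map p D) \<tau> else True)"
    using Cons.prems(2) unfolding search.simps all_iff x_def .
  ultimately have "search fs L lv (anti (p x) # p x # map p D) \<tau>"
    unfolding mem_iff all_iff ex_iff sub_iff set_map Let_def \<tau>_def by (metis (no_types, lifting))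
  then have "search fs L lv (map p (anti x # x # D)) \<tau>"
    using p(3) x(1) by (simp only: list.map)
  from Cons.IH[OF ok this \<tau> D] show ?case
    by (simp add: x_def)
qed

definition antipodal_edges :: "label list list \<Rightarrow> bool" where
  "antipodal_edges fs \<longleftrightarrow> list_all (\<lambda>x. mem (anti x) core \<and> list_all (\<lambda>y. x = y \<or> (ex (sub [x, y]) fs \<longleftrightarrow> y \<noteq> anti x)) core) core"

lemma realize_iff:
  assumes "in_core bs" "set Q \<subseteq> set core" "Q \<noteq> []"
  shows "vtx ` set Q \<in> realize bs \<longleftrightarrow> (\<exists>f\<in>set (facets bs). set Q \<subseteq> set f)"
  unfolding vtx_in_realize[OF assms(1,2)] using assms(3) by (simp add: complex_of_def)

lemma anti_core: "x \<in> set core \<Longrightarrow> anti x \<in> set core"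
  by (cases x) (simp_all add: anti_def)

lemma anti_neq: "x \<in> set core \<Longrightarrow> anti x \<noteq> x"
  by (cases x) (simp_all add: anti_def)

text \<open>The antipodal pairs are exactly the missing edges, so an automorphism commutes with
  \<open>anti\<close>. One that fixes 0 then fixes 6 as well, which is the initial assignment
  \<open>[V6, V0]\<close> of the search.\<close>

lemma automorphism_stabilizer:
  assumes bs: "in_core bs" and V: "vertices (realize bs) = UNIV"
    and edges: "antipodal_edges (facets bs)" and lv: "levels_ok (facets bs) lv [V6, V0]"
    and L: "search (facets bs) (map (\<lambda>g. map g (levels_domain lv [V6, V0])) gs) lv [V6, V0] id"
    and dom: "sub core (levels_domain lv [V6, V0])"
    and \<pi>: "automorphism (realize bs) \<pi>" "\<pi> 0 = 0"
  shows "\<exists>g\<in>set gs. \<forall>v. \<pi> v = vtx (g (lab v))"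
proof -
  define p where "p = lab \<circ> \<pi> \<circ> vtx"
  have vp: "vtx (p x) = \<pi> (vtx x)" and pc: "p x \<in> set core" for x
    by (simp_all add: p_def lab_core del: set_simps)
  have bij: "bij \<pi>" and iff: "\<And>F. F \<in> realize bs \<longleftrightarrow> \<pi> ` F \<in> realize bs"
    using \<pi>(1) by (auto simp: automorphism_def V permutes_bij)
  have inj: "inj_on p (set core)"
  proof (rule inj_onI)
    fix x y assume "x \<in> set core" "y \<in> set core" "p x = p y"
    then show "x = y"
      using vp[of x] vp[of y] bij inj_on_vtx by (metis bij_is_inj inj_eq inj_onD)
  qed
  have face: "(\<exists>f\<in>set (facets bs). set (map p Q) \<subseteq> set f) \<longleftrightarrow> (\<exists>f\<in>set (facets bs). set Q \<subseteq> set f)"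
    if Q: "Q \<noteq> []" "set Q \<subseteq> set core" for Q
  proof -
    have "vtx ` set (map p Q) = \<pi> ` vtx ` set Q"
      by (simp add: image_image vp)
    moreover have "set (map p Q) \<subseteq> set core" "map p Q \<noteq> []"
      using pc Q(1) by (auto simp del: set_simps)
    ultimately show ?thesis
      using realize_iff[OF bs, of Q] realize_iff[OF bs, of "map p Q"] iff Q by metis
  qed
  have edge: "(\<exists>f\<in>set (facets bs). set [x, y] \<subseteq> set f) \<longleftrightarrow> y \<noteq> anti x" if "x \<in> set core" "y \<in> set core" "x \<noteq> y" for x y
  proof -
    have "x = y \<or> (ex (sub [x, y]) (facets bs) \<longleftrightarrow> y \<noteq> anti x)"
      using edges that(1,2) unfolding antipodal_edges_def list_all_iff by blast
    then show ?thesis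
      using that(3) by (simp only: ex_iff sub_iff simp_thms)
  qed
  have anti: "anti x \<in> set core" "anti x \<noteq> x" if "x \<in> set core" for x
    by (rule anti_core[OF that], rule anti_neq[OF that])
  have p_anti: "p (anti x) = anti (p x)" if x: "x \<in> set core" for x
  proof -
    have "p x \<noteq> p (anti x)"
    proof
      assume "p x = p (anti x)"
      from inj_onD[OF inj this x anti(1)[OF x]] show False
        using anti(2)[OF x] by simp
    qed
    moreover have "\<not> (\<exists>f\<in>set (facets bs). set [x, anti x] \<subseteq> set f)"
      using edge[OF x anti(1)[OF x] anti(2)[OF x, symmetric]] by simp
    moreover have "set [x, anti x] \<subseteq> set core"
      using x anti(1)[OF x] unfolding list.set by blast
    ultimately have "\<not> (\<exists>f\<in>set (facets bs). set [p x, p (anti x)] \<subseteq> set f)"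
      using face[of "[x, anti x]"] by (simp only: list.map) blast
    with \<open>p x \<noteq> p (anti x)\<close> show ?thesis
      using edge[OF pc[of x] pc[of "anti x"]] by blast
  qed
  have p_id: "\<forall>d\<in>set [V6, V0]. id d = p d"
  proof -
    have "p V0 = V0"
      using \<pi>(2) lab_vtx[of V0] by (simp add: p_def)
    moreover from this have "p V6 = V6"
      using p_anti[of V0] by (simp add: anti_def)
    ultimately show ?thesis by simp
  qed
  then have L': "search (facets bs) (map (\<lambda>g. map g (levels_domain lv [V6, V0])) gs) lv (map p [V6, V0]) id"
    using L by simp
  note p_id
  moreover have "p ` set core \<subseteq> set core"
    using pc by (intro image_subsetI)
  moreover have "\<exists>f\<in>set (facets bs). set Q \<subseteq> set f"
    if "Q \<noteq> []" "set Q \<subseteq> set core" "\<exists>f\<in>set (facets bs). p ` set Q \<subseteq> set f" for Q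
    using face[OF that(1,2)] that(3) by (simp only: set_map)
  moreover have "set [V6, V0] \<subseteq> set core"
    by simp
  ultimately have "map p (levels_domain lv [V6, V0]) \<in> set (map (\<lambda>g. map g (levels_domain lv [V6, V0])) gs)"
    using search_complete[OF inj _ _ _ lv L'] p_anti by blast
  then obtain g where g: "g \<in> set gs" "map p (levels_domain lv [V6, V0]) = map g (levels_domain lv [V6, V0])"
    by auto
  then have "p x = g x" if "x \<in> set core" for x
    using dom that unfolding sub_iff map_eq_conv by blast
  then have "\<pi> v = vtx (g (lab v))" for v
    using vp[of "lab v"] lab_core[of v] by simp
  then show ?thesis using g(1) by blast
qed

definition label_symmetry :: "label list list \<Rightarrow> (label \<Rightarrow> label) \<Rightarrow> bool" where
  "label_symmetry fs g \<longleftrightarrow> same_complex (map (map g) fs) fs \<and> distinct (map g core) \<and> list_all (\<lambda>x. mem (g x) core) core"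

lemma automorphism_image_subset:
  fixes M :: "'a::finite set set"
  assumes "vertices M = UNIV" "inj \<pi>" "(`) \<pi> ` M = M"
  shows "automorphism M \<pi>"
  unfolding automorphism_def
proof (intro conjI allI impI)
  show "\<pi> permutes vertices M"
    using assms(1,2) finite_UNIV_inj_surj[of \<pi>] by (simp add: permutes_def bij_iff[symmetric] bij_def finite_class.finite_UNIV)
  show "F \<in> M \<longleftrightarrow> \<pi> ` F \<in> M" for F
  proof
    assume "\<pi> ` F \<in> M"
    then obtain G where "G \<in> M" "\<pi> ` F = \<pi> ` G"
      using assms(3) by (metis imageE)
    then show "F \<in> M"
      using inj_image_eq_iff[OF assms(2)] by simp
  qed (use assms(3) in blast)
qed

lemma label_symmetry_automorphism:
  assumes bs: "in_core bs" and V: "vertices (realize bs) = UNIV" and g: "label_symmetry (facets bs) g"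
  shows "automorphism (realize bs) (\<lambda>v. vtx (g (lab v)))"
proof (rule automorphism_image_subset[OF V])
  have gc: "g x \<in> set core" if "x \<in> set core" for x
    using g that unfolding label_symmetry_def list_all_iff mem_iff by blast
  have "distinct (map g core)"
    using g unfolding label_symmetry_def by blast
  then have "inj_on g (set core)"
    by (simp only: distinct_map)
  then show "inj (\<lambda>v. vtx (g (lab v)))"
    using gc lab_core inj_on_vtx by (intro injI) (metis inj_onD vtx_lab)
  have "(\<lambda>v. vtx (g (lab v))) ` vtx ` F = vtx ` g ` F" if "F \<in> complex_of (facets bs)" for F
    unfolding image_image
  proof (rule image_cong[OF refl])
    show "vtx (g (lab (vtx x))) = vtx (g x)" if "x \<in> F" for x
      using lab_vtx[of x] complex_of_core[OF bs \<open>F \<in> complex_of (facets bs)\<close>] that by auto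
  qed
  then have "(`) (\<lambda>v. vtx (g (lab v))) ` realize bs = (`) vtx ` (`) g ` complex_of (facets bs)"
    unfolding realize_def image_image[of "(`) (\<lambda>v. vtx (g (lab v)))"] image_image[of "(`) vtx"]
    by (intro image_cong[OF refl])
  also have "(`) g ` complex_of (facets bs) = complex_of (facets bs)"
    using g same_complex[of "map (map g) (facets bs)" "facets bs"]
    by (simp add: label_symmetry_def complex_of_map)
  finally show "(`) (\<lambda>v. vtx (g (lab v))) ` realize bs = realize bs"
    by (simp add: realize_def)
qed

lemma automorphism_comp:
  assumes f: "automorphism M f" and g: "automorphism M g"
  shows "automorphism M (f \<circ> g)"
  unfolding automorphism_def
proof (intro conjI allI impI)
  show "f \<circ> g permutes vertices M"
    using f g by (simp add: automorphism_def permutes_compose)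
  fix F assume "F \<subseteq> vertices M"
  moreover from this have "g ` F \<subseteq> vertices M"
    using g permutes_image[of g "vertices M"] unfolding automorphism_def by (metis image_mono)
  ultimately show "F \<in> M \<longleftrightarrow> (f \<circ> g) ` F \<in> M"
    using f g unfolding automorphism_def by (metis image_comp)
qed

lemma translation_automorphism:
  assumes "automorphism M zeta"
  shows "automorphism M (\<lambda>x. x + k)"
proof -
  have "automorphism M (zeta ^^ n)" for n
  proof (induction n)
    case 0
    show ?case by (simp add: automorphism_def permutes_id id_def[symmetric])
  next
    case (Suc n)
    show ?case
      unfolding funpow.simps by (rule automorphism_comp[OF assms Suc])
  qed
  moreover have "zeta ^^ n = (\<lambda>x. x + of_nat n)" for n
    by (induction n) (auto simp: fun_eq_iff zeta_eq)
  moreover have "\<exists>n. k = of_nat n"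
    using exhaust_12[of k] by (auto intro: exI[of _ "0::nat"] exI[of _ "1::nat"] exI[of _ "2::nat"] exI[of _ "3::nat"] exI[of _ "4::nat"]
      exI[of _ "5::nat"] exI[of _ "6::nat"] exI[of _ "7::nat"] exI[of _ "8::nat"] exI[of _ "9::nat"] exI[of _ "10::nat"] exI[of _ "11::nat"])
  ultimately show ?thesis by metis
qed

lemma automorphism_iff_stabilizer:
  assumes "automorphism M zeta"
  shows "automorphism M \<pi> \<longleftrightarrow> (\<exists>\<sigma> k. automorphism M \<sigma> \<and> \<sigma> 0 = 0 \<and> \<pi> = (\<lambda>x. \<sigma> x + k))"
proof
  assume \<pi>: "automorphism M \<pi>"
  have "automorphism M ((\<lambda>x. x + - \<pi> 0) \<circ> \<pi>)"
    using translation_automorphism[OF assms] \<pi> by (rule automorphism_comp)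
  then show "\<exists>\<sigma> k. automorphism M \<sigma> \<and> \<sigma> 0 = 0 \<and> \<pi> = (\<lambda>x. \<sigma> x + k)"
    by (intro exI[of _ "(\<lambda>x. x + - \<pi> 0) \<circ> \<pi>"] exI[of _ "\<pi> 0"]) (auto simp: fun_eq_iff)
next
  assume "\<exists>\<sigma> k. automorphism M \<sigma> \<and> \<sigma> 0 = 0 \<and> \<pi> = (\<lambda>x. \<sigma> x + k)"
  then obtain \<sigma> k where "automorphism M \<sigma>" "\<pi> = (\<lambda>x. x + k) \<circ> \<sigma>"
    by (auto simp: fun_eq_iff)
  then show "automorphism M \<pi>"
    using automorphism_comp[OF translation_automorphism[OF assms]] by blast
qed

section \<open>Affine automorphism groups modulo 12\<close>

lemma Rep_of_int_12: "Rep_bit0 (of_int a :: 12) = a mod 12"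
  using bit0.Rep_Abs_mod[where 'a=6, of a] by (simp add: bit0.of_int_eq)

lemma of_int_12_eq_iff: "(of_int a :: 12) = of_int b \<longleftrightarrow> a mod 12 = b mod 12"
  by (simp add: bit0.Rep_inject_sym Rep_of_int_12)

lemma ex_of_int_12: "\<exists>n\<in>{0..<12}. (k::12) = of_int n"
proof (rule bexI[of _ "Rep_bit0 k mod 12"])
  show "k = of_int (Rep_bit0 k mod 12)"
    using bit0.Rep_mod[of k] by (simp add: bit0.Rep_inject_sym Rep_of_int_12)
qed simp

text \<open>The translations form the normal factor, and \<open>H\<close> acts on them through
  multiplication by \<open>u h\<close>. Every unit modulo 12 squares to 1, which is why
  \<open>square\<close> can be asked for; it makes each multiplication its own inverse.\<close>

lemma affine_Aut_iso_semidirect: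
  fixes M :: "12 set set" and H :: "'h monoid" and u :: "'h \<Rightarrow> int"
  assumes H: "group H" and u: "\<And>h k. h \<in> carrier H \<Longrightarrow> k \<in> carrier H \<Longrightarrow> u (h \<otimes>\<^bsub>H\<^esub> k) mod 12 = u h * u k mod 12"
    and square: "\<And>h. h \<in> carrier H \<Longrightarrow> u h * u h mod 12 = 1"
    and inj: "inj_on (\<lambda>h. u h mod 12) (carrier H)"
    and Aut: "\<And>\<pi>. automorphism M \<pi> \<longleftrightarrow> (\<exists>h\<in>carrier H. \<exists>k. \<pi> = (\<lambda>x. of_int (u h) * x + k))"
  shows "iso_semidirect (Aut M) (integer_mod_group 12) H"
proof -
  interpret H: group H by fact
  let ?N = "integer_mod_group 12"
  have N: "carrier ?N = {0..<12}"
    by (simp add: carrier_integer_mod_group)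
  \<comment> \<open>The restriction to \<open>{0..<12}\<close> is forced because elements of
    \<open>AutoGroup\<close> are extensional on the carrier.\<close>
  define \<phi> where "\<phi> h = (\<lambda>n\<in>{0..<12}. u h * n mod 12)" for h
  have \<phi>_eq: "\<phi> h n = u h * n mod 12" if "n \<in> {0..<12}" for h n
    using that by (simp add: \<phi>_def)
  have \<phi>_in: "\<phi> h n \<in> {0..<12}" if "n \<in> {0..<12}" for h n
    using that by (simp add: \<phi>_eq)
  have \<phi>_\<phi>: "\<phi> h (\<phi> h n) = n" if "h \<in> carrier H" "n \<in> {0..<12}" for h n
  proof -
    have "\<phi> h (\<phi> h n) = (u h * u h mod 12) * n mod 12"
      using that \<phi>_in[OF that(2), of h] by (simp add: \<phi>_eq mod_simps mult.assoc)
    then show ?thesis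
      using square[OF that(1)] that(2) by simp
  qed
  have Bij: "\<phi> h \<in> Bij {0..<12}" if "h \<in> carrier H" for h
    unfolding Bij_def using \<phi>_in \<phi>_\<phi>[OF that]
    by (auto simp: \<phi>_def intro!: bij_betw_byWitness[where f'="\<phi> h"])
  have auto: "\<phi> h \<in> auto ?N" if "h \<in> carrier H" for h
    unfolding auto_def N
  proof (intro IntI Bij[OF that] homI)
    fix m n assume "m \<in> carrier ?N" "n \<in> carrier ?N"
    then show "\<phi> h (m \<otimes>\<^bsub>?N\<^esub> n) = \<phi> h m \<otimes>\<^bsub>?N\<^esub> \<phi> h n"
      unfolding N by (simp add: \<phi>_eq mod_simps distrib_left)
  qed (use \<phi>_in in \<open>simp_all add: N\<close>)
  have \<phi>: "\<phi> \<in> hom H (AutoGroup ?N)"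
  proof (rule homI)
    fix h k assume hk: "h \<in> carrier H" "k \<in> carrier H"
    have "\<phi> (h \<otimes>\<^bsub>H\<^esub> k) = compose {0..<12} (\<phi> h) (\<phi> k)"
    proof (rule extensionalityI[of _ "{0..<12}"])
      fix n :: int assume n: "n \<in> {0..<12}"
      have "\<phi> (h \<otimes>\<^bsub>H\<^esub> k) n = (u (h \<otimes>\<^bsub>H\<^esub> k) mod 12) * n mod 12"
        using n by (simp add: \<phi>_eq mod_simps)
      also have "\<dots> = \<phi> h (\<phi> k n)"
        using n \<phi>_in[OF n, of k] by (simp add: u[OF hk] \<phi>_eq mod_simps mult.assoc)
      finally show "\<phi> (h \<otimes>\<^bsub>H\<^esub> k) n = compose {0..<12} (\<phi> h) (\<phi> k) n"
        using n by (simp add: compose_def)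
    qed (simp_all add: \<phi>_def)
    then show "\<phi> (h \<otimes>\<^bsub>H\<^esub> k) = \<phi> h \<otimes>\<^bsub>AutoGroup ?N\<^esub> \<phi> k"
      using Bij hk by (simp add: AutoGroup_def BijGroup_def N)
  qed (use auto in \<open>simp add: AutoGroup_def BijGroup_def\<close>)
  let ?S = "semidirect_product ?N \<phi> H"
  define f where "f = (\<lambda>(n, h). \<lambda>x::12. of_int (u h) * x + of_int n)"
  have u_cong: "(of_int (u (h \<otimes>\<^bsub>H\<^esub> k)) :: 12) = of_int (u h) * of_int (u k)"
    if "h \<in> carrier H" "k \<in> carrier H" for h k
    unfolding of_int_mult[symmetric] of_int_12_eq_iff by (rule u[OF that])
  have "f \<in> hom ?S (Aut M)"
  proof (rule homI)
    fix x assume "x \<in> carrier ?S"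
    then show "f x \<in> carrier (Aut M)"
      using Aut by (auto simp: semidirect_product_def Aut_def f_def)
  next
    fix x y assume "x \<in> carrier ?S" "y \<in> carrier ?S"
    then obtain n h m k where xy: "x = (n, h)" "y = (m, k)" "n \<in> {0..<12}" "m \<in> {0..<12}" "h \<in> carrier H" "k \<in> carrier H"
      by (auto simp: semidirect_product_def N)
    have "(of_int ((n + u h * m mod 12) mod 12) :: 12) = of_int (n + u h * m)"
      unfolding of_int_12_eq_iff by (simp add: mod_simps)
    then show "f (x \<otimes>\<^bsub>?S\<^esub> y) = f x \<otimes>\<^bsub>Aut M\<^esub> f y"
      using xy by (simp add: semidirect_product_def Aut_def f_def fun_eq_iff \<phi>_eq u_cong algebra_simps)
  qed
  moreover have "inj_on f (carrier ?S)"
  proof (rule inj_onI)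
    fix x y assume "x \<in> carrier ?S" "y \<in> carrier ?S" and eq: "f x = f y"
    then obtain n h m k where xy: "x = (n, h)" "y = (m, k)" "n \<in> {0..<12}" "m \<in> {0..<12}" "h \<in> carrier H" "k \<in> carrier H"
      by (auto simp: semidirect_product_def N)
    have "(of_int n :: 12) = of_int m"
      using fun_cong[OF eq, of 0] by (simp add: xy f_def)
    then have "n = m"
      using xy(3,4) unfolding of_int_12_eq_iff by simp
    moreover have "(of_int (u h) :: 12) = of_int (u k)"
      using fun_cong[OF eq, of 1] calculation by (simp add: xy f_def)
    then have "h = k"
      using inj_onD[OF inj _ xy(5,6)] unfolding of_int_12_eq_iff by simp
    ultimately show "x = y"
      by (simp add: xy)
  qed
  moreover have "f ` carrier ?S = carrier (Aut M)"
  proof (intro equalityI subsetI)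
    fix \<pi> assume "\<pi> \<in> carrier (Aut M)"
    then obtain h k where h: "h \<in> carrier H" "\<pi> = (\<lambda>x. of_int (u h) * x + k)"
      using Aut by (auto simp: Aut_def)
    obtain n where "n \<in> {0..<12}" "k = of_int n"
      using ex_of_int_12 by blast
    then show "\<pi> \<in> f ` carrier ?S"
      using h by (intro image_eqI[of _ _ "(n, h)"]) (simp_all add: f_def semidirect_product_def N)
  qed (use \<open>f \<in> hom ?S (Aut M)\<close> in \<open>auto simp: hom_def\<close>)
  ultimately have "f \<in> iso ?S (Aut M)"
    by (simp add: iso_def bij_betw_def)
  then have "Aut M \<cong> ?S"
    by (rule group.iso_sym[OF group_semidirect_product[OF group_integer_mod_group H \<phi>] is_isoI])
  then show ?thesis
    unfolding iso_semidirect_def using \<phi> by blast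
qed

section \<open>The groups of order 24 and 48\<close>

text \<open>All pairs and triples without an antipodal pair are faces, so the levels of
  \<open>V1\<close> and \<open>V2\<close> have nothing to test. Of the 240 quadruples without an
  antipodal pair, 180 are faces; the other 60 are listed at the level where their last vertex
  receives an image.\<close>

definition levels1 :: "(label \<times> label list list) list" where
  "levels1 =
   [(V1, []), (V2, []), (V3, [[V0, V1, V2, V9], [V0, V1, V3, V8], [V2, V6, V7, V9], [V3, V6, V7,
   V8]]), (V4, [[V0, V4, V7, V8], [V0, V7, V8, V10], [V1, V2, V4, V6], [V1, V2, V6, V10], [V0, V1,
   V3, V10], [V0, V7, V9, V10], [V1, V3, V4, V6], [V4, V6, V7, V9], [V0, V2, V9, V10], [V0, V3, V4,
   V8], [V2, V6, V9, V10], [V3, V4, V6, V8], [V1, V2, V3, V10], [V1, V2, V4, V9], [V3, V7, V8, V10],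
   [V4, V7, V8, V9]]), (V5, [[V0, V1, V8, V11], [V0, V2, V7, V11], [V1, V5, V6, V8], [V2, V5, V6,
   V7], [V0, V1, V3, V5], [V0, V1, V5, V9], [V3, V6, V7, V11], [V6, V7, V9, V11], [V0, V4, V5, V7],
   [V0, V7, V10, V11], [V1, V4, V5, V6], [V1, V6, V10, V11], [V0, V2, V3, V5], [V0, V2, V9, V11],
   [V3, V5, V6, V8], [V6, V8, V9, V11], [V0, V2, V4, V11], [V0, V4, V8, V11], [V2, V5, V6, V10],
   [V5, V6, V8, V10], [V0, V3, V4, V5], [V0, V5, V9, V10], [V3, V4, V6, V11], [V6, V9, V10, V11],
   [V1, V5, V8, V9], [V1, V8, V9, V11], [V2, V3, V5, V7], [V2, V3, V7, V11], [V1, V2, V4, V11], [V1,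
   V8, V10, V11], [V2, V4, V5, V7], [V5, V7, V8, V10], [V1, V3, V10, V11], [V1, V4, V5, V9], [V3,
   V7, V10, V11], [V4, V5, V7, V9], [V2, V3, V4, V11], [V2, V3, V5, V10], [V4, V8, V9, V11], [V5,
   V8, V9, V10]])]"

definition levels2 :: "(label \<times> label list list) list" where
  "levels2 =
   [(V1, []), (V2, []), (V3, [[V0, V1, V2, V9], [V0, V1, V3, V8], [V2, V6, V7, V9], [V3, V6, V7,
   V8]]), (V4, [[V0, V1, V4, V8], [V0, V7, V8, V10], [V1, V2, V4, V6], [V2, V6, V7, V10], [V0, V1,
   V3, V10], [V0, V7, V9, V10], [V1, V3, V4, V6], [V4, V6, V7, V9], [V0, V2, V9, V10], [V0, V4, V8,
   V9], [V2, V3, V6, V10], [V3, V4, V6, V8], [V1, V2, V3, V10], [V1, V2, V4, V9], [V3, V7, V8, V10],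
   [V4, V7, V8, V9]]), (V5, [[V0, V1, V8, V11], [V0, V2, V7, V11], [V1, V5, V6, V8], [V2, V5, V6,
   V7], [V0, V1, V3, V5], [V0, V3, V7, V11], [V1, V5, V6, V9], [V6, V7, V9, V11], [V0, V4, V5, V7],
   [V0, V7, V10, V11], [V1, V4, V5, V6], [V1, V6, V10, V11], [V0, V2, V3, V5], [V0, V2, V9, V11],
   [V3, V5, V6, V8], [V6, V8, V9, V11], [V0, V2, V4, V11], [V0, V4, V5, V8], [V2, V6, V10, V11],
   [V5, V6, V8, V10], [V0, V3, V4, V5], [V0, V5, V9, V10], [V3, V4, V6, V11], [V6, V9, V10, V11],
   [V1, V2, V5, V9], [V1, V8, V9, V11], [V2, V3, V5, V7], [V3, V7, V8, V11], [V1, V2, V4, V11], [V1,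
   V8, V10, V11], [V2, V4, V5, V7], [V5, V7, V8, V10], [V1, V3, V10, V11], [V1, V5, V9, V10], [V3,
   V4, V7, V11], [V4, V5, V7, V9], [V2, V3, V4, V11], [V2, V3, V5, V10], [V4, V8, V9, V11], [V5, V8,
   V9, V10]])]"

definition levels3 :: "(label \<times> label list list) list" where
  "levels3 =
   [(V1, []), (V2, []), (V3, [[V0, V1, V8, V9], [V0, V3, V7, V8], [V1, V2, V6, V9], [V2, V3, V6,
   V7]]), (V4, [[V0, V1, V8, V10], [V0, V7, V8, V10], [V1, V2, V4, V6], [V2, V4, V6, V7], [V0, V1,
   V3, V10], [V0, V7, V9, V10], [V1, V3, V4, V6], [V4, V6, V7, V9], [V0, V2, V3, V10], [V0, V2, V9,
   V10], [V3, V4, V6, V8], [V4, V6, V8, V9], [V1, V2, V9, V10], [V1, V4, V8, V9], [V2, V3, V7, V10],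
   [V3, V4, V7, V8]]), (V5, [[V0, V1, V5, V8], [V0, V7, V8, V11], [V1, V2, V5, V6], [V2, V6, V7,
   V11], [V0, V1, V3, V5], [V0, V7, V9, V11], [V1, V3, V5, V6], [V6, V7, V9, V11], [V0, V1, V4, V5],
   [V0, V4, V7, V11], [V1, V5, V6, V10], [V6, V7, V10, V11], [V0, V2, V3, V5], [V0, V2, V9, V11],
   [V3, V5, V6, V8], [V6, V8, V9, V11], [V0, V2, V4, V5], [V0, V2, V4, V11], [V5, V6, V8, V10], [V6,
   V8, V10, V11], [V0, V3, V4, V11], [V0, V4, V5, V9], [V3, V6, V10, V11], [V5, V6, V9, V10], [V1,
   V2, V9, V11], [V1, V8, V9, V11], [V2, V3, V5, V7], [V3, V5, V7, V8], [V1, V2, V4, V11], [V1, V8,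
   V10, V11], [V2, V4, V5, V7], [V5, V7, V8, V10], [V1, V3, V4, V11], [V1, V3, V10, V11], [V4, V5,
   V7, V9], [V5, V7, V9, V10], [V2, V3, V10, V11], [V2, V5, V9, V10], [V3, V4, V8, V11], [V4, V5,
   V8, V9]])]"

primrec mul5 :: "label \<Rightarrow> label" where
  "mul5 V0 = V0"
| "mul5 V1 = V5"
| "mul5 V2 = V10"
| "mul5 V3 = V3"
| "mul5 V4 = V8"
| "mul5 V5 = V1"
| "mul5 V6 = V6"
| "mul5 V7 = V11"
| "mul5 V8 = V4"
| "mul5 V9 = V9"
| "mul5 V10 = V2"
| "mul5 V11 = V7"
| "mul5 V12 = V12"
| "mul5 V13 = V13"
| "mul5 V14 = V14"
| "mul5 V15 = V15"

text \<open>\<open>rho\<close> has order 5 and \<open>tau\<close> order 4. Both fix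
  \<open>V0\<close> and \<open>V6\<close>, and the products of their powers are the 20 elements of
  the stabilizer of \<open>V0\<close> in the second complex.\<close>

primrec rho :: "label \<Rightarrow> label" where
  "rho V0 = V0"
| "rho V1 = V3"
| "rho V2 = V7"
| "rho V3 = V5"
| "rho V4 = V8"
| "rho V5 = V4"
| "rho V6 = V6"
| "rho V7 = V9"
| "rho V8 = V1"
| "rho V9 = V11"
| "rho V10 = V2"
| "rho V11 = V10"
| "rho V12 = V12"
| "rho V13 = V13"
| "rho V14 = V14"
| "rho V15 = V15"

primrec tau :: "label \<Rightarrow> label" where
  "tau V0 = V0"
| "tau V1 = V2"
| "tau V2 = V3"
| "tau V3 = V11"
| "tau V4 = V10"
| "tau V5 = V7"
| "tau V6 = V6"
| "tau V7 = V8"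
| "tau V8 = V9"
| "tau V9 = V5"
| "tau V10 = V4"
| "tau V11 = V1"
| "tau V12 = V12"
| "tau V13 = V13"
| "tau V14 = V14"
| "tau V15 = V15"

definition symmetries1 :: "(label \<Rightarrow> label) list" where
  "symmetries1 = [id, mul5]"

definition symmetries3 :: "(label \<Rightarrow> label) list" where
  "symmetries3 = [id, mul5, neg, mul5 \<circ> neg]"

text \<open>The power of a function applied to a point, by recursion on the exponent, so that it can
  be evaluated inside the checks; \<open>iterate\<close> below connects it with
  \<open>^^\<close>.\<close>

primrec iterate :: "nat \<Rightarrow> ('a \<Rightarrow> 'a) \<Rightarrow> 'a \<Rightarrow> 'a" where
  "iterate 0 f x = x"
| "iterate (Suc n) f x = f (iterate n f x)"

lemma iterate: "iterate n f x = (f ^^ n) x"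
  by (induction n) auto

lemma iterate_numeral: "iterate (numeral k) f x = f (iterate (pred_numeral k) f x)"
  by (simp add: numeral_eq_Suc)

definition symmetries2 :: "(label \<Rightarrow> label) list" where
  "symmetries2 = concat (map (\<lambda>i. map (\<lambda>j x. iterate i rho (iterate j tau x)) [0, 1, 2, 3]) [0, 1, 2, 3, 4])"

definition symmetry_check :: "label list list \<Rightarrow> (label \<Rightarrow> label) list \<Rightarrow> (label \<times> label list list) list \<Rightarrow> (label \<Rightarrow> label) list \<Rightarrow> bool" where
  "symmetry_check bs gs lv ss = (let fs = facets bs in
    antipodal_edges fs \<and> levels_ok fs lv [V6, V0] \<and>
    search fs (map (\<lambda>g. map g (levels_domain lv [V6, V0])) gs) lv [V6, V0] id \<and>
    sub core (levels_domain lv [V6, V0]) \<and> list_all (label_symmetry fs) ss)"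

lemma symmetry_check1: "symmetry_check bases1 symmetries1 levels1 [mul5]"
  by code_simp

lemma symmetry_check2: "symmetry_check bases2 symmetries2 levels2 [rho, tau]"
  by code_simp

lemma symmetry_check3: "symmetry_check bases3 symmetries3 levels3 [mul5, neg]"
  by code_simp

lemma in_core_bases: "in_core bases1" "in_core bases2" "in_core bases3"
  by (simp_all add: in_core_def bases1_def bases2_def bases3_def)

lemma stabilizer:
  assumes "symmetry_check bs gs lv ss" "in_core bs" "vertices (realize bs) = UNIV"
    "automorphism (realize bs) \<sigma>" "\<sigma> 0 = 0"
  shows "\<exists>g\<in>set gs. \<forall>v. \<sigma> v = vtx (g (lab v))"
  using automorphism_stabilizer[OF assms(2,3) _ _ _ _ assms(4,5), of lv gs] assms(1)
  unfolding symmetry_check_def Let_def by blast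

lemma check_symmetry:
  assumes "symmetry_check bs gs lv ss" "in_core bs" "vertices (realize bs) = UNIV" "g \<in> set ss"
  shows "automorphism (realize bs) (\<lambda>v. vtx (g (lab v)))"
  using label_symmetry_automorphism[OF assms(2,3), of g] assms(1,4)
  unfolding symmetry_check_def Let_def list_all_iff by blast

lemma mul5: "x \<in> set core \<Longrightarrow> vtx (mul5 x) = 5 * vtx x"
  by (cases x) simp_all

lemma neg: "x \<in> set core \<Longrightarrow> vtx (neg x) = - vtx x" and neg_core: "x \<in> set core \<Longrightarrow> neg x \<in> set core"
  by (cases x; simp)+

lemma affine_AutI:
  assumes "automorphism M zeta"
    and stab: "\<And>\<sigma>. automorphism M \<sigma> \<Longrightarrow> \<sigma> 0 = 0 \<Longrightarrow> \<exists>h\<in>C. \<forall>v. \<sigma> v = of_int (u h) * v"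
    and sym: "\<And>h. h \<in> C \<Longrightarrow> automorphism M (\<lambda>v. of_int (u h) * v)"
  shows "automorphism M \<pi> \<longleftrightarrow> (\<exists>h\<in>C. \<exists>k. \<pi> = (\<lambda>x. of_int (u h) * x + k))"
proof
  assume "automorphism M \<pi>"
  then obtain \<sigma> k where "automorphism M \<sigma>" "\<sigma> 0 = 0" "\<pi> = (\<lambda>x. \<sigma> x + k)"
    using automorphism_iff_stabilizer[OF assms(1)] by blast
  moreover then obtain h where "h \<in> C" "\<forall>v. \<sigma> v = of_int (u h) * v"
    using stab by blast
  ultimately show "\<exists>h\<in>C. \<exists>k. \<pi> = (\<lambda>x. of_int (u h) * x + k)"
    by (intro bexI[of _ h] exI[of _ k]) auto
next
  assume "\<exists>h\<in>C. \<exists>k. \<pi> = (\<lambda>x. of_int (u h) * x + k)"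
  then obtain h k where h: "h \<in> C" "\<pi> = (\<lambda>x. of_int (u h) * x + k)"
    by blast
  show "automorphism M \<pi>"
    by (rule automorphism_iff_stabilizer[OF assms(1), THEN iffD2], rule exI[of _ "\<lambda>x. of_int (u h) * x"], rule exI[of _ k]) (simp add: sym[OF h(1)] h(2))
qed

lemma automorphism_id: "automorphism M (\<lambda>v. v)"
  by (simp add: automorphism_def permutes_def)

lemma carrier_mod_2: "carrier (integer_mod_group 2) = {0, 1}"
  by (auto simp: carrier_integer_mod_group)

lemma Aut1:
  assumes "admissible (realize bases1)"
  shows "iso_semidirect (Aut (realize bases1)) (integer_mod_group 12) (integer_mod_group 2)"
proof (rule affine_Aut_iso_semidirect[where u="\<lambda>h. if h = 0 then 1 else 5"])
  have V: "vertices (realize bases1) = UNIV" and z: "automorphism (realize bases1) zeta"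
    using assms by (simp_all add: admissible_def)
  note sym = check_symmetry[OF symmetry_check1 in_core_bases(1) V]
  note stab = stabilizer[OF symmetry_check1 in_core_bases(1) V]
  have m: "automorphism (realize bases1) (\<lambda>v. 5 * v)"
    using sym[of mul5] by (simp add: mul5[OF lab_core])
  show "automorphism (realize bases1) \<pi> \<longleftrightarrow>
      (\<exists>h\<in>carrier (integer_mod_group 2). \<exists>k. \<pi> = (\<lambda>x. of_int (if h = 0 then 1 else 5) * x + k))" for \<pi>
  proof (rule affine_AutI[OF z])
    fix \<sigma> assume "automorphism (realize bases1) \<sigma>" "\<sigma> 0 = 0"
    then obtain g where "g \<in> set symmetries1" "\<forall>v. \<sigma> v = vtx (g (lab v))"
      using stab by blast
    then show "\<exists>h\<in>carrier (integer_mod_group 2). \<forall>v. \<sigma> v = of_int (if h = 0 then 1 else 5) * v"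
      by (auto simp: symmetries1_def carrier_mod_2 mul5[OF lab_core])
  qed (use m automorphism_id in \<open>auto simp: carrier_mod_2\<close>)
qed (auto simp: carrier_mod_2 inj_on_def)

lemma Aut3:
  assumes "admissible (realize bases3)"
  shows "iso_semidirect (Aut (realize bases3)) (integer_mod_group 12) (integer_mod_group 2 \<times>\<times> integer_mod_group 2)"
\<comment> \<open>The values 1, 5, -1 and -5 are all the units modulo 12, so the third group
  consists of all affine bijections of the integers modulo 12.\<close>
proof (rule affine_Aut_iso_semidirect[where u="\<lambda>(a, b). (if a = 0 then 1 else 5) * (if b = 0 then 1 else -1)"])
  let ?u = "\<lambda>(a::int, b::int). (if a = 0 then 1 else 5) * (if b = 0 then 1 else -1 :: int)"
  let ?H = "integer_mod_group 2 \<times>\<times> integer_mod_group 2"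
  have V: "vertices (realize bases3) = UNIV" and z: "automorphism (realize bases3) zeta"
    using assms by (simp_all add: admissible_def)
  note sym = check_symmetry[OF symmetry_check3 in_core_bases(3) V]
  note stab = stabilizer[OF symmetry_check3 in_core_bases(3) V]
  have m: "automorphism (realize bases3) (\<lambda>v. 5 * v)"
    using sym[of mul5] by (simp add: mul5[OF lab_core])
  have n: "automorphism (realize bases3) (\<lambda>v. - v)"
    using sym[of neg] by (simp add: neg[OF lab_core])
  have mn: "automorphism (realize bases3) (\<lambda>v. - (5 * v))"
    using automorphism_comp[OF n m] by (simp add: comp_def)
  show "automorphism (realize bases3) \<pi> \<longleftrightarrow>
      (\<exists>h\<in>carrier ?H. \<exists>k. \<pi> = (\<lambda>x. of_int (?u h) * x + k))" for \<pi>
  proof (rule affine_AutI[OF z])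
    fix \<sigma> assume "automorphism (realize bases3) \<sigma>" "\<sigma> 0 = 0"
    then obtain g where "g \<in> set symmetries3" "\<forall>v. \<sigma> v = vtx (g (lab v))"
      using stab by blast
    then show "\<exists>h\<in>carrier ?H. \<forall>v. \<sigma> v = of_int (?u h) * v"
      by (auto simp: symmetries3_def DirProd_def carrier_mod_2 mul5[OF lab_core] neg[OF lab_core]
          mul5[OF neg_core[OF lab_core]])
  next
    have "(*) (1::12) = (\<lambda>v. v)" "(*) (-1::12) = uminus" "(*) (-5::12) = (\<lambda>v. - (5 * v))"
      by auto
    then show "automorphism (realize bases3) (\<lambda>v. of_int (?u h) * v)" if "h \<in> carrier ?H" for h
      using m n mn automorphism_id[of "realize bases3"] that by (auto simp: DirProd_def carrier_mod_2)
  qed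
next
  show "group (integer_mod_group 2 \<times>\<times> integer_mod_group 2)"
    by (intro DirProd_group group_integer_mod_group)
qed (auto simp: DirProd_def carrier_mod_2 inj_on_def)

text \<open>One-line notation for permutations of 1 to 5, continued by the identity as
  \<open>permutes\<close> requires.\<close>

definition perm5 :: "nat list \<Rightarrow> nat \<Rightarrow> nat" where
  "perm5 l n = (if n = 0 then n else if n \<le> 5 then l ! (n - 1) else n)"

lemma perm5_eval: "perm5 [a, b, c, d, e] (Suc 0) = a" "perm5 [a, b, c, d, e] 2 = b"
  "perm5 [a, b, c, d, e] 3 = c" "perm5 [a, b, c, d, e] 4 = d" "perm5 [a, b, c, d, e] 5 = e"
  by (simp_all add: perm5_def)

text \<open>The vertices correspond to the twelve elements of a conjugacy class of five-cycles in \<open>A\<^sub>5\<close>.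
  An automorphism acts on them by \<open>x \<mapsto> s x\<^sup>m s\<^sup>-\<^sup>1\<close> where \<open>m\<close> is the \<open>c\<close>-th power of 2 and
  \<open>s\<close> has the parity of \<open>c\<close>; squaring exchanges the two classes of five-cycles.\<close>

primrec five_cycle :: "label \<Rightarrow> nat list" where
  "five_cycle V0 = [2, 3, 4, 5, 1]"
| "five_cycle V1 = [3, 5, 4, 2, 1]"
| "five_cycle V2 = [4, 1, 5, 3, 2]"
| "five_cycle V3 = [4, 3, 5, 2, 1]"
| "five_cycle V4 = [2, 4, 1, 5, 3]"
| "five_cycle V5 = [4, 3, 1, 5, 2]"
| "five_cycle V6 = [5, 1, 2, 3, 4]"
| "five_cycle V7 = [5, 4, 1, 3, 2]"
| "five_cycle V8 = [2, 5, 4, 1, 3]"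
| "five_cycle V9 = [5, 4, 2, 1, 3]"
| "five_cycle V10 = [3, 1, 5, 2, 4]"
| "five_cycle V11 = [3, 5, 2, 1, 4]"
| "five_cycle V12 = []"
| "five_cycle V13 = []"
| "five_cycle V14 = []"
| "five_cycle V15 = []"

text \<open>The equation \<open>g x = s x^m s^-1\<close> multiplied by \<open>s\<close> on the
  right, so that no inverse has to be computed.\<close>

definition conjugates :: "(label \<Rightarrow> label) \<Rightarrow> nat list \<Rightarrow> nat \<Rightarrow> bool" where
  "conjugates g s c = list_all (\<lambda>x. list_all (\<lambda>n.
     perm5 (five_cycle (g x)) (perm5 s n) = perm5 s (iterate (2 ^ c) (perm5 (five_cycle x)) n)) [1, 2, 3, 4, 5]) core"

lemma conjugates: "conjugates rot [2, 1, 4, 5, 3] 3" "conjugates rho [3, 4, 5, 1, 2] 0"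
  "conjugates tau [2, 5, 3, 1, 4] 1"
  by (simp_all add: conjugates_def perm5_eval iterate_numeral)

lemma five_cycle_power: "list_all (\<lambda>x. list_all (\<lambda>n. iterate 5 (perm5 (five_cycle x)) n = n) [1, 2, 3, 4, 5]) core"
  by (simp add: perm5_eval iterate_numeral)

lemma five_cycle_distinct: "distinct (map five_cycle core)" "list_all (\<lambda>x. length (five_cycle x) = 5) core"
  by simp_all

text \<open>The images of three vertices already separate the twenty maps, which gives the lower
  bound for the order of the group.\<close>

lemma symmetries2_facts: "distinct (map (\<lambda>g. map g [V1, V2, V3]) symmetries2)" "list_all (\<lambda>g. g V0 = V0) symmetries2"
  "length symmetries2 = 20"
  by code_simp+

section \<open>The group of order 240\<close>

lemma perm5_outside: "n = 0 \<or> 5 < n \<Longrightarrow> perm5 l n = n"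
  by (auto simp: perm5_def)

lemma nat_1_5_cases: "n = 1 \<or> n = 2 \<or> n = 3 \<or> n = 4 \<or> n = 5 \<or> n = 0 \<or> 5 < (n::nat)"
  by linarith

definition cyc :: "12 \<Rightarrow> nat \<Rightarrow> nat" where
  "cyc v = perm5 (five_cycle (lab v))"

lemma funpow_fixed: "f x = x \<Longrightarrow> (f ^^ n) x = x"
  by (induction n) auto

lemma cyc_5: "cyc v ^^ 5 = id"
proof
  fix n :: nat
  consider "n \<in> set [1, 2, 3, 4, 5]" | "n = 0 \<or> 5 < n"
    using nat_1_5_cases[of n] by auto
  then show "(cyc v ^^ 5) n = id n"
  proof cases
    case 1
    then show ?thesis
      using five_cycle_power lab_core[of v] unfolding list_all_iff iterate cyc_def id_apply by blast
  next
    case 2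
    then show ?thesis
      by (simp add: cyc_def funpow_fixed perm5_outside)
  qed
qed

lemma cyc_inj: "cyc v = cyc w \<Longrightarrow> v = w"
proof -
  assume eq: "cyc v = cyc w"
  have len: "length (five_cycle (lab u)) = 5" for u
    using five_cycle_distinct(2) lab_core[of u] unfolding list_all_iff by blast
  have "five_cycle (lab v) ! i = five_cycle (lab w) ! i" if "i < 5" for i
    using fun_cong[OF eq, of "Suc i"] that by (simp add: cyc_def perm5_def)
  then have "five_cycle (lab v) = five_cycle (lab w)"
    by (intro nth_equalityI) (simp_all add: len)
  moreover have "inj_on five_cycle (set core)"
    using five_cycle_distinct(1) by (simp only: distinct_map)
  ultimately have "lab v = lab w"
    using lab_core by (meson inj_onD)
  then show "v = w"
    by (metis vtx_lab)
qed

text \<open>The parity of \<open>s\<close> is tied to \<open>c\<close> because squaring moves a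
  five-cycle to the other class of \<open>alt_group 5\<close> and an odd conjugation moves it back.
  The exponent \<open>c\<close> is a natural number so that it simply adds under composition; its
  residue modulo 4 is all that matters.\<close>

definition twisted :: "(12 \<Rightarrow> 12) \<Rightarrow> (nat \<Rightarrow> nat) \<Rightarrow> nat \<Rightarrow> bool" where
  "twisted \<pi> s c \<longleftrightarrow> s permutes {1..5} \<and> evenperm s = even c \<and>
     (\<forall>v. cyc (\<pi> v) \<circ> s = s \<circ> (cyc v ^^ (2 ^ c)))"

lemma permutes_imp_permutation5: "s permutes {1..5::nat} \<Longrightarrow> permutation s"
  by (metis finite_atLeastAtMost permutation_permutes)

lemma funpow_intertwine: "f \<circ> s = s \<circ> g \<Longrightarrow> (f ^^ n) \<circ> s = s \<circ> (g ^^ n)"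
proof (induction n)
  case (Suc n)
  then have "\<And>x. f (s x) = s (g x)" "\<And>x. (f ^^ n) (s x) = s ((g ^^ n) x)"
    by (metis comp_apply)+
  then show ?case by (simp add: fun_eq_iff)
qed simp

lemma twisted_comp:
  assumes "twisted \<pi> s c" "twisted \<pi>' s' c'"
  shows "twisted (\<pi> \<circ> \<pi>') (s \<circ> s') (c + c')"
proof -
  have s: "s permutes {1..5}" "evenperm s = even c" "\<And>v. cyc (\<pi> v) \<circ> s = s \<circ> (cyc v ^^ (2 ^ c))"
    and s': "s' permutes {1..5}" "evenperm s' = even c'" "\<And>v. cyc (\<pi>' v) \<circ> s' = s' \<circ> (cyc v ^^ (2 ^ c'))"
    using assms by (auto simp: twisted_def)
  have "cyc ((\<pi> \<circ> \<pi>') v) \<circ> (s \<circ> s') = (s \<circ> s') \<circ> (cyc v ^^ (2 ^ (c + c')))" for v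
  proof -
    have "cyc ((\<pi> \<circ> \<pi>') v) \<circ> (s \<circ> s') = s \<circ> ((cyc (\<pi>' v) ^^ (2 ^ c)) \<circ> s')"
      using s(3)[of "\<pi>' v"] by (simp add: o_assoc)
    also have "(cyc (\<pi>' v) ^^ (2 ^ c)) \<circ> s' = s' \<circ> ((cyc v ^^ (2 ^ c')) ^^ (2 ^ c))"
      by (rule funpow_intertwine[OF s'(3)])
    also have "(cyc v ^^ (2 ^ c')) ^^ (2 ^ c) = cyc v ^^ (2 ^ (c + c'))"
      by (simp add: funpow_mult power_add mult.commute)
    finally show ?thesis
      by (simp only: o_assoc)
  qed
  moreover have "evenperm (s \<circ> s') = even (c + c')"
    using s(2) s'(2) evenperm_comp[OF permutes_imp_permutation5[OF s(1)] permutes_imp_permutation5[OF s'(1)]]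
    by simp
  ultimately show ?thesis
    using permutes_compose[OF s'(1) s(1)] by (simp add: twisted_def)
qed

lemma twisted_id: "twisted id id 0"
  by (simp add: twisted_def permutes_id)

lemma twisted_funpow: "\<exists>s c. twisted \<pi> s c \<Longrightarrow> \<exists>s c. twisted (\<pi> ^^ n) s c"
proof (induction n)
  case 0
  show ?case
    using twisted_id unfolding funpow.simps by blast
next
  case (Suc n)
  then show ?case
    using twisted_comp unfolding funpow.simps by blast
qed

text \<open>Five-cycles have order 5 and 16 is 1 modulo 5, so the power \<open>2 ^ c\<close> depends
  on \<open>c\<close> modulo 4 only; parity survives since 4 is even.\<close>

lemma twisted_mod_4:
  assumes "twisted \<pi> s c"
  shows "twisted \<pi> s (c mod 4)"
proof -
  have mod5: "(2::nat) ^ c mod 5 = 2 ^ (c mod 4) mod 5"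
  proof -
    have "(2::nat) ^ c = 16 ^ (c div 4) * 2 ^ (c mod 4)"
    proof -
      have "(2::nat) ^ c = 2 ^ (4 * (c div 4) + c mod 4)"
        by simp
      also have "\<dots> = (2 ^ 4) ^ (c div 4) * 2 ^ (c mod 4)"
        by (simp only: power_add power_mult)
      finally show ?thesis by simp
    qed
    moreover have "(16::nat) ^ (c div 4) mod 5 = 1"
      using power_mod[of "16::nat" 5 "c div 4"] by simp
    ultimately show ?thesis
      by (metis mod_mult_left_eq mult_1)
  qed
  have "cyc v ^^ (2 ^ c) = cyc v ^^ (2 ^ (c mod 4))" for v
  proof
    fix x
    have "(cyc v ^^ 5) x = x"
      by (simp add: cyc_5)
    then have "(cyc v ^^ (m mod 5)) x = (cyc v ^^ m) x" for m
      by (rule funpow_mod_eq)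
    then show "(cyc v ^^ (2 ^ c)) x = (cyc v ^^ (2 ^ (c mod 4))) x"
      using mod5 by metis
  qed
  moreover have "even (c mod 4) = even c"
    by presburger
  ultimately show ?thesis
    using assms by (simp add: twisted_def)
qed

lemma twisted_unique:
  assumes "twisted \<pi> s c" "twisted \<pi>' s c"
  shows "\<pi> = \<pi>'"
proof
  fix v
  have "surj s"
    using assms(1) permutes_surj by (auto simp: twisted_def)
  moreover have "cyc (\<pi> v) \<circ> s = cyc (\<pi>' v) \<circ> s"
    using assms by (simp add: twisted_def)
  ultimately have "cyc (\<pi> v) = cyc (\<pi>' v)"
    by (metis surj_fun_eq comp_apply image_eqI surjD ext)
  then show "\<pi> v = \<pi>' v"
    by (rule cyc_inj)
qed

lemma twistedI:
  assumes "conjugates g l c" "\<And>x. x \<in> set core \<Longrightarrow> g x \<in> set core" "\<And>v. \<pi> v = vtx (g (lab v))"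
    "perm5 l permutes {1..5}" "evenperm (perm5 l) = even c"
  shows "twisted \<pi> (perm5 l) c"
proof -
  have "cyc (\<pi> v) \<circ> perm5 l = perm5 l \<circ> (cyc v ^^ (2 ^ c))" for v
  proof
    fix n :: nat
    have lab: "lab (\<pi> v) = g (lab v)"
      unfolding assms(3) by (rule lab_vtx[OF assms(2)[OF lab_core]])
    consider "n \<in> set [1, 2, 3, 4, 5]" | "n = 0 \<or> 5 < n"
      using nat_1_5_cases[of n] by auto
    then show "(cyc (\<pi> v) \<circ> perm5 l) n = (perm5 l \<circ> (cyc v ^^ (2 ^ c))) n"
    proof cases
      case 1
      then show ?thesis
        using assms(1) lab_core[of v] unfolding conjugates_def list_all_iff iterate cyc_def comp_apply lab by blast
    next
      case 2
      then show ?thesis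
        by (simp add: cyc_def funpow_fixed perm5_outside)
    qed
  qed
  then show ?thesis
    using assms(4,5) by (simp add: twisted_def)
qed

text \<open>The parity of the three conjugating permutations is read off from factorizations into
  three, four and three transpositions.\<close>

lemma perm5_transpositions_1: "perm5 [2, 1, 4, 5, 3] = Transposition.transpose 1 2 \<circ> (Transposition.transpose 3 4 \<circ> Transposition.transpose 4 5)"
proof
  fix n :: nat
  show "perm5 [2, 1, 4, 5, 3] n = (Transposition.transpose 1 2 \<circ> (Transposition.transpose 3 4 \<circ> Transposition.transpose 4 5)) n"
    using nat_1_5_cases[of n] by (elim disjE) (simp_all add: perm5_eval perm5_outside Transposition.transpose_def)
qed

lemma perm5_transpositions_2: "perm5 [3, 4, 5, 1, 2] = Transposition.transpose 1 3 \<circ> (Transposition.transpose 3 5 \<circ> (Transposition.transpose 5 2 \<circ> Transposition.transpose 2 4))"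
proof
  fix n :: nat
  show "perm5 [3, 4, 5, 1, 2] n = (Transposition.transpose 1 3 \<circ> (Transposition.transpose 3 5 \<circ> (Transposition.transpose 5 2 \<circ> Transposition.transpose 2 4))) n"
    using nat_1_5_cases[of n] by (elim disjE) (simp_all add: perm5_eval perm5_outside Transposition.transpose_def)
qed

lemma perm5_transpositions_3: "perm5 [2, 5, 3, 1, 4] = Transposition.transpose 1 2 \<circ> (Transposition.transpose 2 5 \<circ> Transposition.transpose 5 4)"
proof
  fix n :: nat
  show "perm5 [2, 5, 3, 1, 4] n = (Transposition.transpose 1 2 \<circ> (Transposition.transpose 2 5 \<circ> Transposition.transpose 5 4)) n"
    using nat_1_5_cases[of n] by (elim disjE) (simp_all add: perm5_eval perm5_outside Transposition.transpose_def)
qed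

lemmas perm5_transpositions = perm5_transpositions_1 perm5_transpositions_2 perm5_transpositions_3

lemma rot_in_core: "x \<in> set core \<Longrightarrow> rot x \<in> set core"
  by (cases x) simp_all

lemma rho_core: "x \<in> set core \<Longrightarrow> rho x \<in> set core"
  by (cases x) simp_all

lemma tau_core: "x \<in> set core \<Longrightarrow> tau x \<in> set core"
  by (cases x) simp_all

lemma transposition5:
  assumes "a \<in> {1..5::nat}" "b \<in> {1..5}" "a \<noteq> b"
  shows "Transposition.transpose a b permutes {1..5}" "evenperm (Transposition.transpose a b) = False" "permutation (Transposition.transpose a b)"
  using assms by (simp_all add: permutes_swap_id evenperm_swap permutation_swap_id)

lemma compose_transposition5:
  assumes "a \<in> {1..5::nat}" "b \<in> {1..5}" "a \<noteq> b" "p permutes {1..5}"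
  shows "Transposition.transpose a b \<circ> p permutes {1..5}"
    and "evenperm (Transposition.transpose a b \<circ> p) \<longleftrightarrow> \<not> evenperm p"
  using transposition5[OF assms(1-3)] assms(4) permutes_imp_permutation[of "{1..5}" p]
  by (simp_all only: permutes_compose evenperm_comp finite_atLeastAtMost) simp_all

lemma perm5_parity:
  shows "perm5 [2, 1, 4, 5, 3] permutes {1..5}" "evenperm (perm5 [2, 1, 4, 5, 3]) \<longleftrightarrow> even (3::nat)"
    and "perm5 [3, 4, 5, 1, 2] permutes {1..5}" "evenperm (perm5 [3, 4, 5, 1, 2]) \<longleftrightarrow> even (0::nat)"
    and "perm5 [2, 5, 3, 1, 4] permutes {1..5}" "evenperm (perm5 [2, 5, 3, 1, 4]) \<longleftrightarrow> even (1::nat)"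
proof -
  note t = compose_transposition5 transposition5
  show "perm5 [2, 1, 4, 5, 3] permutes {1..5}" "perm5 [3, 4, 5, 1, 2] permutes {1..5}" "perm5 [2, 5, 3, 1, 4] permutes {1..5}"
    "evenperm (perm5 [2, 1, 4, 5, 3]) \<longleftrightarrow> even (3::nat)" "evenperm (perm5 [3, 4, 5, 1, 2]) \<longleftrightarrow> even (0::nat)"
    "evenperm (perm5 [2, 5, 3, 1, 4]) \<longleftrightarrow> even (1::nat)"
    unfolding perm5_transpositions by (simp_all add: t del: One_nat_def)
qed

lemma generators_twisted:
  "\<exists>s c. twisted zeta s c" "\<exists>s c. twisted (\<lambda>v. vtx (rho (lab v))) s c" "\<exists>s c. twisted (\<lambda>v. vtx (tau (lab v))) s c"
proof -
  have "twisted zeta (perm5 [2, 1, 4, 5, 3]) 3"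
  proof (rule twistedI[OF conjugates(1)])
    show "rot x \<in> set core" if "x \<in> set core" for x
      using that by (rule rot_in_core)
    show "zeta v = vtx (rot (lab v))" for v
      using vtx_rot[OF lab_core[of v]] by simp
  qed (use perm5_parity in \<open>auto simp only:\<close>)
  moreover have "twisted (\<lambda>v. vtx (rho (lab v))) (perm5 [3, 4, 5, 1, 2]) 0"
  proof (rule twistedI[OF conjugates(2)])
    show "rho x \<in> set core" if "x \<in> set core" for x
      using that by (rule rho_core)
  qed (use perm5_parity in \<open>auto simp only:\<close>)
  moreover have "twisted (\<lambda>v. vtx (tau (lab v))) (perm5 [2, 5, 3, 1, 4]) 1"
  proof (rule twistedI[OF conjugates(3)])
    show "tau x \<in> set core" if "x \<in> set core" for x
      using that by (rule tau_core)
  qed (use perm5_parity in \<open>auto simp only:\<close>)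
  ultimately show "\<exists>s c. twisted zeta s c" "\<exists>s c. twisted (\<lambda>v. vtx (rho (lab v))) s c"
    "\<exists>s c. twisted (\<lambda>v. vtx (tau (lab v))) s c"
    by blast+
qed

lemma funpow_label_map:
  assumes "\<And>x. x \<in> set core \<Longrightarrow> g x \<in> set core"
  shows "((\<lambda>v. vtx (g (lab v))) ^^ n) v = vtx ((g ^^ n) (lab v)) \<and> (g ^^ n) (lab v) \<in> set core"
proof (induction n)
  case 0
  show ?case using lab_core by simp
next
  case (Suc n)
  then show ?case
    using assms by (simp only: funpow.simps comp_apply lab_vtx)
qed

lemma symmetries2_iterate:
  assumes "g \<in> set symmetries2"
  shows "\<exists>i j. g = (\<lambda>x. iterate i rho (iterate j tau x))"
  using assms unfolding symmetries2_def by (auto simp only: set_concat set_map UN_iff image_iff) (rule exI, rule exI, rule refl)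

lemma symmetries2_funpow:
  assumes "g \<in> set symmetries2"
  shows "\<exists>i j. \<forall>v. vtx (g (lab v)) = (((\<lambda>v. vtx (rho (lab v))) ^^ i) \<circ> ((\<lambda>v. vtx (tau (lab v))) ^^ j)) v"
proof -
  obtain i j where g: "g = (\<lambda>x. iterate i rho (iterate j tau x))"
    using symmetries2_iterate[OF assms] by blast
  have "(((\<lambda>v. vtx (rho (lab v))) ^^ i) \<circ> ((\<lambda>v. vtx (tau (lab v))) ^^ j)) v = vtx (g (lab v))" for v
    using funpow_label_map[of tau j v, OF tau_core] funpow_label_map[of rho i "vtx ((tau ^^ j) (lab v))", OF rho_core]
    by (simp only: comp_apply lab_vtx g iterate)
  then show ?thesis by metis
qed

context
  fixes M :: "12 set set"
  assumes M: "M = realize bases2" and adm: "admissible M"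
begin

lemma V2: "vertices (realize bases2) = UNIV" and zeta2: "automorphism M zeta"
  using adm M by (simp_all add: admissible_def)

lemma symmetries2_automorphism:
  assumes "g \<in> set symmetries2"
  shows "automorphism M (\<lambda>v. vtx (g (lab v)))"
proof -
  have gen: "automorphism M (\<lambda>v. vtx (rho (lab v)))" "automorphism M (\<lambda>v. vtx (tau (lab v)))"
    using check_symmetry[OF symmetry_check2 in_core_bases(2) V2] M by simp_all
  have pow: "automorphism M (f ^^ n)" if "automorphism M f" for f n
  proof (induction n)
    case 0
    show ?case using automorphism_id[of M] by (simp add: id_def)
  next
    case (Suc n)
    show ?case
      unfolding funpow.simps by (rule automorphism_comp[OF that Suc])
  qed
  obtain i j where "\<forall>v. vtx (g (lab v)) = (((\<lambda>v. vtx (rho (lab v))) ^^ i) \<circ> ((\<lambda>v. vtx (tau (lab v))) ^^ j)) v"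
    using symmetries2_funpow[OF assms] by blast
  then have "(\<lambda>v. vtx (g (lab v))) = ((\<lambda>v. vtx (rho (lab v))) ^^ i) \<circ> ((\<lambda>v. vtx (tau (lab v))) ^^ j)"
    by blast
  then show ?thesis
    using automorphism_comp[OF pow[OF gen(1)] pow[OF gen(2)]] by simp
qed

lemma automorphism_twisted:
  assumes "automorphism M \<pi>"
  shows "\<exists>s c. twisted \<pi> s c \<and> c < 4"
proof -
  obtain \<sigma> k where \<sigma>: "automorphism M \<sigma>" "\<sigma> 0 = 0" "\<pi> = (\<lambda>x. \<sigma> x + k)"
    using assms automorphism_iff_stabilizer[OF zeta2] by blast
  obtain g where "g \<in> set symmetries2" and g: "\<forall>v. \<sigma> v = vtx (g (lab v))"
    using stabilizer[OF symmetry_check2 in_core_bases(2) V2] \<sigma>(1,2) M by blast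
  then obtain i j where "\<forall>v. \<sigma> v = (((\<lambda>v. vtx (rho (lab v))) ^^ i) \<circ> ((\<lambda>v. vtx (tau (lab v))) ^^ j)) v"
    using symmetries2_funpow by metis
  then have "\<sigma> = ((\<lambda>v. vtx (rho (lab v))) ^^ i) \<circ> ((\<lambda>v. vtx (tau (lab v))) ^^ j)"
    by blast
  then have "\<exists>s c. twisted \<sigma> s c"
    using twisted_funpow[OF generators_twisted(2), of i] twisted_funpow[OF generators_twisted(3), of j]
      twisted_comp by blast
  moreover have "\<exists>s c. twisted (\<lambda>x. x + k) s c"
  proof -
    obtain n where "k = of_int n" "n \<in> {0..<12}"
      using ex_of_int_12 by blast
    then have "k = of_nat (nat n)" by simp
    moreover have "zeta ^^ m = (\<lambda>x. x + of_nat m)" for m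
      by (induction m) (auto simp: fun_eq_iff zeta_eq)
    ultimately show ?thesis
      using twisted_funpow[OF generators_twisted(1), of "nat n"] by simp
  qed
  moreover have "\<pi> = (\<lambda>x. x + k) \<circ> \<sigma>"
    using \<sigma>(3) by auto
  ultimately obtain s c where "twisted \<pi> s c"
    using twisted_comp by blast
  then show ?thesis
    using twisted_mod_4 by (intro exI[of _ s] exI[of _ "c mod 4"]) simp
qed

text \<open>Twelve rotations after twenty elements of the stabilizer: the rotation is recovered from
  the image of 0, the stabilizer element from the images of three more vertices. This bound meets
  the order 60 * 4 of the semidirect product, so no automorphism has to be built for an individual
  parameter.\<close>

lemma card_Aut_ge: "240 \<le> card {\<pi>. automorphism M \<pi>}"
proof -
  let ?A = "\<lambda>(i, k). \<lambda>v. vtx ((symmetries2 ! i) (lab v)) + k"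
  have mem: "symmetries2 ! i \<in> set symmetries2" if "i < 20" for i
    using that symmetries2_facts(3) by simp
  have "inj_on ?A ({..<20} \<times> UNIV)"
  proof (rule inj_onI)
    fix x y assume x: "x \<in> {..<20} \<times> (UNIV :: 12 set)" and y: "y \<in> {..<20} \<times> (UNIV :: 12 set)" and eq: "?A x = ?A y"
    obtain i k j l where xy: "x = (i, k)" "y = (j, l)" "i < 20" "j < 20"
      using x y by auto
    have V0: "(symmetries2 ! m) V0 = V0" if "m < 20" for m
      using symmetries2_facts(2) mem[OF that] unfolding list_all_iff by blast
    have e: "vtx ((symmetries2 ! i) x) + k = vtx ((symmetries2 ! j) x) + l" if "x \<in> set core" for x
      using fun_cong[OF eq, of "vtx x"] by (simp only: xy prod.case lab_vtx[OF that])
    have "k = l"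
      using e[of V0] V0 xy(3,4) by simp
    then have v: "vtx ((symmetries2 ! i) x) = vtx ((symmetries2 ! j) x)" if "x \<in> set core" for x
      using e[OF that] by simp
    have core: "(symmetries2 ! m) x \<in> set core" if "m < 20" "x \<in> set core" for m x
    proof -
      obtain a b where "symmetries2 ! m = (\<lambda>x. iterate a rho (iterate b tau x))"
        using symmetries2_iterate[OF mem[OF \<open>m < 20\<close>]] by blast
      moreover have "(rho ^^ n) z \<in> set core" "(tau ^^ n) z \<in> set core" if "z \<in> set core" for n z
      proof -
        show "(rho ^^ n) z \<in> set core" "(tau ^^ n) z \<in> set core"
          using that by (induction n; simp only: funpow.simps comp_apply id_apply rho_core tau_core)+
      qed
      ultimately show ?thesis
        using that(2) by (simp only: iterate)
    qed
    have eq: "(symmetries2 ! i) x = (symmetries2 ! j) x" if "x \<in> set core" for x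
      by (rule inj_onD[OF inj_on_vtx v[OF that] core[OF xy(3) that] core[OF xy(4) that]])
    have "map (symmetries2 ! i) [V1, V2, V3] = map (symmetries2 ! j) [V1, V2, V3]"
      using eq[of V1] eq[of V2] eq[of V3] by simp
    then have "map (\<lambda>g. map g [V1, V2, V3]) symmetries2 ! i = map (\<lambda>g. map g [V1, V2, V3]) symmetries2 ! j"
      using xy(3,4) symmetries2_facts(3) by (simp only: nth_map)
    then have "i = j"
      using symmetries2_facts(1,3) xy(3,4) by (metis length_map nth_eq_iff_index_eq)
    then show "x = y"
      using \<open>k = l\<close> xy by simp
  qed
  then have "card (?A ` ({..<20} \<times> (UNIV :: 12 set))) = 240"
    by (simp add: card_image card_cartesian_product)
  moreover have "?A ` ({..<20} \<times> UNIV) \<subseteq> {\<pi>. automorphism M \<pi>}"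
  proof clarify
    fix i :: nat and k :: 12 assume "i < 20"
    then have "automorphism M ((\<lambda>x. x + k) \<circ> (\<lambda>v. vtx ((symmetries2 ! i) (lab v))))"
      by (intro automorphism_comp translation_automorphism[OF zeta2] symmetries2_automorphism mem) auto
    then show "automorphism M (\<lambda>v. vtx ((symmetries2 ! i) (lab v)) + k)"
      by (simp add: comp_def)
  qed
  ultimately show ?thesis
    by (metis card_mono finite)
qed

text \<open>The power of the transposition of 1 and 2 with exponent \<open>c\<close>. Multiplying
  \<open>s\<close> by it makes \<open>s\<close> even, which turns the parameters of
  \<open>twisted\<close> into pairs from \<open>alt_group 5\<close> and the integers modulo 4;
  conjugation by it is the action in the semidirect product.\<close>

definition swap_power :: "nat \<Rightarrow> nat \<Rightarrow> nat" where
  "swap_power c = (if even c then id else Transposition.transpose 1 2)"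

lemma swap_power: "swap_power c permutes {1..5}" "evenperm (swap_power c) = even c"
  "swap_power c \<circ> swap_power d = swap_power (c + d)"
  using transposition5[of 1 2] by (auto simp: swap_power_def permutes_id)

lemma swap_power_cancel: "s \<circ> swap_power c \<circ> swap_power c = s"
  by (simp add: swap_power(3) flip: o_assoc) (simp add: swap_power_def)

text \<open>Parameters determine the automorphism, so \<open>E\<close> embeds the automorphisms into
  a set of 240 pairs. By the lower bound \<open>E\<close> is onto, hence every pair belongs to an
  automorphism, and \<open>F\<close> is the resulting map in the opposite direction.\<close>

lemma Aut2: "iso_semidirect (Aut M) (alt_group 5) (integer_mod_group 4)"
  and card_Aut2: "card {\<pi>. automorphism M \<pi>} = 240"
proof -
  let ?G = "{\<pi>. automorphism M \<pi>}" and ?A = "carrier (alt_group 5)"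
  define X where "X = ?A \<times> {0..<4::int}"
  have Z4: "carrier (integer_mod_group 4) = {0..<4}"
    by (simp add: carrier_integer_mod_group)
  have A: "a \<in> ?A \<longleftrightarrow> a permutes {1..5} \<and> evenperm a" for a
    by (simp add: alt_group_carrier)
  have comp_even: "evenperm (a \<circ> b) \<longleftrightarrow> evenperm a = evenperm b" if "a permutes {1..5::nat}" "b permutes {1..5}" for a b
    using evenperm_comp permutes_imp_permutation5 that by blast
  have "card ?A = 60"
    using alt_group_card_carrier[of 5] by (simp add: fact_numeral)
  then have cardX: "card X = 240" and finX: "finite X"
    by (simp_all add: X_def card_cartesian_product card_ge_0_finite)
  have "\<forall>\<pi>\<in>?G. \<exists>x. twisted \<pi> (fst x) (snd x) \<and> snd x < 4"
    using automorphism_twisted by (metis fst_conv mem_Collect_eq snd_conv)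
  then obtain e where e: "\<forall>\<pi>\<in>?G. twisted \<pi> (fst (e \<pi>)) (snd (e \<pi>)) \<and> snd (e \<pi>) < 4"
    by (rule bchoice[THEN exE])
  define E where "E \<pi> = (fst (e \<pi>) \<circ> swap_power (snd (e \<pi>)), int (snd (e \<pi>)))" for \<pi>
  have E: "\<exists>s c. twisted \<pi> s c \<and> c < 4 \<and> E \<pi> = (s \<circ> swap_power c, int c)" if "\<pi> \<in> ?G" for \<pi>
    using bspec[OF e that] unfolding E_def by blast
  have E_X: "E ` ?G \<subseteq> X"
  proof (rule image_subsetI)
    fix \<pi> assume "\<pi> \<in> ?G"
    then obtain s c where "twisted \<pi> s c" "c < 4" "E \<pi> = (s \<circ> swap_power c, int c)"
      using E by blast
    then show "E \<pi> \<in> X"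
      using comp_even[of s "swap_power c"] swap_power(1,2)[of c] permutes_compose[of "swap_power c" "{1..5}" s]
      by (auto simp: X_def A twisted_def)
  qed
  have E_inj: "inj_on E ?G"
  proof (rule inj_onI)
    fix \<pi> \<pi>' assume "\<pi> \<in> ?G" "\<pi>' \<in> ?G" and eq: "E \<pi> = E \<pi>'"
    then obtain s c s' c' where *: "twisted \<pi> s c" "E \<pi> = (s \<circ> swap_power c, int c)"
      "twisted \<pi>' s' c'" "E \<pi>' = (s' \<circ> swap_power c', int c')"
      using E by meson
    then have "c = c'" "s \<circ> swap_power c = s' \<circ> swap_power c"
      using eq by auto
    then have "s = s'"
      using swap_power_cancel by metis
    then show "\<pi> = \<pi>'"
      using * \<open>c = c'\<close> twisted_unique by blast
  qed
  have "card ?G \<le> 240"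
    using card_inj_on_le[OF E_inj E_X finX] cardX by simp
  then show card: "card ?G = 240"
    using card_Aut_ge by simp
  have E_onto: "E ` ?G = X"
    using card_subset_eq[OF finX E_X] card_image[OF E_inj] card cardX by simp
  have ex1: "\<exists>\<pi>. \<pi> \<in> ?G \<and> twisted \<pi> (a \<circ> swap_power (nat h)) (nat h)" if "(a, h) \<in> X" for a h
  proof -
    have "(a, h) \<in> E ` ?G"
      using that E_onto by simp
    then obtain \<pi> where \<pi>: "(a, h) = E \<pi>" "\<pi> \<in> ?G"
      by (rule imageE)
    obtain s c where "twisted \<pi> s c" "E \<pi> = (s \<circ> swap_power c, int c)"
      using E[OF \<pi>(2)] by blast
    then have "twisted \<pi> (a \<circ> swap_power (nat h)) (nat h)"
      using \<pi>(1) by (simp add: swap_power_cancel)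
    then show ?thesis
      using \<pi>(2) by blast
  qed
  \<comment> \<open>The choice is harmless: by \<open>twisted_unique\<close> only one automorphism
    has the given parameters, which is also what makes \<open>F\<close> multiplicative.\<close>
  define F where "F = (\<lambda>(a, h). SOME \<pi>. \<pi> \<in> ?G \<and> twisted \<pi> (a \<circ> swap_power (nat h)) (nat h))"
  have F: "F (a, h) \<in> ?G" "twisted (F (a, h)) (a \<circ> swap_power (nat h)) (nat h)" if "(a, h) \<in> X" for a h
    using someI_ex[OF ex1[OF that]] by (simp_all add: F_def)
  define \<phi> where "\<phi> h = (\<lambda>a\<in>?A. swap_power (nat h) \<circ> a \<circ> swap_power (nat h))" for h
  have \<phi>_in: "swap_power c \<circ> a \<circ> swap_power c \<in> ?A" if "a \<in> ?A" for a c
    using that comp_even[of "swap_power c \<circ> a" "swap_power c"] comp_even[of "swap_power c" a] swap_power(1,2)[of c]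
      permutes_compose[of "swap_power c" "{1..5}" "swap_power c \<circ> a"] permutes_compose[of a "{1..5}" "swap_power c"]
    by (auto simp: A)
  have \<phi>_mult: "(swap_power c \<circ> a \<circ> swap_power c) \<circ> (swap_power c \<circ> b \<circ> swap_power c) = swap_power c \<circ> (a \<circ> b) \<circ> swap_power c" for a b c
    using swap_power_cancel[of "swap_power c \<circ> a" c] by (metis o_assoc)
  have \<phi>_inv: "swap_power c \<circ> (swap_power c \<circ> a \<circ> swap_power c) \<circ> swap_power c = a" for a c
  proof -
    have "swap_power c \<circ> swap_power c = id"
      using swap_power_cancel[of id c] by simp
    then show ?thesis
      using swap_power_cancel[of a c] by (metis id_comp o_assoc)
  qed
  have Bij: "\<phi> h \<in> Bij ?A" for h
    unfolding Bij_def using \<phi>_in \<phi>_inv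
    by (auto simp: \<phi>_def intro!: bij_betw_byWitness[where f'="\<phi> h"])
  have auto: "\<phi> h \<in> auto (alt_group 5)" for h
    unfolding auto_def
  proof (intro IntI Bij homI)
    fix a b assume ab: "a \<in> ?A" "b \<in> ?A"
    then have "a \<circ> b \<in> ?A"
      using comp_even[of a b] permutes_compose[of b "{1..5}" a] by (auto simp: A)
    then show "\<phi> h (a \<otimes>\<^bsub>alt_group 5\<^esub> b) = \<phi> h a \<otimes>\<^bsub>alt_group 5\<^esub> \<phi> h b"
      using ab \<phi>_mult by (simp add: \<phi>_def alt_group_mult)
  qed (use \<phi>_in in \<open>simp add: \<phi>_def\<close>)
  have sp_mod: "swap_power (nat ((h + k) mod 4)) = swap_power (nat h + nat k)" if "0 \<le> h" "0 \<le> k" for h k :: int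
  proof -
    have "nat ((h + k) mod 4) = (nat h + nat k) mod 4"
      using that by (simp add: nat_mod_distrib nat_add_distrib)
    moreover have "even (m mod 4) = even m" for m :: nat
      by presburger
    ultimately show ?thesis
      by (simp add: swap_power_def)
  qed
  have \<phi>: "\<phi> \<in> hom (integer_mod_group 4) (AutoGroup (alt_group 5))"
  proof (rule homI)
    fix h k :: int assume "h \<in> carrier (integer_mod_group 4)" "k \<in> carrier (integer_mod_group 4)"
    then have hk: "0 \<le> h" "0 \<le> k"
      by (simp_all add: Z4)
    have "\<phi> ((h + k) mod 4) = compose ?A (\<phi> h) (\<phi> k)"
    proof (rule extensionalityI[of _ ?A])
      fix a assume a: "a \<in> ?A"
      have "swap_power (nat h + nat k) \<circ> a \<circ> swap_power (nat k + nat h) =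
          swap_power (nat h) \<circ> (swap_power (nat k) \<circ> a \<circ> swap_power (nat k)) \<circ> swap_power (nat h)"
        by (simp only: swap_power(3)[symmetric] o_assoc)
      then show "\<phi> ((h + k) mod 4) a = compose ?A (\<phi> h) (\<phi> k) a"
        using a \<phi>_in[OF a] by (simp add: \<phi>_def compose_def sp_mod[OF hk] add.commute)
    qed (simp_all add: \<phi>_def)
    then show "\<phi> (h \<otimes>\<^bsub>integer_mod_group 4\<^esub> k) = \<phi> h \<otimes>\<^bsub>AutoGroup (alt_group 5)\<^esub> \<phi> k"
      using Bij by (simp add: AutoGroup_def BijGroup_def)
  qed (use auto in \<open>simp add: AutoGroup_def BijGroup_def\<close>)
  let ?S = "semidirect_product (alt_group 5) \<phi> (integer_mod_group 4)"
  have carrier: "carrier ?S = X"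
    by (simp add: semidirect_product_def X_def Z4)
  have "F \<in> hom ?S (Aut M)"
  proof (rule homI)
    fix x assume "x \<in> carrier ?S"
    then show "F x \<in> carrier (Aut M)"
      using F(1) unfolding carrier by (cases x) (simp add: Aut_def)
  next
    fix x y assume "x \<in> carrier ?S" "y \<in> carrier ?S"
    then obtain a h b k where xy: "x = (a, h)" "y = (b, k)" "(a, h) \<in> X" "(b, k) \<in> X"
      unfolding carrier by (cases x; cases y) auto
    then have hk: "0 \<le> h" "0 \<le> k" and ab: "a \<in> ?A" "b \<in> ?A"
      by (auto simp: X_def)
    let ?z = "(a \<circ> (swap_power (nat h) \<circ> b \<circ> swap_power (nat h)), (h + k) mod 4)"
    have "a \<circ> (swap_power (nat h) \<circ> b \<circ> swap_power (nat h)) \<in> ?A"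
      using ab(1) \<phi>_in[OF ab(2), of "nat h"] comp_even permutes_compose unfolding A by blast
    then have z: "?z \<in> X"
      by (simp add: X_def)
    have "nat ((h + k) mod 4) = (nat h + nat k) mod 4"
      using hk by (simp add: nat_mod_distrib nat_add_distrib)
    \<comment> \<open>The two copies of \<open>swap_power (nat h)\<close> that meet after
      \<open>b\<close> cancel, so the product taken in the semidirect product has as parameter the
      composite of the two parameters.\<close>
    moreover have "a \<circ> (swap_power (nat h) \<circ> b \<circ> swap_power (nat h)) \<circ> swap_power (nat ((h + k) mod 4)) =
        (a \<circ> swap_power (nat h)) \<circ> (b \<circ> swap_power (nat k))"
      using swap_power_cancel[of "a \<circ> swap_power (nat h) \<circ> b" "nat h"]
      unfolding sp_mod[OF hk] swap_power(3)[symmetric] by (simp only: o_assoc)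
    ultimately have "twisted (F x \<circ> F y) (fst ?z \<circ> swap_power (nat (snd ?z))) (nat (snd ?z))"
      using twisted_mod_4[OF twisted_comp[OF F(2)[OF xy(3)] F(2)[OF xy(4)]]] by (simp add: xy(1,2))
    moreover have "twisted (F ?z) (fst ?z \<circ> swap_power (nat (snd ?z))) (nat (snd ?z))"
      using F(2)[OF z] by simp
    ultimately have "F ?z = F x \<circ> F y"
      using twisted_unique by blast
    then show "F (x \<otimes>\<^bsub>?S\<^esub> y) = F x \<otimes>\<^bsub>Aut M\<^esub> F y"
      using ab by (simp add: xy(1,2) semidirect_product_def Aut_def \<phi>_def alt_group_mult)
  qed
  moreover have onto: "F ` X = ?G"
  proof (intro equalityI subsetI)
    fix \<pi> assume \<pi>: "\<pi> \<in> ?G"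
    then obtain s c where sc: "twisted \<pi> s c" "E \<pi> = (s \<circ> swap_power c, int c)"
      using E by blast
    then have X: "(s \<circ> swap_power c, int c) \<in> X"
      using E_X \<pi> by force
    have "F (s \<circ> swap_power c, int c) = \<pi>"
      using F(2)[OF X] sc(1) by (intro twisted_unique) (simp_all add: swap_power_cancel)
    then show "\<pi> \<in> F ` X"
      using X by blast
  qed (use F(1) in auto)
  moreover have "inj_on F X"
    by (rule eq_card_imp_inj_on[OF finX]) (simp only: onto card cardX)
  ultimately have "F \<in> iso ?S (Aut M)"
    by (simp add: iso_def bij_betw_def carrier Aut_def)
  then have "Aut M \<cong> ?S"
    by (rule group.iso_sym[OF group_semidirect_product[OF alt_group_is_group group_integer_mod_group \<phi>] is_isoI])
  then show "iso_semidirect (Aut M) (alt_group 5) (integer_mod_group 4)"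
    unfolding iso_semidirect_def using \<phi> by blast
qed

end

section \<open>Classification\<close>

lemma combinatorially_equivalent_refl: "M \<sim>\<^sub>c M"
  unfolding combinatorially_equivalent_def by (intro exI[of _ id]) simp

lemma combinatorially_equivalent_image:
  assumes "inj e"
  shows "M \<sim>\<^sub>c (`) e ` M"
  unfolding combinatorially_equivalent_def
proof (intro exI conjI ballI)
  show "bij_betw ((`) e) M ((`) e ` M)"
    using inj_image_eq_iff[OF assms] by (intro inj_on_imp_bij_betw inj_onI) blast
  show "F \<subseteq> G \<longleftrightarrow> e ` F \<subseteq> e ` G" for F G
    using inj_image_subset_iff[OF assms] by blast
qed

lemma abstract_complexD:
  assumes "abstract_complex M"
  shows "{} \<notin> M" and "F \<in> M \<Longrightarrow> G \<subseteq> F \<Longrightarrow> G \<noteq> {} \<Longrightarrow> G \<in> M"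
proof -
  note c = assms[unfolded abstract_complex_def, THEN conjunct2]
  note * = c[THEN conjunct1] c[THEN conjunct2]
  show "{} \<notin> M" using bspec[OF *(1)] by metis
  show "F \<in> M \<Longrightarrow> G \<subseteq> F \<Longrightarrow> G \<noteq> {} \<Longrightarrow> G \<in> M" using *(2) by metis
qed

text \<open>An isomorphism of face posets preserves minimal faces, which are the vertices, and a
  face is determined by the vertices below it. So \<open>\<phi>\<close> is induced by the vertex map
  \<open>e\<close> that it defines on singletons.\<close>

lemma combinatorially_equivalent_imp_image:
  assumes M: "abstract_complex M" and M': "abstract_complex M'" and eq: "M \<sim>\<^sub>c M'"
  shows "\<exists>e. bij_betw e (vertices M) (vertices M') \<and> M' = (`) e ` M"
proof -
  have ne: "{} \<notin> M" "{} \<notin> M'" 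
    by (rule abstract_complexD[OF M], rule abstract_complexD[OF M'])
  have down: "{v} \<in> K" if "abstract_complex K" "F \<in> K" "v \<in> F" for K :: "'c set set" and F v
    by (rule abstract_complexD(2)[OF that(1,2)]) (use that(3) in simp_all)
  note down = down[OF M] down[OF M']
  obtain \<phi> where bij: "bij_betw \<phi> M M'" and "\<forall>F\<in>M. \<forall>G\<in>M. F \<subseteq> G \<longleftrightarrow> \<phi> F \<subseteq> \<phi> G"
    using eq unfolding combinatorially_equivalent_def by (elim exE conjE)
  note ord = bspec[OF bspec[OF this(2)]]
  have im: "\<phi> ` M = M'" and inj: "inj_on \<phi> M"
    using bij by (auto simp: bij_betw_def)
  \<comment> \<open>A vertex of \<open>\<phi> F\<close> is itself a face of \<open>M'\<close>; its
    preimage lies below \<open>F\<close> because \<open>\<phi>\<close> reflects inclusion.\<close>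
  have pre: "\<exists>G\<in>M. {w} = \<phi> G \<and> G \<subseteq> F" if "F \<in> M" "w \<in> \<phi> F" for F w
  proof -
    have "\<phi> F \<in> M'" using im that(1) by blast
    then have "{w} \<in> M'" using down(2) that(2) by blast
    then obtain G where "G \<in> M" "{w} = \<phi> G" using im by blast
    then show ?thesis using ord[of G F] that by auto
  qed
  define e where "e v = the_elem (\<phi> {v})" for v
  have e: "\<phi> {v} = {e v}" if v: "{v} \<in> M" for v
  proof -
    have "\<phi> {v} \<noteq> {}" using im v ne by force
    then obtain w where "w \<in> \<phi> {v}" by blast
    then obtain G where "G \<in> M" "{w} = \<phi> G" "G \<subseteq> {v}" using pre[OF v] by blast
    moreover then have "G = {v}" using ne by (metis subset_singletonD)
    ultimately show ?thesis by (metis e_def the_elem_eq)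
  qed
  have img: "\<phi> F = e ` F" if F: "F \<in> M" for F
  proof (intro equalityI subsetI)
    fix w assume "w \<in> \<phi> F"
    then obtain G where G: "G \<in> M" "{w} = \<phi> G" "G \<subseteq> F" using pre[OF F] by blast
    then obtain v where v: "v \<in> G" using ne by fastforce
    then have "{v} \<in> M" using down(1) G(1) by blast
    then have "{e v} \<subseteq> {w}" using ord[of "{v}" G] e G v by auto
    then show "w \<in> e ` F" using v G(3) by blast
  next
    fix w assume "w \<in> e ` F"
    then obtain v where v: "v \<in> F" "w = e v" by blast
    then have "{v} \<in> M" using down(1) F by blast
    then show "w \<in> \<phi> F" using ord[of "{v}" F] e F v by auto
  qed
  have "inj_on e (vertices M)"
  proof (rule inj_onI)
    fix v w assume "v \<in> vertices M" "w \<in> vertices M" and eq: "e v = e w"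
    then have vw: "{v} \<in> M" "{w} \<in> M" using down(1) by (auto simp: vertices_def)
    then have "\<phi> {v} = \<phi> {w}" using e eq by simp
    then show "v = w" using inj_onD[OF inj _ vw] by simp
  qed
  moreover have M'_eq: "M' = (`) e ` M"
    using im img by auto
  moreover have "e ` vertices M = vertices M'"
    unfolding M'_eq vertices_def by auto
  ultimately show ?thesis
    unfolding bij_betw_def by blast
qed

lemma automorphism_conjugate:
  assumes \<pi>: "automorphism M \<pi>" and V: "vertices M = UNIV" and e: "bij e"
  shows "automorphism ((`) e ` M) (e \<circ> \<pi> \<circ> (inv_into UNIV e))"
proof -
  have b: "bij \<pi>" and iff: "\<pi> ` F \<in> M \<longleftrightarrow> F \<in> M" for F
    using \<pi> V permutes_bij unfolding automorphism_def by (metis, metis subset_UNIV)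
  have V': "vertices ((`) e ` M) = UNIV"
    using V bij_is_surj[OF e] unfolding vertices_def by (metis image_Union)
  have mem: "F \<in> (`) e ` M \<longleftrightarrow> (inv_into UNIV e) ` F \<in> M" for F
    using bij_is_inj[OF e] bij_is_surj[OF e]
    by (metis (no_types, lifting) image_f_inv_f image_inv_f_f imageE imageI)
  have pinv: "(inv_into UNIV e) ` (e \<circ> \<pi> \<circ> (inv_into UNIV e)) ` F = \<pi> ` (inv_into UNIV e) ` F" for F
    using bij_is_inj[OF e] by (simp add: image_comp comp_def)
  have "e \<circ> \<pi> \<circ> inv_into UNIV e permutes UNIV"
    by (intro bij_imp_permutes bij_comp bij_imp_bij_inv b e) simp
  then show ?thesis
    unfolding automorphism_def V' mem pinv iff by simp
qed

lemma card_automorphisms_le: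
  fixes M :: "'a::finite set set" and e :: "'a \<Rightarrow> 'b::finite"
  assumes "vertices M = UNIV" "bij e"
  shows "card {\<pi>. automorphism M \<pi>} \<le> card {\<pi>. automorphism ((`) e ` M) \<pi>}"
proof (rule card_inj_on_le[of "\<lambda>\<pi>. e \<circ> \<pi> \<circ> (inv_into UNIV e)"])
  show "inj_on (\<lambda>\<pi>. e \<circ> \<pi> \<circ> (inv_into UNIV e)) {\<pi>. automorphism M \<pi>}"
  proof (rule inj_onI)
    fix \<pi> \<sigma> assume eq: "e \<circ> \<pi> \<circ> (inv_into UNIV e) = e \<circ> \<sigma> \<circ> (inv_into UNIV e)"
    show "\<pi> = \<sigma>"
    proof
      fix x
      show "\<pi> x = \<sigma> x"
        using fun_cong[OF eq, of "e x"] bij_is_inj[OF assms(2)] by (simp add: inj_eq)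
    qed
  qed
qed (use automorphism_conjugate[OF _ assms] in auto)

text \<open>Conjugation by the bijection of vertices embeds each automorphism group in the other, so
  complexes with groups of different orders are inequivalent.\<close>

lemma combinatorially_equivalent_card_automorphisms:
  fixes M M' :: "'a::finite set set"
  assumes "abstract_complex M" "abstract_complex M'" "vertices M = UNIV" "vertices M' = UNIV" "M \<sim>\<^sub>c M'"
  shows "card {\<pi>. automorphism M \<pi>} = card {\<pi>. automorphism M' \<pi>}"
proof -
  obtain e where e: "bij e" "M' = (`) e ` M"
    using combinatorially_equivalent_imp_image[OF assms(1,2,5)] assms(3,4) by auto
  have "M = (`) (inv_into UNIV e) ` M'"
    using bij_is_inj[OF e(1)] by (simp add: e(2) image_image)
  then show ?thesis
    using card_automorphisms_le[OF assms(3) e(1)] card_automorphisms_le[OF assms(4) bij_imp_bij_inv[OF e(1)]] e(2)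
    by simp
qed

lemma iso_semidirect_card:
  assumes "iso_semidirect (Aut M) N H"
  shows "card {\<pi>. automorphism M \<pi>} = card (carrier N) * card (carrier H)"
proof -
  obtain \<phi> h where "h \<in> iso (Aut M) (semidirect_product N \<phi> H)"
    using assms unfolding iso_semidirect_def is_iso_def by blast
  then have "bij_betw h {\<pi>. automorphism M \<pi>} (carrier N \<times> carrier H)"
    by (simp add: iso_def Aut_def semidirect_product_def)
  then show ?thesis
    by (simp add: bij_betw_same_card card_cartesian_product)
qed

section \<open>From an admissible complex to its set of facet orbits\<close>

lemma vtx_surj: "\<exists>v. w = vtx v \<and> v \<in> set core"
proof -
  have "w \<in> vtx ` set core"
    by (simp only: vtx_core UNIV_I)
  then show ?thesis by (rule imageE) (intro exI conjI)
qed

lemma admissible_rot_image: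
  assumes M: "admissible M" and F: "F \<subseteq> set core"
  shows "vtx ` (rot ^^ k) ` F \<in> M \<longleftrightarrow> vtx ` F \<in> M"
proof (induction k)
  case (Suc k)
  have sub: "(rot ^^ k) ` F \<subseteq> set core"
    using image_mono[OF F] rot_pow_core by metis
  have "zeta ` vtx ` (rot ^^ k) ` F = vtx ` rot ` (rot ^^ k) ` F"
    unfolding image_image[of zeta] image_image[of vtx rot]
  proof (rule image_cong[OF refl])
    show "zeta (vtx x) = vtx (rot x)" if "x \<in> (rot ^^ k) ` F" for x
      by (rule vtx_rot[symmetric]) (rule subsetD[OF sub that])
  qed
  moreover have "zeta ` G \<in> M \<longleftrightarrow> G \<in> M" for G
    using M unfolding admissible_def automorphism_def by (metis subset_UNIV)
  ultimately have "vtx ` rot ` (rot ^^ k) ` F \<in> M \<longleftrightarrow> vtx ` F \<in> M"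
    using Suc by metis
  then show ?case
    by (simp only: funpow.simps image_comp)
qed simp

lemma admissible_canon:
  assumes "admissible M" "set l \<subseteq> set core"
  shows "vtx ` set (canon l) \<in> M \<longleftrightarrow> vtx ` set l \<in> M"
  using canon[of l] admissible_rot_image[OF assms] by metis

lemma admissible_antipodal:
  assumes M: "admissible M" and x: "x \<in> set core"
  shows "vtx ` {x, anti x} \<notin> M"
proof -
  define Q where "Q x \<longleftrightarrow> vtx ` {x, anti x} \<notin> M" for x
  have step: "Q (rot x)" if "x \<in> set core" "anti x \<in> set core" "Q x" for x
  proof -
    have "{x, anti x} \<subseteq> set core" using that(1,2) by blast
    from admissible_rot_image[OF M this, of 1] show ?thesis
      using that(3) by (simp add: Q_def anti_def)
  qed
  have "Q V0"
    using M by (simp add: Q_def anti_def admissible_def diagonal_def)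
  then have "\<forall>x\<in>set core. Q x"
    using step[of V0] step[of V1] step[of V2] step[of V3] step[of V4] step[of V5] step[of V6] step[of V7]
      step[of V8] step[of V9] step[of V10] by (simp add: anti_def)
  then show ?thesis
    using x unfolding Q_def by blast
qed

lemma base_index: "l \<in> base ` set ts \<Longrightarrow> base (base_index ts l) = l"
  by (induction ts l rule: base_index.induct) auto

lemma base_core: "set (base t) \<subseteq> set core"
  by (cases t) simp_all

lemma subset_closed:
  assumes "admissible M" "F \<in> M" "G \<subseteq> F" "G \<noteq> {}"
  shows "G \<in> M"
  by (rule abstract_complexD(2)[OF _ assms(2-4)]) (use assms(1) in \<open>simp add: admissible_def combinatorial_manifold_def\<close>)

text \<open>If \<open>R\<close> spans no face, neither does any completion. Otherwise there are
  exactly two, and \<open>cofacets\<close> misses none of them, since a facet contains no antipodal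
  pair.\<close>

lemma ridge_count:
  assumes M: "admissible M" and R: "distinct R" "length R = 4" "set R \<subseteq> set core"
  shows "length (filter (\<lambda>v. vtx ` set (v # R) \<in> M) (cofacets R)) \<in> {0, 2}"
proof -
  let ?A = "{v \<in> set (cofacets R). vtx ` set (v # R) \<in> M}" and ?R = "vtx ` set R"
  have cof: "v \<in> set (cofacets R) \<longleftrightarrow> v \<in> set core \<and> v \<notin> set R \<and> anti v \<notin> set R" for v
    by (simp only: cofacets_def set_filter mem_Collect_eq mem_iff split: if_splits) blast
  have A: "?A \<subseteq> set core"
    using cof by blast
  have "distinct core" by simp
  then have "distinct (cofacets R)"
    unfolding cofacets_def by (rule distinct_filter)
  then have len: "length (filter (\<lambda>v. vtx ` set (v # R) \<in> M) (cofacets R)) = card ?A"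
    using distinct_card[OF distinct_filter, of "cofacets R" "\<lambda>v. vtx ` set (v # R) \<in> M"] by (metis set_filter)
  have img: "vtx ` ?A = {w. w \<notin> ?R \<and> insert w ?R \<in> M}"
  proof (intro equalityI subsetI)
    fix w assume "w \<in> vtx ` ?A"
    then obtain v where v: "w = vtx v" "v \<in> set core" "v \<notin> set R" "vtx ` set (v # R) \<in> M"
      using cof by blast
    then have "vtx v \<notin> ?R"
      using inj_on_image_mem_iff[OF inj_on_vtx v(2) R(3)] by blast
    then show "w \<in> {w. w \<notin> ?R \<and> insert w ?R \<in> M}"
      using v by (simp only: list.set image_insert mem_Collect_eq not_False_eq_True simp_thms)
  next
    fix w assume "w \<in> {w. w \<notin> ?R \<and> insert w ?R \<in> M}"
    then have w: "w \<notin> ?R" "insert w ?R \<in> M" by blast+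
    obtain v where v: "w = vtx v" "v \<in> set core"
      using vtx_surj by metis
    have "anti v \<notin> set R"
    proof
      assume "anti v \<in> set R"
      then have "vtx ` {v, anti v} \<subseteq> insert w ?R"
        using v by blast
      then show False
        using subset_closed[OF M w(2)] admissible_antipodal[OF M v(2)] by blast
    qed
    then have "v \<in> ?A"
      using w v cof by (metis (mono_tags, lifting) image_eqI image_insert list.set(2) mem_Collect_eq)
    then show "w \<in> vtx ` ?A"
      using v(1) by blast
  qed
  have card: "card ?A = card {w. w \<notin> ?R \<and> insert w ?R \<in> M}"
    unfolding img[symmetric] by (rule card_image[symmetric], rule inj_on_subset[OF inj_on_vtx A])
  show ?thesis
  proof (cases "?R \<in> M")
    case True
    have "card ?R = 4"
      using card_image[OF inj_on_subset[OF inj_on_vtx R(3)]] distinct_card[OF R(1)] R(2) by simp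
    then have "card {w. w \<notin> ?R \<and> insert w ?R \<in> M} = 2"
      using ridge_in_two_facets True M unfolding admissible_def by blast
    then show ?thesis
      using len card by simp
  next
    case False
    have "?R \<noteq> {}" using R(2) by auto
    then have "{w. w \<notin> ?R \<and> insert w ?R \<in> M} = {}"
      using subset_closed[OF M, of _ ?R] False by blast
    then show ?thesis
      using len card by simp
  qed
qed

text \<open>Membership in \<open>M\<close> is constant on rotation orbits and \<open>canon\<close>
  stays within an orbit. Counting the completions of a ridge that are facets therefore counts the
  chosen entries of its row, with multiplicity.\<close>

lemma admissible_constraints:
  assumes M: "admissible M" and c: "c \<in> set ridge_constraints"
  shows "length (filter (\<lambda>t. vtx ` set (base t) \<in> M) c) \<in> {0, 2}"
proof -
  obtain R where R: "R \<in> set ridges" "c = map (\<lambda>v. base_index all_labels (canon (v # R))) (cofacets R)"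
    using c unfolding ridge_constraints[symmetric] set_map by blast
  have props: "distinct R" "length R = 4" "set R \<subseteq> set core"
    "\<forall>v\<in>set (cofacets R). canon (v # R) \<in> base ` set all_labels"
    using ridge_cofacets R(1) unfolding list_all_iff mem_iff set_map by blast+
  have "vtx ` set (base (base_index all_labels (canon (v # R)))) \<in> M \<longleftrightarrow> vtx ` set (v # R) \<in> M"
    if "v \<in> set (cofacets R)" for v
  proof -
    have "v \<in> set core" using that unfolding cofacets_def set_filter by blast
    then have "set (v # R) \<subseteq> set core"
      using props(3) by (simp only: list.set insert_subset)
    then show ?thesis
      using admissible_canon[OF M] base_index props(4) that by metis
  qed
  then have "filter (\<lambda>v. vtx ` set (base (base_index all_labels (canon (v # R)))) \<in> M) (cofacets R) =
      filter (\<lambda>v. vtx ` set (v # R) \<in> M) (cofacets R)"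
    by (rule filter_cong[OF refl])
  then show ?thesis
    using ridge_count[OF M props(1-3)] unfolding R(2) filter_map length_map comp_def by simp
qed

lemma complex_of_facets_rot_pow:
  assumes "(rot ^^ k) ` H \<in> complex_of (facets bs)"
  shows "H \<in> complex_of (facets bs)"
  using assms
proof (induction k)
  case (Suc k)
  have "rot ` (rot ^^ k) ` H = (rot ^^ Suc k) ` H"
    by (simp only: funpow.simps image_comp)
  then have "rot ` (rot ^^ k) ` H \<in> (`) rot ` complex_of (facets bs)"
    using Suc.prems facets_rot by metis
  then obtain G where "rot ` (rot ^^ k) ` H = rot ` G" "G \<in> complex_of (facets bs)"
    by (rule imageE)
  then show ?case
    using inj_image_eq_iff[OF inj_rot] Suc.IH by metis
qed simp

lemma admissible_facet_canon:
  assumes M: "admissible M" and F: "F \<in> M"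
  shows "\<exists>t H k. F \<subseteq> vtx ` H \<and> (rot ^^ k) ` H = set (base t) \<and> vtx ` set (base t) \<in> M \<and> H \<subseteq> set core"
proof -
  obtain G where G: "G \<in> M" "F \<subseteq> G" "card G = 5"
    using face_in_facet[of 4 M F] M F by (auto simp: admissible_def)
  define H where "H = {x \<in> set core. vtx x \<in> G}"
  have Hc: "H \<subseteq> set core" unfolding H_def by blast
  have vH: "vtx ` H = G"
  proof (intro equalityI subsetI)
    fix w assume "w \<in> G"
    then show "w \<in> vtx ` H"
      using vtx_surj[of w] unfolding H_def by (metis (mono_tags, lifting) imageI mem_Collect_eq)
  qed (auto simp: H_def)
  have cH: "card H = 5"
    using card_image[OF inj_on_subset[OF inj_on_vtx Hc]] vH G(3) by simp
  have pair: "\<not> {fst p, snd p} \<subseteq> H" if "p \<in> set pairs" for p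
  proof
    assume sub: "{fst p, snd p} \<subseteq> H"
    have p: "snd p = anti (fst p)" "fst p \<in> set core"
      using that by (auto simp: pairs_def anti_def)
    have "vtx ` {fst p, anti (fst p)} \<subseteq> G"
      using image_mono[OF sub, of vtx] unfolding p(1) vH .
    then show False
      using subset_closed[OF M G(1)] admissible_antipodal[OF M p(2)] by blast
  qed
  have "H \<subseteq> (\<Union>p\<in>set pairs. {fst p, snd p})"
    using Hc by (rule order_trans) (simp add: pairs_def)
  then obtain l where l: "l \<in> set (transversals 5 pairs)" "set l = H"
    using transversals[of H pairs 5] pair cH by (metis card.infinite zero_neq_numeral)
  obtain t where t: "canon l = base t"
    using canon_transversals l(1) unfolding list_all_iff mem_iff set_map by blast
  obtain k where k: "set (canon l) = (rot ^^ k) ` H"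
    using canon[of l] l(2) by blast
  have "vtx ` set (base t) \<in> M"
    using admissible_canon[OF M, of l] l(2) Hc vH G(1) t by simp
  then show ?thesis
    using G(2) vH k t Hc by metis
qed

text \<open>Since every face lies in a 4-face and every 4-face is a rotation of a base,
  \<open>M\<close> is generated by the bases that it contains; the ridge condition puts this
  selection among the solutions of the constraints.\<close>

lemma admissible_candidate:
  assumes M: "admissible M"
  shows "\<exists>S\<in>set candidates. M = realize (map base S)"
proof -
  let ?P = "\<lambda>t. vtx ` set (base t) \<in> M"
  let ?xs = "[V10, V5, V11, V13, V8, V9, V4, V2, V14, V15, V1, V3, V0, V7, V6, V12]"
  have xs: "t \<in> set ?xs" for t by (cases t) simp_all
  have "\<forall>c\<in>set ridge_constraints. length (filter ?P c) \<in> {0, 2}"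
    using admissible_constraints[OF M] by blast
  then have "\<exists>S\<in>set candidates. set S = set [] \<union> {t \<in> set ?xs. ?P t}"
    unfolding candidates_def by (intro solutions_complete) simp_all
  then obtain S where S: "S \<in> set candidates" "set S = set [] \<union> {t \<in> set ?xs. ?P t}"
    by (rule bexE)
  have inS: "t \<in> set S \<longleftrightarrow> ?P t" for t
    unfolding S(2) using xs by simp
  have "F \<in> M" if "F \<in> realize (map base S)" for F
  proof -
    obtain H where H: "F = vtx ` H" "H \<in> complex_of (facets (map base S))"
      using \<open>F \<in> realize (map base S)\<close> unfolding realize_def by (rule imageE)
    then obtain f where H: "F = vtx ` H" "H \<noteq> {}" "f \<in> set (facets (map base S))" "H \<subseteq> set f"
      unfolding complex_of_def mem_Collect_eq by (elim conjE bexE)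
    obtain t k where t: "t \<in> set S" "f = map (rot ^^ k) (base t)"
      using H(3) unfolding in_facets set_map by blast
    have "vtx ` set f \<in> M"
      using admissible_rot_image[OF M base_core] t inS by simp
    then show ?thesis
      using subset_closed[OF M, of "vtx ` set f" F] H by blast
  qed
  moreover have "F \<in> realize (map base S)" if "F \<in> M" for F
  proof -
    obtain t H k where t: "F \<subseteq> vtx ` H" "(rot ^^ k) ` H = set (base t)" "?P t"
      using admissible_facet_canon[OF M \<open>F \<in> M\<close>] by blast
    have "base t \<in> set (facets (map base S))"
      unfolding in_facets using inS t(3) by (intro bexI[of _ "base t"] exI[of _ 0]) simp_all
    moreover have "set (base t) \<noteq> {}" by (cases t) simp_all
    ultimately have "(rot ^^ k) ` H \<in> complex_of (facets (map base S))"
      unfolding t(2) complex_of_def by blast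
    then have H: "H \<in> complex_of (facets (map base S))"
      by (rule complex_of_facets_rot_pow)
    then have "vtx ` H \<in> realize (map base S)"
      unfolding realize_def by blast
    moreover have "F \<noteq> {}"
      using M that abstract_complexD(1)[of M] by (auto simp: admissible_def combinatorial_manifold_def)
    ultimately show ?thesis
      using abstract_complexD(2)[OF realize_abstract_complex] t(1) by blast
  qed
  ultimately show ?thesis
    using S(1) by blast
qed

lemma realize_same_bases:
  assumes "same_bases bs cs"
  shows "realize bs = realize cs"
proof -
  have "set bs = set cs"
    using assms by (auto simp: same_bases_def)
  then show ?thesis
    by (simp add: realize_def complex_of_def facets_def)
qed

lemma vtx_neg: "x \<in> set core \<Longrightarrow> vtx (neg x) = - vtx x"
  by (cases x) simp_all

text \<open>Mirrored bases need not be in the normal form of \<open>base\<close>;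
  \<open>canon\<close> restores it, so that they can be compared with the candidates entry by entry.
  The hypothesis \<open>same\<close> certifies that the normalized bases generate the mirrored
  complex.\<close>

lemma realize_neg:
  assumes same: "same_complex (facets (map (\<lambda>b. canon (map neg b)) bs)) (map (map neg) (facets bs))"
    and bs: "in_core bs"
  shows "(`) uminus ` realize (map (\<lambda>b. canon (map neg b)) bs) = realize bs"
proof -
  have "vtx ` neg ` F = uminus ` vtx ` F" if "F \<in> complex_of (facets bs)" for F
    unfolding image_image
    by (rule image_cong[OF refl], rule vtx_neg) (use complex_of_core[OF bs that] in blast)
  then have "realize (map (\<lambda>b. canon (map neg b)) bs) = (`) uminus ` realize bs"
    unfolding realize_def same_complex[OF same] complex_of_map image_image
    by (rule image_cong[OF refl])
  then show ?thesis
    by (simp add: image_image)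
qed

lemma same_complex_neg_1: "same_complex (facets (map (\<lambda>b. canon (map neg b)) bases1)) (map (map neg) (facets bases1))"
  by code_simp

lemma same_complex_neg_2: "same_complex (facets (map (\<lambda>b. canon (map neg b)) bases2)) (map (map neg) (facets bases2))"
  by code_simp

lemma admissible_classification:
  assumes M: "admissible M"
  shows "M \<sim>\<^sub>c realize bases1 \<or> M \<sim>\<^sub>c realize bases2 \<or> M \<sim>\<^sub>c realize bases3"
proof -
  obtain S where S: "S \<in> set candidates" "M = realize (map base S)"
    using admissible_candidate[OF M] by blast
  have "in_core (map base S)"
    using base_core by (simp only: in_core_def set_map) blast
  then have "counts_ok (map base S)"
    using admissible_counts_ok M S(2) by blast
  moreover then have "kcount 5 core (facets (map base S)) = 72"
    unfolding counts_ok_def Let_def by blast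
  ultimately consider "same_bases (map base S) bases1" | "same_bases (map base S) bases2"
    | "same_bases (map base S) bases3" | "same_bases (map base S) (map (\<lambda>b. canon (map neg b)) bases1)"
    | "same_bases (map base S) (map (\<lambda>b. canon (map neg b)) bases2)"
    using bspec[OF candidates[unfolded list_all_iff] S(1)] unfolding Let_def by metis
  then show ?thesis
  proof cases
    case 4
    have "M \<sim>\<^sub>c (`) uminus ` M"
      by (rule combinatorially_equivalent_image) simp
    then show ?thesis
      using realize_neg[OF same_complex_neg_1 in_core_bases(1)] realize_same_bases[OF 4] S(2) by metis
  next
    case 5
    have "M \<sim>\<^sub>c (`) uminus ` M"
      by (rule combinatorially_equivalent_image) simp
    then show ?thesis
      using realize_neg[OF same_complex_neg_2 in_core_bases(2)] realize_same_bases[OF 5] S(2) by metis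
  qed (use S(2) realize_same_bases combinatorially_equivalent_refl in metis)+
qed

lemma admissible_bases:
  shows "admissible (realize bases1)" "admissible (realize bases2)" "admissible (realize bases3)"
proof -
  show "admissible (realize bases1)"
    by (rule admissible_realize[OF combinatorial_manifold_1]; code_simp)
  show "admissible (realize bases2)"
    by (rule admissible_realize[OF combinatorial_manifold_2]; code_simp)
  show "admissible (realize bases3)"
    by (rule admissible_realize[OF combinatorial_manifold_3]; code_simp)
qed

lemma realize_PL_homeomorphic:
  assumes "PL_homeomorphic (underlying_space (complex_of (facets bs))) T" "in_core bs"
  shows "PL_homeomorphic (underlying_space (realize bs)) T"
  unfolding realize_def
  using PL_homeomorphic_trans[OF PL_homeomorphic_sym[OF PL_homeomorphic_relabel[OF inj_on_vtx_complex[OF assms(2)]]] assms(1)] .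

theorem theorem1p2:
  shows "\<exists>M\<^sub>1 M\<^sub>2 M\<^sub>3 :: 12 set set.
    admissible M\<^sub>1 \<and> admissible M\<^sub>2 \<and> admissible M\<^sub>3 \<and>
    \<not> M\<^sub>1 \<sim>\<^sub>c M\<^sub>2 \<and> \<not> M\<^sub>1 \<sim>\<^sub>c M\<^sub>3 \<and> \<not> M\<^sub>2 \<sim>\<^sub>c M\<^sub>3 \<and>
    (\<forall>M. admissible M \<longrightarrow> M \<sim>\<^sub>c M\<^sub>1 \<or> M \<sim>\<^sub>c M\<^sub>2 \<or> M \<sim>\<^sub>c M\<^sub>3) \<and>
    PL_homeomorphic (underlying_space M\<^sub>1) PL_S2_times_S2 \<and>
    PL_homeomorphic (underlying_space M\<^sub>2) PL_S2_times_S2 \<and>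
    PL_homeomorphic (underlying_space M\<^sub>3) PL_S2_times_S2 \<and>
    iso_semidirect (Aut M\<^sub>1) (integer_mod_group 12) (integer_mod_group 2) \<and>
    iso_semidirect (Aut M\<^sub>2) (alt_group 5) (integer_mod_group 4) \<and>
    iso_semidirect (Aut M\<^sub>3) (integer_mod_group 12)
      (integer_mod_group 2 \<times>\<times> integer_mod_group 2)"
proof -
  let ?M1 = "realize bases1" and ?M2 = "realize bases2" and ?M3 = "realize bases3"
  note adm = admissible_bases
  note A = Aut1[OF adm(1)] Aut2[OF refl adm(2)] Aut3[OF adm(3)]
  have "card (carrier (integer_mod_group 12 :: int monoid)) = 12" "card (carrier (integer_mod_group 2)) = 2"
    "card (carrier (integer_mod_group 4)) = 4" "card (carrier (alt_group 5)) = 60"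
    using alt_group_card_carrier[of 5] by (simp_all add: carrier_integer_mod_group fact_numeral)
  then have cards: "card {\<pi>. automorphism ?M1 \<pi>} = 24" "card {\<pi>. automorphism ?M2 \<pi>} = 240"
      "card {\<pi>. automorphism ?M3 \<pi>} = 48"
    using A[THEN iso_semidirect_card] by (simp_all add: DirProd_def card_cartesian_product)
  have "\<not> M \<sim>\<^sub>c M'" if "admissible M" "admissible M'" "card {\<pi>. automorphism M \<pi>} \<noteq> card {\<pi>. automorphism M' \<pi>}" for M M'
    using combinatorially_equivalent_card_automorphisms[of M M'] that
    by (auto simp: admissible_def combinatorial_manifold_def)
  then have "\<not> ?M1 \<sim>\<^sub>c ?M2" "\<not> ?M1 \<sim>\<^sub>c ?M3" "\<not> ?M2 \<sim>\<^sub>c ?M3"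
    using adm cards by simp_all
  moreover note realize_PL_homeomorphic[OF facets1_PL_homeomorphic in_core_bases(1)]
    realize_PL_homeomorphic[OF facets2_PL_homeomorphic in_core_bases(2)]
    realize_PL_homeomorphic[OF facets3_PL_homeomorphic in_core_bases(3)]
  ultimately show ?thesis
    using adm A admissible_classification by blast
qed

end
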